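(* Let $\Omega\subset\mathbb R^N$ be a bounded open set, let $\kappa$ be a (positive) Borel measure on $\partial\Omega$ and $\theta$ a symmetric (positive) Radon measure on $(\partial\Omega\times\partial\Omega)\setminus d$, where $d$ is the diagonal, such that the pair $(\kappa,\theta)$ is admissible. Then the operator $\Delta_{\kappa,\theta}$ generates a symmetric sub-Markovian semigroup $(e^{t\Delta_{\kappa,\theta}})_{t\ge0}$ on $L^2(\Omega)$; i.e. $e^{t\Delta_{\kappa,\theta}}\ge0$ for all $t\ge0$ (it maps a.e. nonnegative functions to a.e. nonnegative functions) and $$\|e^{t\Delta_{\kappa,\theta}}f\|_\infty\le\|f\|_\infty\qquad(t\ge0)$$ for all $f\in L^2(\Omega)\cap L^\infty(\Omega)$.
   Context: $C_c(\overline\Omega)$ is the space of continuous real-valued functions with compact support in $\overline\Omega$. The form $\mathcal E_{\kappa,\theta}$ has domain $$E=\Big\{u\in H^1(\Omega)\cap C_c(\overline\Omega):\int_{\partial\Omega}|u|^2\,d\kappa+\int_{(\partial\Omega\times\partial\Omega)\setminus d}(u(x)-u(y))^2\,d\theta(x,y)<\infty\Big\}$$ and is given by $$\mathcal E_{\kappa,\theta}(u,v)=\int_\Omega\nabla u\cdot\nabla v\,dx+\int_{\partial\Omega}uv\,d\kappa+\int_{(\partial\Omega\times\partial\Omega)\setminus d}(u(x)-u(y))(v(x)-v(y))\,d\theta(x,y).$$ $\widetilde H^1(\Omega)$ is the closure of $H^1(\Omega)\cap C_c(\overline\Omega)$ in $H^1(\Omega)$. The relative capacity of $A\subset\overline\Omega$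 is $$\mathrm{Cap}_{\overline\Omega}(A)=\inf\{\|u\|_{H^1(\Omega)}: u\in\widetilde H^1(\Omega),\ \exists\,O\subset\mathbb R^N\text{ open},\ A\subset O,\ u\ge1\text{ a.e. on }\Omega\cap O\}.$$ $\hat\theta$ is the Borel measure on $\partial\Omega$ given by $\hat\theta(B)=\theta((B\times\partial\Omega)\setminus d)$. Let $$\Gamma_{\kappa,\theta}=\{z\in\partial\Omega:\exists r>0,\ \kappa(\partial\Omega\cap B(z,r))+\hat\theta(\partial\Omega\cap B(z,r))<\infty\}.$$ The pair $(\kappa,\theta)$ is admissible if for each Borel set $A\subset\Gamma_{\kappa,\theta}$, $\mathrm{Cap}_{\overline\Omega}(A)=0$ implies $(\kappa+\hat\theta)(A)=0$. When $(\kappa,\theta)$ is admissible the form $(\mathcal E_{\kappa,\theta},E)$ is closable in $L^2(\Omega)$; its closure is denoted by the same symbol, with domain $\mathfrak D$. The operator $-\Delta_{\kappa,\theta}$ is the self-adjoint operator on $L^2(\Omega)$ associated with the closure: $D(\Delta_{\kappa,\theta})=\{u\in\mathfrak D:\exists v\in L^2(\Omega),\ \mathcal E_{\kappa,\theta}(u,\varphi)=(v,\varphi)_{L^2(\Omega)}\ \forall\varphi\in\mathfrak D\}$, $\Delta_{\kappa,\theta}u=-v$. *)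

theory Defs
  imports "HOL-Analysis.Analysis" "HOL-Probability.Essential_Supremum"
begin

section \<open>Lebesgue spaces\<close>

text \<open>
  Elements of the Lebesgue and Sobolev spaces are represented by functions on the whole space, of
  which only the values on \<open>\<Omega>\<close> matter; almost everywhere equality is never turned into a quotient.
\<close>

definition L2 :: "'a::euclidean_space set \<Rightarrow> ('a \<Rightarrow> real) set" where
  "L2 \<Omega> = {f. f \<in> borel_measurable (lebesgue_on \<Omega>) \<and> integrable (lebesgue_on \<Omega>) (\<lambda>x. (f x)\<^sup>2)}"

definition l2_inner :: "'a::euclidean_space set \<Rightarrow> ('a \<Rightarrow> real) \<Rightarrow> ('a \<Rightarrow> real) \<Rightarrow> real" where
  "l2_inner \<Omega> f g = (LINT x|lebesgue_on \<Omega>. f x * g x)"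

definition l2_norm :: "'a::euclidean_space set \<Rightarrow> ('a \<Rightarrow> real) \<Rightarrow> real" where
  "l2_norm \<Omega> f = sqrt (LINT x|lebesgue_on \<Omega>. (f x)\<^sup>2)"

definition linf_norm :: "'a::euclidean_space set \<Rightarrow> ('a \<Rightarrow> real) \<Rightarrow> ereal" where
  "linf_norm \<Omega> f = esssup (lebesgue_on \<Omega>) (\<lambda>x. ereal \<bar>f x\<bar>)"

definition Linf :: "'a::euclidean_space set \<Rightarrow> ('a \<Rightarrow> real) set" where
  "Linf \<Omega> = {f. f \<in> borel_measurable (lebesgue_on \<Omega>) \<and> linf_norm \<Omega> f < \<infinity>}"

section \<open>The first order Sobolev space\<close>

fun Ck :: "nat \<Rightarrow> ('a::euclidean_space \<Rightarrow> real) \<Rightarrow> bool" where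
  "Ck 0 f \<longleftrightarrow> continuous_on UNIV f"
| "Ck (Suc k) f \<longleftrightarrow> (\<forall>x. f differentiable at x) \<and>
     (\<forall>i\<in>Basis. Ck k (\<lambda>x. frechet_derivative f (at x) i))"

definition test_functions :: "'a::euclidean_space set \<Rightarrow> ('a \<Rightarrow> real) set" where
  "test_functions \<Omega> = {\<phi>. (\<forall>k. Ck k \<phi>) \<and> compact (closure {x. \<phi> x \<noteq> 0}) \<and> closure {x. \<phi> x \<noteq> 0} \<subseteq> \<Omega>}"

definition is_weak_gradient ::
    "'a::euclidean_space set \<Rightarrow> ('a \<Rightarrow> real) \<Rightarrow> ('a \<Rightarrow> 'a) \<Rightarrow> bool" where
  "is_weak_gradient \<Omega> u g \<longleftrightarrow>
     g \<in> borel_measurable (lebesgue_on \<Omega>) \<and>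
     integrable (lebesgue_on \<Omega>) (\<lambda>x. (norm (g x))\<^sup>2) \<and>
     (\<forall>\<phi>\<in>test_functions \<Omega>. \<forall>i\<in>Basis.
        (LINT x|lebesgue_on \<Omega>. u x * frechet_derivative \<phi> (at x) i) =
        - (LINT x|lebesgue_on \<Omega>. (g x \<bullet> i) * \<phi> x))"

definition H1 :: "'a::euclidean_space set \<Rightarrow> ('a \<Rightarrow> real) set" where
  "H1 \<Omega> = {u \<in> L2 \<Omega>. \<exists>g. is_weak_gradient \<Omega> u g}"

text \<open>The weak gradient is unique up to null sets; some representative is chosen.\<close>

definition weak_grad :: "'a::euclidean_space set \<Rightarrow> ('a \<Rightarrow> real) \<Rightarrow> 'a \<Rightarrow> 'a" where
  "weak_grad \<Omega> u = (SOME g. is_weak_gradient \<Omega> u g)"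

definition h1_norm :: "'a::euclidean_space set \<Rightarrow> ('a \<Rightarrow> real) \<Rightarrow> real" where
  "h1_norm \<Omega> u = sqrt ((LINT x|lebesgue_on \<Omega>. (u x)\<^sup>2) +
                       (LINT x|lebesgue_on \<Omega>. (norm (weak_grad \<Omega> u x))\<^sup>2))"

definition Cc_closure :: "'a::euclidean_space set \<Rightarrow> ('a \<Rightarrow> real) set" where
  "Cc_closure \<Omega> = {u. continuous_on (closure \<Omega>) u \<and> compact (closure {x \<in> closure \<Omega>. u x \<noteq> 0})}"

definition H1_tilde :: "'a::euclidean_space set \<Rightarrow> ('a \<Rightarrow> real) set" where
  "H1_tilde \<Omega> = {u \<in> H1 \<Omega>. \<forall>e>0. \<exists>w\<in>H1 \<Omega> \<inter> Cc_closure \<Omega>. h1_norm \<Omega> (\<lambda>x. w x - u x) < e}"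

section \<open>Relative capacity and admissible pairs of measures\<close>

definition relative_capacity :: "'a::euclidean_space set \<Rightarrow> 'a set \<Rightarrow> ennreal" where
  "relative_capacity \<Omega> A =
     (INF u\<in>{u \<in> H1_tilde \<Omega>. \<exists>U. open U \<and> A \<subseteq> U \<and> (AE x in lebesgue_on \<Omega>. x \<in> U \<longrightarrow> u x \<ge> 1)}.
        ennreal (h1_norm \<Omega> u))"

text \<open>No finiteness condition of any kind is imposed on a Borel measure.\<close>

definition borel_measure_on :: "'a::topological_space set \<Rightarrow> 'a measure \<Rightarrow> bool" where
  "borel_measure_on X M \<longleftrightarrow> sets M = sets (restrict_space borel X)"

definition radon_measure_on :: "'a::topological_space set \<Rightarrow> 'a measure \<Rightarrow> bool" where
  "radon_measure_on X M \<longleftrightarrow> borel_measure_on X M \<and>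
     (\<forall>K. compact K \<and> K \<subseteq> X \<longrightarrow> emeasure M K < \<infinity>) \<and>
     (\<forall>B\<in>sets M. emeasure M B = (SUP K\<in>{K. compact K \<and> K \<subseteq> B}. emeasure M K))"

definition symmetric_measure :: "('a \<times> 'a) measure \<Rightarrow> bool" where
  "symmetric_measure M \<longleftrightarrow> (\<forall>B\<in>sets M. emeasure M (prod.swap ` B) = emeasure M B)"

definition offdiag_boundary :: "'a::euclidean_space set \<Rightarrow> ('a \<times> 'a) set" where
  "offdiag_boundary \<Omega> = (frontier \<Omega> \<times> frontier \<Omega>) - Id"

definition theta_hat ::
    "'a::euclidean_space set \<Rightarrow> ('a \<times> 'a) measure \<Rightarrow> 'a set \<Rightarrow> ennreal" where
  "theta_hat \<Omega> \<theta> B = emeasure \<theta> ((B \<times> frontier \<Omega>) - Id)"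

definition Gamma_set ::
    "'a::euclidean_space set \<Rightarrow> 'a measure \<Rightarrow> ('a \<times> 'a) measure \<Rightarrow> 'a set" where
  "Gamma_set \<Omega> \<kappa> \<theta> = {z \<in> frontier \<Omega>. \<exists>r>0.
     emeasure \<kappa> (frontier \<Omega> \<inter> ball z r) + theta_hat \<Omega> \<theta> (frontier \<Omega> \<inter> ball z r) < \<infinity>}"

definition admissible ::
    "'a::euclidean_space set \<Rightarrow> 'a measure \<Rightarrow> ('a \<times> 'a) measure \<Rightarrow> bool" where
  "admissible \<Omega> \<kappa> \<theta> \<longleftrightarrow>
     (\<forall>A\<in>sets borel. A \<subseteq> Gamma_set \<Omega> \<kappa> \<theta> \<longrightarrow> relative_capacity \<Omega> A = 0 \<longrightarrow>
        emeasure \<kappa> A + theta_hat \<Omega> \<theta> A = 0)"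

section \<open>The form\<close>

definition form_domain ::
    "'a::euclidean_space set \<Rightarrow> 'a measure \<Rightarrow> ('a \<times> 'a) measure \<Rightarrow> ('a \<Rightarrow> real) set" where
  "form_domain \<Omega> \<kappa> \<theta> = {u \<in> H1 \<Omega> \<inter> Cc_closure \<Omega>.
     (\<integral>\<^sup>+x. ennreal ((u x)\<^sup>2) \<partial>\<kappa>) + (\<integral>\<^sup>+p. ennreal ((u (fst p) - u (snd p))\<^sup>2) \<partial>\<theta>) < \<infinity>}"

definition energy_form ::
    "'a::euclidean_space set \<Rightarrow> 'a measure \<Rightarrow> ('a \<times> 'a) measure \<Rightarrow>
     ('a \<Rightarrow> real) \<Rightarrow> ('a \<Rightarrow> real) \<Rightarrow> real" where
  "energy_form \<Omega> \<kappa> \<theta> u v =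
     (LINT x|lebesgue_on \<Omega>. weak_grad \<Omega> u x \<bullet> weak_grad \<Omega> v x) +
     (LINT x|\<kappa>. u x * v x) +
     (LINT p|\<theta>. (u (fst p) - u (snd p)) * (v (fst p) - v (snd p)))"

section \<open>Closure of a form and the associated operator\<close>

definition approximates ::
    "'a::euclidean_space set \<Rightarrow> ('a \<Rightarrow> real) set \<Rightarrow> (('a \<Rightarrow> real) \<Rightarrow> ('a \<Rightarrow> real) \<Rightarrow> real) \<Rightarrow>
     (nat \<Rightarrow> 'a \<Rightarrow> real) \<Rightarrow> ('a \<Rightarrow> real) \<Rightarrow> bool" where
  "approximates \<Omega> D a us u \<longleftrightarrow>
     u \<in> L2 \<Omega> \<and> (\<forall>n. us n \<in> D) \<and>
     (\<lambda>n. l2_norm \<Omega> (\<lambda>x. us n x - u x)) \<longlonglongrightarrow> 0 \<and>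
     (\<forall>e>0. \<exists>N. \<forall>m\<ge>N. \<forall>n\<ge>N. a (\<lambda>x. us m x - us n x) (\<lambda>x. us m x - us n x) < e)"

definition closable ::
    "'a::euclidean_space set \<Rightarrow> ('a \<Rightarrow> real) set \<Rightarrow> (('a \<Rightarrow> real) \<Rightarrow> ('a \<Rightarrow> real) \<Rightarrow> real) \<Rightarrow> bool" where
  "closable \<Omega> D a \<longleftrightarrow> (\<forall>us. approximates \<Omega> D a us (\<lambda>x. 0) \<longrightarrow> (\<lambda>n. a (us n) (us n)) \<longlonglongrightarrow> 0)"

definition closure_domain ::
    "'a::euclidean_space set \<Rightarrow> ('a \<Rightarrow> real) set \<Rightarrow> (('a \<Rightarrow> real) \<Rightarrow> ('a \<Rightarrow> real) \<Rightarrow> real) \<Rightarrow>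
     ('a \<Rightarrow> real) set" where
  "closure_domain \<Omega> D a = {u. \<exists>us. approximates \<Omega> D a us u}"

definition closure_form ::
    "'a::euclidean_space set \<Rightarrow> ('a \<Rightarrow> real) set \<Rightarrow> (('a \<Rightarrow> real) \<Rightarrow> ('a \<Rightarrow> real) \<Rightarrow> real) \<Rightarrow>
     ('a \<Rightarrow> real) \<Rightarrow> ('a \<Rightarrow> real) \<Rightarrow> real" where
  "closure_form \<Omega> D a u v =
     (THE r. \<forall>us vs. approximates \<Omega> D a us u \<longrightarrow> approximates \<Omega> D a vs v \<longrightarrow>
        (\<lambda>n. a (us n) (vs n)) \<longlonglongrightarrow> r)"

text \<open>
  The graph of minus the operator associated with the closure of a form: \<open>(u, -v)\<close> belongs to it if
  \<open>u\<close> lies in the domain of the closure, \<open>v \<in> L2 \<Omega>\<close>, and the value of the closure at \<open>(u, \<phi>)\<close> is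
  \<open>(v, \<phi>)\<close> for all \<open>\<phi>\<close> in the domain of the closure. The value of the closure is written out as a
  limit along approximating sequences, so that the definition also makes sense for a form that is
  not closable (then the elements of the completion of \<open>D\<close> take the place of the functions in the
  domain of the closure). For a closable form this is literally the usual definition in terms of
  the closure: see \<open>form_operator_closable\<close>.
\<close>

definition form_operator ::
    "'a::euclidean_space set \<Rightarrow> ('a \<Rightarrow> real) set \<Rightarrow> (('a \<Rightarrow> real) \<Rightarrow> ('a \<Rightarrow> real) \<Rightarrow> real) \<Rightarrow>
     (('a \<Rightarrow> real) \<times> ('a \<Rightarrow> real)) set" where
  "form_operator \<Omega> D a = {(u, \<lambda>x. - v x) | u v.
     v \<in> L2 \<Omega> \<and>
     (\<exists>us. approximates \<Omega> D a us u \<and>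
       (\<forall>\<phi> \<phi>s. approximates \<Omega> D a \<phi>s \<phi> \<longrightarrow> (\<lambda>n. a (us n) (\<phi>s n)) \<longlonglongrightarrow> l2_inner \<Omega> v \<phi>))}"

lemma L2_diff_bound:
  assumes "f \<in> L2 \<Omega>" "g \<in> L2 \<Omega>"
  shows "(\<lambda>x. f x - g x) \<in> L2 \<Omega>"
    and "(l2_norm \<Omega> (\<lambda>x. f x - g x))\<^sup>2 \<le> 2 * (l2_norm \<Omega> f)\<^sup>2 + 2 * (l2_norm \<Omega> g)\<^sup>2"
proof -
  have i: "integrable (lebesgue_on \<Omega>) (\<lambda>x. 2 * (f x)\<^sup>2 + 2 * (g x)\<^sup>2)"
    using assms by (auto simp: L2_def)
  have m: "(\<lambda>x. f x - g x) \<in> borel_measurable (lebesgue_on \<Omega>)"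
    using assms by (auto simp: L2_def)
  have pw: "(f x - g x)\<^sup>2 \<le> 2 * (f x)\<^sup>2 + 2 * (g x)\<^sup>2" for x
    using zero_le_power2[of "f x + g x"] by (simp add: power2_eq_square algebra_simps)
  have i2: "integrable (lebesgue_on \<Omega>) (\<lambda>x. (f x - g x)\<^sup>2)"
  proof (rule Bochner_Integration.integrable_bound[OF i])
    show "(\<lambda>x. (f x - g x)\<^sup>2) \<in> borel_measurable (lebesgue_on \<Omega>)"
      using m by (intro borel_measurable_power)
    show "AE x in lebesgue_on \<Omega>. norm ((f x - g x)\<^sup>2) \<le> norm (2 * (f x)\<^sup>2 + 2 * (g x)\<^sup>2)"
      using pw by (intro AE_I2) simp
  qed
  show "(\<lambda>x. f x - g x) \<in> L2 \<Omega>" using m i2 by (simp add: L2_def)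
  have "(LINT x|lebesgue_on \<Omega>. (f x - g x)\<^sup>2) \<le> (LINT x|lebesgue_on \<Omega>. 2 * (f x)\<^sup>2 + 2 * (g x)\<^sup>2)"
    by (intro integral_mono i i2 pw)
  also have "\<dots> = 2 * (LINT x|lebesgue_on \<Omega>. (f x)\<^sup>2) + 2 * (LINT x|lebesgue_on \<Omega>. (g x)\<^sup>2)"
    using assms by (subst Bochner_Integration.integral_add) (auto simp: L2_def)
  finally show "(l2_norm \<Omega> (\<lambda>x. f x - g x))\<^sup>2 \<le> 2 * (l2_norm \<Omega> f)\<^sup>2 + 2 * (l2_norm \<Omega> g)\<^sup>2"
    by (simp add: l2_norm_def)
qed

lemma form_operator_closable:
  fixes \<Omega> :: "'a::euclidean_space set" and a :: "('a \<Rightarrow> real) \<Rightarrow> ('a \<Rightarrow> real) \<Rightarrow> real"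
  assumes D: "D \<subseteq> L2 \<Omega>"
    and lin: "\<And>f g c. f \<in> D \<Longrightarrow> g \<in> D \<Longrightarrow> (\<lambda>x. f x - c * g x) \<in> D"
    and sym: "\<And>f g. f \<in> D \<Longrightarrow> g \<in> D \<Longrightarrow> a f g = a g f"
    and bil: "\<And>f g h c. f \<in> D \<Longrightarrow> g \<in> D \<Longrightarrow> h \<in> D \<Longrightarrow> a (\<lambda>x. f x - c * g x) h = a f h - c * a g h"
    and pos: "\<And>f. f \<in> D \<Longrightarrow> a f f \<ge> 0"
    and cl: "closable \<Omega> D a"
  shows "form_operator \<Omega> D a = {(u, \<lambda>x. - v x) | u v. u \<in> closure_domain \<Omega> D a \<and> v \<in> L2 \<Omega> \<and>
    (\<forall>\<phi>\<in>closure_domain \<Omega> D a. closure_form \<Omega> D a u \<phi> = l2_inner \<Omega> v \<phi>)}"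
proof -
  let ?A = "approximates \<Omega> D a"
  have dD: "(\<lambda>x. f x - g x) \<in> D" if "f \<in> D" "g \<in> D" for f g
    using lin[OF that, of 1] by simp
  have dl: "a (\<lambda>x. f x - g x) h = a f h - a g h" if "f \<in> D" "g \<in> D" "h \<in> D" for f g h
    using bil[OF that, of 1] by simp
  have dr: "a h (\<lambda>x. f x - g x) = a h f - a h g" if "f \<in> D" "g \<in> D" "h \<in> D" for f g h
    using dl[OF that] sym that dD by simp
  have CS: "(a f g)\<^sup>2 \<le> a f f * a g g" if f: "f \<in> D" and g: "g \<in> D" for f g
  proof -
    have q: "0 \<le> a f f - 2 * t * a f g + t\<^sup>2 * a g g" for t
    proof -
      let ?h = "\<lambda>x. f x - t * g x"
      have h: "?h \<in> D" by (rule lin[OF f g])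
      have "a ?h ?h = a f ?h - t * a g ?h" by (rule bil[OF f g h])
      also have "\<dots> = a ?h f - t * a ?h g" using sym h f g by simp
      also have "\<dots> = a f f - 2 * t * a f g + t\<^sup>2 * a g g"
        unfolding bil[OF f g f] bil[OF f g g] sym[OF g f]
        by (simp add: power2_eq_square algebra_simps)
      finally show ?thesis using pos[OF h] by simp
    qed
    show ?thesis
    proof (cases "a g g = 0")
      case True
      have "a f g = 0"
      proof (rule ccontr)
        assume n: "a f g \<noteq> 0"
        show False using q[of "(a f f + 1) / (2 * a f g)"] True n by (simp add: field_simps)
      qed
      then show ?thesis using True by simp
    next
      case False
      then have gp: "a g g > 0" using pos[OF g] by simp
      have "0 \<le> a f f - (a f g)\<^sup>2 / a g g"
        using q[of "a f g / a g g"] gp by (simp add: power2_eq_square)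
      then show ?thesis using gp by (simp add: field_simps)
    qed
  qed
  have CS': "\<bar>a f g\<bar> \<le> sqrt (a f f) * sqrt (a g g)" if f: "f \<in> D" and g: "g \<in> D" for f g
    using CS[OF f g] by (metis real_sqrt_abs real_sqrt_le_mono real_sqrt_mult)
  have par: "a (\<lambda>x. f x - g x) (\<lambda>x. f x - g x) \<le> 2 * a f f + 2 * a g g"
    if f: "f \<in> D" and g: "g \<in> D" for f g
  proof -
    let ?s = "\<lambda>x. f x - (-1) * g x"
    have s: "?s \<in> D" by (rule lin[OF f g])
    have "a ?s ?s = a f f + 2 * a f g + a g g"
      using bil[OF f g s, of "-1"] bil[OF f g f, of "-1"] bil[OF f g g, of "-1"]
        sym[OF f g] sym[OF f s] sym[OF g s] by simp
    moreover have "a (\<lambda>x. f x - g x) (\<lambda>x. f x - g x) = a f f - 2 * a f g + a g g"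
      using dl[OF f g dD[OF f g]] dr[OF f g f] dr[OF f g g] sym[OF f g] by simp
    ultimately show ?thesis using pos[OF s] by simp
  qed
  have bounded: "\<exists>C>0. \<forall>n. sqrt (a (us n) (us n)) \<le> C" if A: "?A us u" for us u
  proof -
    have usD: "us n \<in> D" for n using A by (simp add: approximates_def)
    obtain N where N: "\<And>m n. m \<ge> N \<Longrightarrow> n \<ge> N \<Longrightarrow>
        a (\<lambda>x. us m x - us n x) (\<lambda>x. us m x - us n x) < 1"
      using A unfolding approximates_def by (metis zero_less_one)
    define K where "K = 2 + 2 * a (us N) (us N) + (\<Sum>k\<le>N. a (us k) (us k))"
    have S: "(\<Sum>k\<le>N. a (us k) (us k)) \<ge> 0" by (intro sum_nonneg pos usD)
    have K: "a (us n) (us n) \<le> K" for n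
    proof (cases "n \<ge> N")
      case True
      have "a (us n) (us n) \<le> 2 * a (\<lambda>x. us n x - us N x) (\<lambda>x. us n x - us N x) + 2 * a (us N) (us N)"
      proof -
        let ?d = "\<lambda>x. us n x - us N x" and ?m = "\<lambda>x. us N x - 2 * us N x"
        have m: "?m \<in> D" by (rule lin[OF usD usD])
        have e: "us n = (\<lambda>x. ?d x - ?m x)" by auto
        have mm: "a ?m ?m = a (us N) (us N)"
          using bil[OF usD usD m, of N 2 N] bil[OF usD usD usD, of N 2 N N] sym[OF usD m, of N] by simp
        show ?thesis using par[OF dD[OF usD[of n] usD[of N]] m] unfolding mm e[symmetric] .
      qed
      then show ?thesis using N[OF True order_refl] S unfolding K_def by simp
    next
      case False
      have "a (us n) (us n) \<le> (\<Sum>k\<le>N. a (us k) (us k))"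
        using False by (intro member_le_sum) (auto intro: pos usD)
      then show ?thesis using pos[OF usD[of N]] unfolding K_def by simp
    qed
    have "sqrt (a (us n) (us n)) \<le> sqrt K" for n using K by simp
    moreover have "K > 0" using S pos[OF usD[of N]] unfolding K_def by linarith
    ultimately show ?thesis by (intro exI[of _ "sqrt K"]) auto
  qed
  have null: "(\<lambda>n. a (\<lambda>x. us n x - us' n x) (\<lambda>x. us n x - us' n x)) \<longlonglongrightarrow> 0"
    if A: "?A us u" and A': "?A us' u" for us us' u
  proof -
    have usD: "us n \<in> D" "us' n \<in> D" for n using A A' by (auto simp: approximates_def)
    have uL: "u \<in> L2 \<Omega>" using A by (simp add: approximates_def)
    have z: "?A (\<lambda>n x. us n x - us' n x) (\<lambda>x. 0)"
      unfolding approximates_def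
    proof (intro conjI allI impI)
      show "(\<lambda>x. 0) \<in> L2 \<Omega>" by (simp add: L2_def)
      show "(\<lambda>x. us n x - us' n x) \<in> D" for n by (intro dD usD)
      have l: "(\<lambda>n. l2_norm \<Omega> (\<lambda>x. us n x - u x)) \<longlonglongrightarrow> 0" "(\<lambda>n. l2_norm \<Omega> (\<lambda>x. us' n x - u x)) \<longlonglongrightarrow> 0"
        using A A' by (auto simp: approximates_def)
      have "(\<lambda>n. sqrt (2 * (l2_norm \<Omega> (\<lambda>x. us n x - u x))\<^sup>2 + 2 * (l2_norm \<Omega> (\<lambda>x. us' n x - u x))\<^sup>2))
          \<longlonglongrightarrow> sqrt (2 * 0\<^sup>2 + 2 * 0\<^sup>2)"
        by (intro tendsto_intros l)
      then have lim: "(\<lambda>n. sqrt (2 * (l2_norm \<Omega> (\<lambda>x. us n x - u x))\<^sup>2 + 2 * (l2_norm \<Omega> (\<lambda>x. us' n x - u x))\<^sup>2))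
          \<longlonglongrightarrow> 0" by simp
      show "(\<lambda>n. l2_norm \<Omega> (\<lambda>x. us n x - us' n x - 0)) \<longlonglongrightarrow> 0"
      proof (rule tendsto_sandwich[OF _ _ tendsto_const lim])
        show "\<forall>\<^sub>F n in sequentially. 0 \<le> l2_norm \<Omega> (\<lambda>x. us n x - us' n x - 0)"
          by (simp add: l2_norm_def)
        show "\<forall>\<^sub>F n in sequentially. l2_norm \<Omega> (\<lambda>x. us n x - us' n x - 0)
            \<le> sqrt (2 * (l2_norm \<Omega> (\<lambda>x. us n x - u x))\<^sup>2 + 2 * (l2_norm \<Omega> (\<lambda>x. us' n x - u x))\<^sup>2)"
        proof (intro always_eventually allI real_le_rsqrt)
          fix n
          have "(\<lambda>x. us n x - u x) \<in> L2 \<Omega>" "(\<lambda>x. us' n x - u x) \<in> L2 \<Omega>"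
            using D usD uL by (auto intro!: L2_diff_bound(1))
          from L2_diff_bound(2)[OF this]
          show "(l2_norm \<Omega> (\<lambda>x. us n x - us' n x - 0))\<^sup>2
            \<le> 2 * (l2_norm \<Omega> (\<lambda>x. us n x - u x))\<^sup>2 + 2 * (l2_norm \<Omega> (\<lambda>x. us' n x - u x))\<^sup>2" by simp
        qed
      qed
      fix e :: real assume "e > 0"
      then have e: "e / 4 > 0" by simp
      obtain N where N: "\<And>m n. m \<ge> N \<Longrightarrow> n \<ge> N \<Longrightarrow>
          a (\<lambda>x. us m x - us n x) (\<lambda>x. us m x - us n x) < e / 4"
        using A e unfolding approximates_def by meson
      obtain N' where N': "\<And>m n. m \<ge> N' \<Longrightarrow> n \<ge> N' \<Longrightarrow>
          a (\<lambda>x. us' m x - us' n x) (\<lambda>x. us' m x - us' n x) < e / 4"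
        using A' e unfolding approximates_def by meson
      show "\<exists>N. \<forall>m\<ge>N. \<forall>n\<ge>N. a (\<lambda>x. us m x - us' m x - (us n x - us' n x))
          (\<lambda>x. us m x - us' m x - (us n x - us' n x)) < e"
      proof (intro exI[of _ "max N N'"] allI impI)
        fix m n assume mn: "max N N' \<le> m" "max N N' \<le> n"
        have eq: "(\<lambda>x. us m x - us' m x - (us n x - us' n x)) =
            (\<lambda>x. (us m x - us n x) - (us' m x - us' n x))" by auto
        show "a (\<lambda>x. us m x - us' m x - (us n x - us' n x))
            (\<lambda>x. us m x - us' m x - (us n x - us' n x)) < e"
          unfolding eq
          using par[OF dD[OF usD(1)[of m] usD(1)[of n]] dD[OF usD(2)[of m] usD(2)[of n]]]
            N[of m n] N'[of m n] mn by simp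
      qed
    qed
    show ?thesis using cl z unfolding closable_def by blast
  qed
  have conv: "convergent (\<lambda>n. a (us n) (vs n))" if A: "?A us u" and B: "?A vs v" for us u vs v
  proof -
    have usD: "us n \<in> D" "vs n \<in> D" for n using A B by (auto simp: approximates_def)
    obtain C where C: "C > 0" "\<And>n. sqrt (a (us n) (us n)) \<le> C" using bounded[OF A] by blast
    obtain C' where C': "C' > 0" "\<And>n. sqrt (a (vs n) (vs n)) \<le> C'" using bounded[OF B] by blast
    have "Cauchy (\<lambda>n. a (us n) (vs n))"
    proof (rule metric_CauchyI)
      fix e :: real assume e: "e > 0"
      have "(e / (2 * C'))\<^sup>2 > 0" "(e / (2 * C))\<^sup>2 > 0" using e C(1) C'(1) by auto
      then obtain N N' where N: "\<And>m n. m \<ge> N \<Longrightarrow> n \<ge> N \<Longrightarrow>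
          a (\<lambda>x. us m x - us n x) (\<lambda>x. us m x - us n x) < (e / (2 * C'))\<^sup>2"
        and N': "\<And>m n. m \<ge> N' \<Longrightarrow> n \<ge> N' \<Longrightarrow>
          a (\<lambda>x. vs m x - vs n x) (\<lambda>x. vs m x - vs n x) < (e / (2 * C))\<^sup>2"
        using A B unfolding approximates_def by meson
      have "dist (a (us m) (vs m)) (a (us n) (vs n)) < e" if mn: "m \<ge> max N N'" "n \<ge> max N N'" for m n
      proof -
        let ?du = "\<lambda>x. us m x - us n x" and ?dv = "\<lambda>x. vs m x - vs n x"
        have du: "sqrt (a ?du ?du) < e / (2 * C')"
          using N[of m n] mn e C'(1) by (intro real_less_lsqrt) auto
        have dv: "sqrt (a ?dv ?dv) < e / (2 * C)"
          using N'[of m n] mn e C(1) by (intro real_less_lsqrt) auto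
        have "\<bar>a ?du (vs m)\<bar> \<le> sqrt (a ?du ?du) * sqrt (a (vs m) (vs m))"
          by (intro CS' dD usD)
        also have "\<dots> \<le> sqrt (a ?du ?du) * C'"
          by (intro mult_left_mono C') (simp add: pos dD usD)
        also have "\<dots> < e / (2 * C') * C'" using du C'(1) by (intro mult_strict_right_mono)
        finally have 1: "\<bar>a ?du (vs m)\<bar> < e / 2" using C'(1) by simp
        have "\<bar>a (us n) ?dv\<bar> \<le> sqrt (a (us n) (us n)) * sqrt (a ?dv ?dv)"
          by (intro CS' dD usD)
        also have "\<dots> \<le> C * sqrt (a ?dv ?dv)"
          by (intro mult_right_mono C) (simp add: pos dD usD)
        also have "\<dots> < C * (e / (2 * C))" using dv C(1) by (intro mult_strict_left_mono)
        finally have 2: "\<bar>a (us n) ?dv\<bar> < e / 2" using C(1) by simp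
        have "a (us m) (vs m) - a (us n) (vs n) = a ?du (vs m) + a (us n) ?dv"
          using dl usD dr by simp
        then show ?thesis using 1 2 by (simp add: dist_real_def)
      qed
      then show "\<exists>M. \<forall>m\<ge>M. \<forall>n\<ge>M. dist (a (us m) (vs m)) (a (us n) (vs n)) < e" by blast
    qed
    then show ?thesis by (simp add: Cauchy_convergent_iff)
  qed
  have indep: "(\<lambda>n. a (us n) (vs n) - a (us' n) (vs' n)) \<longlonglongrightarrow> 0"
    if A: "?A us u" and A': "?A us' u" and B: "?A vs v" and B': "?A vs' v" for us us' u vs vs' v
  proof -
    have usD: "us n \<in> D" "vs n \<in> D" "us' n \<in> D" "vs' n \<in> D" for n
      using A B A' B' by (auto simp: approximates_def)
    obtain C where C: "\<And>n. sqrt (a (us' n) (us' n)) \<le> C" using bounded[OF A'] by blast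
    obtain C' where C': "\<And>n. sqrt (a (vs n) (vs n)) \<le> C'" using bounded[OF B] by blast
    let ?du = "\<lambda>n x. us n x - us' n x" and ?dv = "\<lambda>n x. vs n x - vs' n x"
    have "(\<lambda>n. sqrt (a (?du n) (?du n)) * C' + C * sqrt (a (?dv n) (?dv n))) \<longlonglongrightarrow> sqrt 0 * C' + C * sqrt 0"
      by (intro tendsto_intros null[OF A A'] null[OF B B'])
    then have lim: "(\<lambda>n. sqrt (a (?du n) (?du n)) * C' + C * sqrt (a (?dv n) (?dv n))) \<longlonglongrightarrow> 0" by simp
    show ?thesis
    proof (rule Lim_null_comparison[OF _ lim], intro always_eventually allI)
      fix n
      have "\<bar>a (?du n) (vs n)\<bar> \<le> sqrt (a (?du n) (?du n)) * sqrt (a (vs n) (vs n))"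
        by (intro CS' dD usD)
      also have "\<dots> \<le> sqrt (a (?du n) (?du n)) * C'"
        by (intro mult_left_mono C') (simp add: pos dD usD)
      finally have 1: "\<bar>a (?du n) (vs n)\<bar> \<le> sqrt (a (?du n) (?du n)) * C'" .
      have "\<bar>a (us' n) (?dv n)\<bar> \<le> sqrt (a (us' n) (us' n)) * sqrt (a (?dv n) (?dv n))"
        by (intro CS' dD usD)
      also have "\<dots> \<le> C * sqrt (a (?dv n) (?dv n))"
        by (intro mult_right_mono C) (simp add: pos dD usD)
      finally have 2: "\<bar>a (us' n) (?dv n)\<bar> \<le> C * sqrt (a (?dv n) (?dv n))" .
      have "a (us n) (vs n) - a (us' n) (vs' n) = a (?du n) (vs n) + a (us' n) (?dv n)"
        using dl usD dr by simp
      then show "norm (a (us n) (vs n) - a (us' n) (vs' n))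
          \<le> sqrt (a (?du n) (?du n)) * C' + C * sqrt (a (?dv n) (?dv n))"
        using 1 2 by simp
    qed
  qed
  have val: "(\<lambda>n. a (us n) (vs n)) \<longlonglongrightarrow> closure_form \<Omega> D a u v"
    if A: "?A us u" and B: "?A vs v" for us u vs v
  proof -
    obtain r where r: "(\<lambda>n. a (us n) (vs n)) \<longlonglongrightarrow> r" using conv[OF A B] by (auto simp: convergent_def)
    have all: "(\<lambda>n. a (us' n) (vs' n)) \<longlonglongrightarrow> r" if "?A us' u" "?A vs' v" for us' vs'
      using tendsto_diff[OF r indep[OF A that(1) B that(2)]] by simp
    have "closure_form \<Omega> D a u v = r"
      unfolding closure_form_def
    proof (rule the_equality)
      show "\<forall>us vs. ?A us u \<longrightarrow> ?A vs v \<longrightarrow> (\<lambda>n. a (us n) (vs n)) \<longlonglongrightarrow> r" using all by blast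
      fix s assume "\<forall>us vs. ?A us u \<longrightarrow> ?A vs v \<longrightarrow> (\<lambda>n. a (us n) (vs n)) \<longlonglongrightarrow> s"
      then show "s = r" using A B r LIMSEQ_unique by blast
    qed
    then show ?thesis using r by simp
  qed
  have iff: "(\<exists>us. ?A us u \<and> (\<forall>\<phi> \<phi>s. ?A \<phi>s \<phi> \<longrightarrow> (\<lambda>n. a (us n) (\<phi>s n)) \<longlonglongrightarrow> l2_inner \<Omega> v \<phi>)) \<longleftrightarrow>
      u \<in> closure_domain \<Omega> D a \<and>
      (\<forall>\<phi>\<in>closure_domain \<Omega> D a. closure_form \<Omega> D a u \<phi> = l2_inner \<Omega> v \<phi>)" (is "?L \<longleftrightarrow> ?R") for u v
  proof
    assume ?L
    then obtain us where us: "?A us u"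
      "\<And>\<phi> \<phi>s. ?A \<phi>s \<phi> \<Longrightarrow> (\<lambda>n. a (us n) (\<phi>s n)) \<longlonglongrightarrow> l2_inner \<Omega> v \<phi>" by blast
    show ?R
    proof (intro conjI ballI)
      show "u \<in> closure_domain \<Omega> D a" using us(1) by (auto simp: closure_domain_def)
      fix \<phi> assume "\<phi> \<in> closure_domain \<Omega> D a"
      then obtain \<phi>s where "?A \<phi>s \<phi>" by (auto simp: closure_domain_def)
      then show "closure_form \<Omega> D a u \<phi> = l2_inner \<Omega> v \<phi>"
        using val[OF us(1)] us(2) LIMSEQ_unique by blast
    qed
  next
    assume R: ?R
    then obtain us where us: "?A us u" by (auto simp: closure_domain_def)
    show ?L
    proof (intro exI[of _ us] conjI allI impI us)
      fix \<phi> \<phi>s assume p: "?A \<phi>s \<phi>"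
      then have "\<phi> \<in> closure_domain \<Omega> D a" by (auto simp: closure_domain_def)
      then show "(\<lambda>n. a (us n) (\<phi>s n)) \<longlonglongrightarrow> l2_inner \<Omega> v \<phi>" using val[OF us p] R by simp
    qed
  qed
  show ?thesis unfolding form_operator_def iff by blast
qed

definition robin_laplacian ::
    "'a::euclidean_space set \<Rightarrow> 'a measure \<Rightarrow> ('a \<times> 'a) measure \<Rightarrow>
     (('a \<Rightarrow> real) \<times> ('a \<Rightarrow> real)) set" where
  "robin_laplacian \<Omega> \<kappa> \<theta> = form_operator \<Omega> (form_domain \<Omega> \<kappa> \<theta>) (energy_form \<Omega> \<kappa> \<theta>)"

section \<open>Semigroups\<close>

text \<open>
  Operators on \<open>L2 \<Omega>\<close> that are defined everywhere are functions acting on representatives and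
  respecting almost everywhere equality; unbounded ones are given by their graphs, which are
  saturated under almost everywhere equality.
\<close>

definition bounded_operator ::
    "'a::euclidean_space set \<Rightarrow> (('a \<Rightarrow> real) \<Rightarrow> 'a \<Rightarrow> real) \<Rightarrow> bool" where
  "bounded_operator \<Omega> S \<longleftrightarrow>
     (\<forall>f\<in>L2 \<Omega>. S f \<in> L2 \<Omega>) \<and>
     (\<forall>f\<in>L2 \<Omega>. \<forall>g\<in>L2 \<Omega>. (AE x in lebesgue_on \<Omega>. f x = g x) \<longrightarrow>
        (AE x in lebesgue_on \<Omega>. S f x = S g x)) \<and>
     (\<forall>f\<in>L2 \<Omega>. \<forall>g\<in>L2 \<Omega>. AE x in lebesgue_on \<Omega>. S (\<lambda>y. f y + g y) x = S f x + S g x) \<and>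
     (\<forall>c. \<forall>f\<in>L2 \<Omega>. AE x in lebesgue_on \<Omega>. S (\<lambda>y. c * f y) x = c * S f x) \<and>
     (\<exists>C. \<forall>f\<in>L2 \<Omega>. l2_norm \<Omega> (S f) \<le> C * l2_norm \<Omega> f)"

definition C0_semigroup ::
    "'a::euclidean_space set \<Rightarrow> (real \<Rightarrow> ('a \<Rightarrow> real) \<Rightarrow> 'a \<Rightarrow> real) \<Rightarrow> bool" where
  "C0_semigroup \<Omega> T \<longleftrightarrow>
     (\<forall>t\<ge>0. bounded_operator \<Omega> (T t)) \<and>
     (\<forall>f\<in>L2 \<Omega>. AE x in lebesgue_on \<Omega>. T 0 f x = f x) \<and>
     (\<forall>s\<ge>0. \<forall>t\<ge>0. \<forall>f\<in>L2 \<Omega>. AE x in lebesgue_on \<Omega>. T (s + t) f x = T s (T t f) x) \<and>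
     (\<forall>f\<in>L2 \<Omega>. ((\<lambda>t. l2_norm \<Omega> (\<lambda>x. T t f x - f x)) \<longlongrightarrow> 0) (at_right 0))"

definition generator ::
    "'a::euclidean_space set \<Rightarrow> (real \<Rightarrow> ('a \<Rightarrow> real) \<Rightarrow> 'a \<Rightarrow> real) \<Rightarrow>
     (('a \<Rightarrow> real) \<times> ('a \<Rightarrow> real)) set" where
  "generator \<Omega> T = {(f, g). f \<in> L2 \<Omega> \<and> g \<in> L2 \<Omega> \<and>
     ((\<lambda>t. l2_norm \<Omega> (\<lambda>x. (T t f x - f x) / t - g x)) \<longlongrightarrow> 0) (at_right 0)}"

definition generates ::
    "'a::euclidean_space set \<Rightarrow> (('a \<Rightarrow> real) \<times> ('a \<Rightarrow> real)) set \<Rightarrow>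
     (real \<Rightarrow> ('a \<Rightarrow> real) \<Rightarrow> 'a \<Rightarrow> real) \<Rightarrow> bool" where
  "generates \<Omega> A T \<longleftrightarrow> C0_semigroup \<Omega> T \<and> generator \<Omega> T = A"

definition symmetric_semigroup ::
    "'a::euclidean_space set \<Rightarrow> (real \<Rightarrow> ('a \<Rightarrow> real) \<Rightarrow> 'a \<Rightarrow> real) \<Rightarrow> bool" where
  "symmetric_semigroup \<Omega> T \<longleftrightarrow>
     (\<forall>t\<ge>0. \<forall>f\<in>L2 \<Omega>. \<forall>g\<in>L2 \<Omega>. l2_inner \<Omega> (T t f) g = l2_inner \<Omega> f (T t g))"

definition positive_semigroup ::
    "'a::euclidean_space set \<Rightarrow> (real \<Rightarrow> ('a \<Rightarrow> real) \<Rightarrow> 'a \<Rightarrow> real) \<Rightarrow> bool" where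
  "positive_semigroup \<Omega> T \<longleftrightarrow>
     (\<forall>t\<ge>0. \<forall>f\<in>L2 \<Omega>. (AE x in lebesgue_on \<Omega>. f x \<ge> 0) \<longrightarrow> (AE x in lebesgue_on \<Omega>. T t f x \<ge> 0))"

definition Linf_contractive ::
    "'a::euclidean_space set \<Rightarrow> (real \<Rightarrow> ('a \<Rightarrow> real) \<Rightarrow> 'a \<Rightarrow> real) \<Rightarrow> bool" where
  "Linf_contractive \<Omega> T \<longleftrightarrow>
     (\<forall>t\<ge>0. \<forall>f\<in>L2 \<Omega> \<inter> Linf \<Omega>. linf_norm \<Omega> (T t f) \<le> linf_norm \<Omega> f)"

definition sub_Markovian ::
    "'a::euclidean_space set \<Rightarrow> (real \<Rightarrow> ('a \<Rightarrow> real) \<Rightarrow> 'a \<Rightarrow> real) \<Rightarrow> bool" where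
  "sub_Markovian \<Omega> T \<longleftrightarrow> positive_semigroup \<Omega> T \<and> Linf_contractive \<Omega> T"

end

theory Submission
  imports Defs
begin

text \<open>
  The form need not be closed, or even closable: the elements of its completion are represented by
  Cauchy sequences, and for \<open>c > 0\<close> the function \<open>c (c - \<Delta>)\<^sup>-\<^sup>1 g\<close> is the \<open>L2\<close> limit of every
  minimising sequence of \<open>u \<mapsto> a u u + c \<parallel>u - g\<parallel>\<^sup>2\<close>. The resolvents \<open>R c\<close> so obtained are
  symmetric, \<open>c R c\<close> is a contraction, and the Yosida approximations \<open>exp (t c (c R c - 1))\<close> converge
  to the semigroup. If \<open>g \<le> M\<close> with \<open>M \<ge> 0\<close>, replacing a minimising sequence \<open>u n\<close> by \<open>F (u n)\<close>,
  where \<open>F\<close> is a \<open>C\<^sup>1\<close> contraction that fixes every \<open>s \<le> M\<close> and is bounded above by \<open>M + e\<close>, does not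
  increase the functional; so the minimiser is at most \<open>M\<close>, and the Yosida exponentials, being
  limits of sub-convex combinations of powers of \<open>c R c\<close>, inherit this. As \<open>F\<close> is \<open>C\<^sup>1\<close>, only the
  classical chain rule in \<open>H1\<close> is needed.
\<close>

section \<open>Square integrable functions\<close>

text \<open>A Hilbert space that is a type cannot depend on \<Omega>. The abstract theory is
  therefore applied to L2 of the whole space, with functions on \<Omega> extended by zero, and the
  operator is densely defined only in a closed subspace; this is why a relation takes its place.
  That the subspace contains all of L2 of \<Omega> rests on test functions: they vanish on the
  boundary and so lie in the form domain however large \<kappa> and \<theta> are. A single upper
  bound carries both sub-Markovian properties: for -f with M = 0 it is positivity, for f and -f with
  M the supremum norm of f it is contractivity. The distance term of the functional does not grow
  because F fixes g: |F(u) - g| = |F(u) - F(g)| <= |u - g|. The sharp truncation min(u, M) would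
  call for a chain rule for functions with a corner; the price of a smooth F is the excess e, which
  is removed by letting e tend to 0.\<close>

definition square_integrable :: "'a measure \<Rightarrow> ('a \<Rightarrow> real) \<Rightarrow> bool" where
  "square_integrable M f \<longleftrightarrow> f \<in> borel_measurable M \<and> integrable M (\<lambda>x. (f x)\<^sup>2)"

lemma L2_iff: "f \<in> L2 \<Omega> \<longleftrightarrow> square_integrable (lebesgue_on \<Omega>) f"
  by (simp add: L2_def square_integrable_def)

lemma square_integrable_bound:
  assumes "square_integrable M f" "g \<in> borel_measurable M" "AE x in M. \<bar>g x\<bar> \<le> \<bar>f x\<bar>"
  shows "square_integrable M g"
proof -
  have "integrable M (\<lambda>x. (f x)\<^sup>2)" using assms(1) by (simp add: square_integrable_def)
  then have "integrable M (\<lambda>x. (g x)\<^sup>2)"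
  proof (rule Bochner_Integration.integrable_bound)
    show "AE x in M. norm ((g x)\<^sup>2) \<le> norm ((f x)\<^sup>2)"
      using assms(3) by eventually_elim (simp add: abs_le_square_iff)
  qed (use assms(2) in measurable)
  then show ?thesis using assms(2) by (simp add: square_integrable_def)
qed

lemma square_integrable_mult:
  assumes "square_integrable M f" "square_integrable M g"
  shows "integrable M (\<lambda>x. f x * g x)"
proof -
  have [measurable]: "f \<in> borel_measurable M" "g \<in> borel_measurable M"
    using assms by (auto simp: square_integrable_def)
  have "integrable M (\<lambda>x. (f x)\<^sup>2 + (g x)\<^sup>2)"
    using assms by (auto simp: square_integrable_def)
  then show ?thesis
  proof (rule Bochner_Integration.integrable_bound)
    have "\<bar>a * b\<bar> \<le> a\<^sup>2 + b\<^sup>2" for a b :: real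
    proof -
      have "\<bar>a * b\<bar> * 2 \<le> a\<^sup>2 + b\<^sup>2"
        using sum_squares_bound[of "\<bar>a\<bar>" "\<bar>b\<bar>"] by (simp add: abs_mult)
      then show ?thesis using zero_le_power2[of a] zero_le_power2[of b] by linarith
    qed
    then show "AE x in M. norm (f x * g x) \<le> norm ((f x)\<^sup>2 + (g x)\<^sup>2)" by simp
  qed measurable
qed

lemma square_integrable_cmult:
  "square_integrable M f \<Longrightarrow> square_integrable M (\<lambda>x. c * f x)"
  by (auto simp: square_integrable_def power_mult_distrib)

lemma square_integrable_add:
  assumes "square_integrable M f" "square_integrable M g"
  shows "square_integrable M (\<lambda>x. f x + g x)"
  using assms square_integrable_mult[OF assms]
  by (auto simp: square_integrable_def power2_sum mult.assoc)

lemma square_integrable_diff: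
  assumes "square_integrable M f" "square_integrable M g"
  shows "square_integrable M (\<lambda>x. f x - g x)"
  using square_integrable_add[OF assms(1) square_integrable_cmult[OF assms(2), of "-1"]] by simp

lemma square_integrable_zero: "square_integrable M (\<lambda>x. 0)"
  by (simp add: square_integrable_def)

text \<open>Passes between the real integral, in which L2 distances are stated, and the nonnegative
  integral, in which Fatou's lemma and suprema of series are available.\<close>

lemma integral_square_le_iff_nn:
  assumes "square_integrable M f" "0 \<le> c"
  shows "(\<integral>\<^sup>+x. ennreal ((f x)\<^sup>2) \<partial>M) \<le> ennreal c \<longleftrightarrow> (\<integral>x. (f x)\<^sup>2 \<partial>M) \<le> c"
  using assms by (subst nn_integral_eq_integral) (auto simp: square_integrable_def)

text \<open>The Riesz-Fischer argument: a rapidly converging subsequence converges almost everywhere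
  because its increments are dominated by a geometric sequence, and Fatou's lemma along this
  subsequence turns the pointwise limit into an L2 limit of the whole sequence.\<close>

lemma L2_complete:
  fixes f :: "nat \<Rightarrow> 'a \<Rightarrow> real"
  assumes sq: "\<And>n. square_integrable M (f n)"
    and C: "\<And>e. e > 0 \<Longrightarrow> \<exists>N. \<forall>m\<ge>N. \<forall>n\<ge>N. (\<integral>x. (f m x - f n x)\<^sup>2 \<partial>M) < e"
  obtains g where "square_integrable M g" "(\<lambda>n. \<integral>x. (f n x - g x)\<^sup>2 \<partial>M) \<longlonglongrightarrow> 0"
proof -
  have [measurable]: "f n \<in> borel_measurable M" for n using sq by (auto simp: square_integrable_def)
  have sqd: "square_integrable M (\<lambda>x. f m x - f n x)" for m n by (intro square_integrable_diff sq)
  have "\<exists>N. \<forall>m\<ge>N. \<forall>n\<ge>N. (\<integral>x. (f m x - f n x)\<^sup>2 \<partial>M) < 1 / 8 ^ k" for k :: nat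
    by (rule C) simp
  then obtain N where N: "\<And>k m n. m \<ge> N k \<Longrightarrow> n \<ge> N k \<Longrightarrow> (\<integral>x. (f m x - f n x)\<^sup>2 \<partial>M) < 1 / 8 ^ k"
    by metis
  \<comment> \<open>The maximum ensures that \<open>r j\<close> is at least \<open>N k\<close> for
    every \<open>j\<close> from \<open>k\<close> on, as the Fatou estimate requires.\<close>
  define r where "r k = Max (N ` {..k})" for k
  have rN: "r k \<ge> N k" "r (Suc k) \<ge> N k" for k
    by (auto simp: r_def)
  define d where "d k x = f (r (Suc k)) x - f (r k) x" for k x
  have [measurable]: "d k \<in> borel_measurable M" for k unfolding d_def by measurable
  have dk: "(\<integral>\<^sup>+x. ennreal ((d k x)\<^sup>2) \<partial>M) \<le> ennreal (1 / 8 ^ k)" for k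
    using integral_square_le_iff_nn[OF sqd, of "1/8^k" "r (Suc k)" "r k"] N[of k "r (Suc k)" "r k"] rN[of k]
    by (simp add: d_def)
  \<comment> \<open>The weight \<open>4 ^ k\<close> divides the gain \<open>8 ^ k\<close> between
    two demands: the integrals still form a convergent geometric series, while pointwise finiteness
    of the sum forces \<open>d k x\<close> to be of order \<open>1 / 2 ^ k\<close>.\<close>
  have "(\<integral>\<^sup>+x. (\<Sum>k. ennreal (4 ^ k * (d k x)\<^sup>2)) \<partial>M) = (\<Sum>k. \<integral>\<^sup>+x. ennreal (4 ^ k * (d k x)\<^sup>2) \<partial>M)"
    by (intro nn_integral_suminf) measurable
  also have "\<dots> \<le> (\<Sum>k. ennreal ((1/2) ^ k))"
  proof (intro suminf_le)
    fix k
    have "(\<integral>\<^sup>+x. ennreal (4 ^ k * (d k x)\<^sup>2) \<partial>M) = ennreal (4 ^ k) * (\<integral>\<^sup>+x. ennreal ((d k x)\<^sup>2) \<partial>M)"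
      by (subst nn_integral_cmult[symmetric]) (auto simp: ennreal_mult)
    also have "\<dots> \<le> ennreal (4 ^ k) * ennreal (1 / 8 ^ k)" by (intro mult_left_mono dk) simp
    also have "\<dots> = ennreal (4 ^ k * (1 / 8 ^ k))" by (rule ennreal_mult[symmetric]) simp_all
    also have "4 ^ k * (1 / 8 ^ k) = ((1::real) / 2) ^ k"
      using power_mult_distrib[of "4::real" 2 k] by (simp add: power_divide)
    finally show "(\<integral>\<^sup>+x. ennreal (4 ^ k * (d k x)\<^sup>2) \<partial>M) \<le> ennreal ((1/2) ^ k)" .
  qed auto
  also have "\<dots> = ennreal (\<Sum>k. (1/2) ^ k)"
    by (rule suminf_ennreal2) (simp_all add: summable_geometric)
  also have "\<dots> < \<infinity>" by simp
  finally have "(\<integral>\<^sup>+x. (\<Sum>k. ennreal (4 ^ k * (d k x)\<^sup>2)) \<partial>M) \<noteq> \<infinity>" by simp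
  then have "AE x in M. (\<Sum>k. ennreal (4 ^ k * (d k x)\<^sup>2)) \<noteq> \<infinity>"
    by (intro nn_integral_noteq_infinite) measurable
  then have "AE x in M. convergent (\<lambda>k. f (r k) x)"
  proof eventually_elim
    fix x assume fin: "(\<Sum>k. ennreal (4 ^ k * (d k x)\<^sup>2)) \<noteq> \<infinity>"
    have s: "summable (\<lambda>k. 4 ^ k * (d k x)\<^sup>2)"
      by (rule summable_suminf_not_top) (use fin in auto)
    have "((2::real) ^ k)\<^sup>2 = 4 ^ k" for k
      by (simp add: power2_eq_square flip: power_mult_distrib)
    then have "(\<lambda>k. (2 ^ k * d k x)\<^sup>2) \<longlonglongrightarrow> 0"
      using summable_LIMSEQ_zero[OF s] by (simp add: power_mult_distrib)
    then have "Bseq (\<lambda>k. (2 ^ k * d k x)\<^sup>2)" by (rule convergent_imp_Bseq[OF convergentI])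
    then obtain K where K: "K > 0" "\<And>k. (2 ^ k * d k x)\<^sup>2 \<le> K" by (auto simp: Bseq_def)
    have "\<bar>d k x\<bar> \<le> sqrt K * (1/2) ^ k" for k
    proof -
      have "\<bar>2 ^ k * d k x\<bar> \<le> sqrt K" using real_sqrt_le_mono[OF K(2)[of k]] by simp
      then show ?thesis by (simp add: abs_mult field_simps)
    qed
    then have "norm (d k x) \<le> sqrt K * (1/2) ^ k" for k by simp
    moreover have "summable (\<lambda>k. sqrt K * (1/2) ^ k)"
      by (intro summable_mult summable_geometric) simp
    ultimately have "summable (\<lambda>k. d k x)"
      using summable_comparison_test'[of "\<lambda>k. sqrt K * (1/2) ^ k" 0 "\<lambda>k. d k x"] by blast
    then obtain l where "(\<lambda>n. \<Sum>k<n. d k x) \<longlonglongrightarrow> l"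
      by (auto simp: summable_def sums_def)
    then have "(\<lambda>n. (\<Sum>k<n. d k x) + f (r 0) x) \<longlonglongrightarrow> l + f (r 0) x" by (intro tendsto_intros)
    moreover have "(\<Sum>k<n. d k x) + f (r 0) x = f (r n) x" for n
      using sum_lessThan_telescope[of "\<lambda>k. f (r k) x" n] by (simp add: d_def)
    ultimately show "convergent (\<lambda>k. f (r k) x)" by (auto simp: convergent_def)
  qed
  then have AElim: "AE x in M. (\<lambda>k. f (r k) x) \<longlonglongrightarrow> lim (\<lambda>k. f (r k) x)"
    by (simp add: convergent_LIMSEQ_iff)
  define g where "g x = lim (\<lambda>k. f (r k) x)" for x
  have [measurable]: "g \<in> borel_measurable M" unfolding g_def by measurable
  have bnd: "(\<integral>\<^sup>+x. ennreal ((f n x - g x)\<^sup>2) \<partial>M) \<le> ennreal (1 / 8 ^ k)" if "n \<ge> N k" for n k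
  proof -
    have "(\<integral>\<^sup>+x. ennreal ((f n x - g x)\<^sup>2) \<partial>M) = (\<integral>\<^sup>+x. liminf (\<lambda>j. ennreal ((f n x - f (r j) x)\<^sup>2)) \<partial>M)"
    proof (rule nn_integral_cong_AE)
      show "AE x in M. ennreal ((f n x - g x)\<^sup>2) = liminf (\<lambda>j. ennreal ((f n x - f (r j) x)\<^sup>2))"
        using AElim
      proof eventually_elim
        fix x assume "(\<lambda>k. f (r k) x) \<longlonglongrightarrow> lim (\<lambda>k. f (r k) x)"
        then have "(\<lambda>j. ennreal ((f n x - f (r j) x)\<^sup>2)) \<longlonglongrightarrow> ennreal ((f n x - g x)\<^sup>2)"
          unfolding g_def by (intro tendsto_ennrealI tendsto_power tendsto_diff tendsto_const)
        then show "ennreal ((f n x - g x)\<^sup>2) = liminf (\<lambda>j. ennreal ((f n x - f (r j) x)\<^sup>2))"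
          by (rule lim_imp_Liminf[OF sequentially_bot, symmetric])
      qed
    qed
    also have "\<dots> \<le> liminf (\<lambda>j. \<integral>\<^sup>+x. ennreal ((f n x - f (r j) x)\<^sup>2) \<partial>M)"
      by (rule nn_integral_liminf) measurable
    also have "\<dots> \<le> ennreal (1 / 8 ^ k)"
    proof (rule Liminf_le)
      show "\<forall>\<^sub>F j in sequentially. (\<integral>\<^sup>+x. ennreal ((f n x - f (r j) x)\<^sup>2) \<partial>M) \<le> ennreal (1 / 8 ^ k)"
      proof (rule eventually_sequentiallyI[of k])
        fix j assume "k \<le> j"
        then have "r j \<ge> N k" by (auto simp: r_def)
        then show "(\<integral>\<^sup>+x. ennreal ((f n x - f (r j) x)\<^sup>2) \<partial>M) \<le> ennreal (1 / 8 ^ k)"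
          using integral_square_le_iff_nn[OF sqd, of "1/8^k" n "r j"] N[OF that, of "r j"] by simp
      qed
    qed simp
    finally show ?thesis .
  qed
  have sqfg: "square_integrable M (\<lambda>x. f n x - g x)" if "n \<ge> N k" for n k
    using bnd[OF that]
    by (auto simp: square_integrable_def integrable_iff_bounded intro: le_less_trans)
  have "square_integrable M (\<lambda>x. f (N 0) x - (f (N 0) x - g x))"
    by (intro square_integrable_diff sq sqfg[of 0]) auto
  then have sg: "square_integrable M g" by simp
  have "(\<lambda>n. \<integral>x. (f n x - g x)\<^sup>2 \<partial>M) \<longlonglongrightarrow> 0"
  proof (rule LIMSEQ_I)
    fix e :: real assume "e > 0"
    then obtain k where k: "(1/8 :: real) ^ k < e" using real_arch_pow_inv[of e "1/8"] by auto
    show "\<exists>no. \<forall>n\<ge>no. norm ((\<integral>x. (f n x - g x)\<^sup>2 \<partial>M) - 0) < e"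
    proof (intro exI allI impI)
      fix n assume n: "n \<ge> N k"
      have "(\<integral>x. (f n x - g x)\<^sup>2 \<partial>M) \<le> 1 / 8 ^ k"
        using bnd[OF n] integral_square_le_iff_nn[OF sqfg[OF n], of "1/8^k"] by simp
      then show "norm ((\<integral>x. (f n x - g x)\<^sup>2 \<partial>M) - 0) < e" using k by (simp add: power_divide)
    qed
  qed
  then show ?thesis using that sg by blast
qed

section \<open>The Hilbert space of square integrable functions\<close>

text \<open>Reflexive only at square integrable functions, so that the partial quotient consists of
  exactly the classes of L2.\<close>

definition lsq_rel :: "('a::euclidean_space \<Rightarrow> real) \<Rightarrow> ('a \<Rightarrow> real) \<Rightarrow> bool" where
  "lsq_rel f g \<longleftrightarrow> square_integrable lebesgue f \<and> square_integrable lebesgue g \<and> (AE x in lebesgue. f x = g x)"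

lemma lsq_rel_part_equivp: "part_equivp (lsq_rel :: ('a::euclidean_space \<Rightarrow> real) \<Rightarrow> _)"
proof (rule part_equivpI)
  show "\<exists>f::'a \<Rightarrow> real. lsq_rel f f"
    by (intro exI[of _ "\<lambda>x. 0"]) (simp add: lsq_rel_def square_integrable_zero)
  show "symp (lsq_rel :: ('a \<Rightarrow> real) \<Rightarrow> _)"
    by (rule sympI) (auto simp: lsq_rel_def)
  show "transp (lsq_rel :: ('a \<Rightarrow> real) \<Rightarrow> _)"
    by (rule transpI) (auto simp: lsq_rel_def)
qed

quotient_type (overloaded) 'a lsq = "'a::euclidean_space \<Rightarrow> real" / partial: lsq_rel
  by (rule lsq_rel_part_equivp)

instantiation lsq :: (euclidean_space) real_inner
begin

lift_definition zero_lsq :: "'a lsq" is "\<lambda>x. 0"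
  by (simp add: lsq_rel_def square_integrable_zero)

lift_definition plus_lsq :: "'a lsq \<Rightarrow> 'a lsq \<Rightarrow> 'a lsq" is "\<lambda>f g x. f x + g x"
  by (auto simp: lsq_rel_def intro: square_integrable_add elim: eventually_elim2)

lift_definition minus_lsq :: "'a lsq \<Rightarrow> 'a lsq \<Rightarrow> 'a lsq" is "\<lambda>f g x. f x - g x"
  by (auto simp: lsq_rel_def intro: square_integrable_diff elim: eventually_elim2)

lift_definition uminus_lsq :: "'a lsq \<Rightarrow> 'a lsq" is "\<lambda>f x. - f x"
  using square_integrable_cmult[of lebesgue _ "-1"] by (auto simp: lsq_rel_def elim: eventually_mono)

lift_definition scaleR_lsq :: "real \<Rightarrow> 'a lsq \<Rightarrow> 'a lsq" is "\<lambda>c f x. c * f x"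
  by (auto simp: lsq_rel_def intro: square_integrable_cmult elim: eventually_mono)

lift_definition inner_lsq :: "'a lsq \<Rightarrow> 'a lsq \<Rightarrow> real" is "\<lambda>f g. \<integral>x. f x * g x \<partial>lebesgue"
proof -
  fix f f' g g' :: "'a \<Rightarrow> real"
  assume "lsq_rel f f'" "lsq_rel g g'"
  then have [measurable]: "f \<in> borel_measurable lebesgue" "f' \<in> borel_measurable lebesgue"
      "g \<in> borel_measurable lebesgue" "g' \<in> borel_measurable lebesgue"
    and eq: "AE x in lebesgue. f x = f' x" "AE x in lebesgue. g x = g' x"
    by (auto simp: lsq_rel_def square_integrable_def)
  show "(\<integral>x. f x * g x \<partial>lebesgue) = (\<integral>x. f' x * g' x \<partial>lebesgue)"
    by (rule integral_cong_AE) (use eq in \<open>auto elim: eventually_elim2\<close>)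
qed

definition norm_lsq :: "'a lsq \<Rightarrow> real" where "norm_lsq f = sqrt (f \<bullet> f)"

definition sgn_lsq :: "'a lsq \<Rightarrow> 'a lsq" where "sgn_lsq f = scaleR (inverse (norm f)) f"

definition dist_lsq :: "'a lsq \<Rightarrow> 'a lsq \<Rightarrow> real" where "dist_lsq f g = norm (f - g)"

definition uniformity_lsq :: "('a lsq \<times> 'a lsq) filter" where
  "uniformity_lsq = (INF e\<in>{0<..}. principal {(x, y). dist x y < e})"

definition open_lsq :: "'a lsq set \<Rightarrow> bool" where
  "open_lsq U = (\<forall>x\<in>U. eventually (\<lambda>(x', y). x' = x \<longrightarrow> y \<in> U) uniformity)"

instance
proof
  fix f g h :: "'a lsq" and a b :: real
  show "f + g + h = f + (g + h)"
    by transfer (auto simp: lsq_rel_def add.assoc intro: square_integrable_add)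
  show "f + g = g + f"
    by transfer (auto simp: lsq_rel_def add.commute intro: square_integrable_add)
  show "0 + f = f"
    by transfer (auto simp: lsq_rel_def)
  show "- f + f = 0"
    by transfer (auto simp: lsq_rel_def square_integrable_zero)
  show "f - g = f + - g"
    by transfer (auto simp: lsq_rel_def intro: square_integrable_diff)
  show "a *\<^sub>R (f + g) = a *\<^sub>R f + a *\<^sub>R g"
    by transfer (auto simp: lsq_rel_def distrib_left intro: square_integrable_add square_integrable_cmult)
  show "(a + b) *\<^sub>R f = a *\<^sub>R f + b *\<^sub>R f"
    by transfer (auto simp: lsq_rel_def distrib_right intro: square_integrable_add square_integrable_cmult)
  show "a *\<^sub>R b *\<^sub>R f = (a * b) *\<^sub>R f"
    by transfer (auto simp: lsq_rel_def mult.assoc intro: square_integrable_cmult)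
  show "1 *\<^sub>R f = f"
    by transfer (auto simp: lsq_rel_def)
  show "f \<bullet> g = g \<bullet> f"
    by transfer (simp add: mult.commute)
  show "(f + g) \<bullet> h = f \<bullet> h + g \<bullet> h"
    by transfer (simp add: lsq_rel_def distrib_right square_integrable_mult)
  show "(a *\<^sub>R f) \<bullet> g = a * (f \<bullet> g)"
    by transfer (simp add: mult.assoc)
  show "0 \<le> f \<bullet> f"
    by transfer simp
  show "f \<bullet> f = 0 \<longleftrightarrow> f = 0"
    by transfer
      (auto simp: lsq_rel_def square_integrable_zero integral_nonneg_eq_0_iff_AE square_integrable_mult)
  show "norm f = sqrt (f \<bullet> f)" by (rule norm_lsq_def)
  show "sgn f = scaleR (inverse (norm f)) f" by (rule sgn_lsq_def)
  show "dist f g = norm (f - g)" by (rule dist_lsq_def)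
next
  show "uniformity = (INF e\<in>{0<..}. principal {(x, y::'a lsq). dist x y < e})"
    by (rule uniformity_lsq_def)
next
  fix U :: "'a lsq set"
  show "open U = (\<forall>x\<in>U. \<forall>\<^sub>F (x', y) in uniformity. x' = x \<longrightarrow> y \<in> U)"
    by (rule open_lsq_def)
qed

end

lemma rep_abs_lsq_rel:
  assumes "square_integrable lebesgue f"
  shows "lsq_rel (rep_lsq (abs_lsq f)) f"
  by (rule rep_abs_rsp_left[OF Quotient3_lsq]) (use assms in \<open>auto simp: lsq_rel_def\<close>)

lemma square_integrable_rep_lsq: "square_integrable lebesgue (rep_lsq h)"
  using Quotient3_rep_reflp[OF Quotient3_lsq, of h] by (simp add: lsq_rel_def)

lemma abs_lsq_rep [simp]: "abs_lsq (rep_lsq h) = h"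
  by (rule Quotient3_abs_rep[OF Quotient3_lsq])

lemma abs_lsq_eq_iff:
  assumes "square_integrable lebesgue f" "square_integrable lebesgue g"
  shows "abs_lsq f = abs_lsq g \<longleftrightarrow> (AE x in lebesgue. f x = g x)"
  using Quotient3_rel[OF Quotient3_lsq, of f g] assms by (auto simp: lsq_rel_def)

lemma rep_abs_lsq:
  assumes "square_integrable lebesgue f"
  shows "AE x in lebesgue. rep_lsq (abs_lsq f) x = f x"
  using rep_abs_lsq_rel[OF assms] by (simp add: lsq_rel_def)

lemma abs_lsq_add:
  "square_integrable lebesgue f \<Longrightarrow> square_integrable lebesgue g \<Longrightarrow> abs_lsq f + abs_lsq g = abs_lsq (\<lambda>x. f x + g x)"
  by (rule plus_lsq.abs_eq) (auto simp: lsq_rel_def eq_onp_def)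

lemma abs_lsq_diff:
  "square_integrable lebesgue f \<Longrightarrow> square_integrable lebesgue g \<Longrightarrow> abs_lsq f - abs_lsq g = abs_lsq (\<lambda>x. f x - g x)"
  by (rule minus_lsq.abs_eq) (auto simp: lsq_rel_def eq_onp_def)

lemma abs_lsq_scaleR:
  "square_integrable lebesgue f \<Longrightarrow> c *\<^sub>R abs_lsq f = abs_lsq (\<lambda>x. c * f x)"
  by (rule scaleR_lsq.abs_eq) (auto simp: lsq_rel_def eq_onp_def)

lemma inner_abs_lsq:
  "square_integrable lebesgue f \<Longrightarrow> square_integrable lebesgue g \<Longrightarrow> abs_lsq f \<bullet> abs_lsq g = (\<integral>x. f x * g x \<partial>lebesgue)"
  by (rule inner_lsq.abs_eq) (auto simp: lsq_rel_def eq_onp_def)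

lemma norm_abs_lsq:
  "square_integrable lebesgue f \<Longrightarrow> (norm (abs_lsq f))\<^sup>2 = (\<integral>x. (f x)\<^sup>2 \<partial>lebesgue)"
  by (simp only: power2_norm_eq_inner inner_abs_lsq) (simp add: power2_eq_square)

instance lsq :: (euclidean_space) complete_space
proof
  fix X :: "nat \<Rightarrow> 'a lsq" assume X: "Cauchy X"
  let ?f = "\<lambda>n. rep_lsq (X n)"
  have nrm: "(norm (X m - X n))\<^sup>2 = (\<integral>x. (?f m x - ?f n x)\<^sup>2 \<partial>lebesgue)" for m n
    using norm_abs_lsq[of "\<lambda>x. ?f m x - ?f n x"] abs_lsq_diff[of "?f m" "?f n"]
    by (simp add: square_integrable_rep_lsq square_integrable_diff)
  have "\<exists>N. \<forall>m\<ge>N. \<forall>n\<ge>N. (\<integral>x. (?f m x - ?f n x)\<^sup>2 \<partial>lebesgue) < e" if e: "e > 0" for e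
  proof -
    obtain N where "\<And>m n. m \<ge> N \<Longrightarrow> n \<ge> N \<Longrightarrow> norm (X m - X n) < sqrt e"
      using X e unfolding Cauchy_iff by (metis real_sqrt_gt_zero)
    then have "(norm (X m - X n))\<^sup>2 < e" if "m \<ge> N" "n \<ge> N" for m n
      using power_strict_mono[of "norm (X m - X n)" "sqrt e" 2] that e by simp
    then show ?thesis by (auto simp: nrm)
  qed
  then obtain g where g: "square_integrable lebesgue g"
    "(\<lambda>n. \<integral>x. (?f n x - g x)\<^sup>2 \<partial>lebesgue) \<longlonglongrightarrow> 0"
    using L2_complete[of lebesgue ?f] square_integrable_rep_lsq by blast
  have "(\<integral>x. (?f n x - g x)\<^sup>2 \<partial>lebesgue) = (norm (X n - abs_lsq g))\<^sup>2" for n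
    using norm_abs_lsq[of "\<lambda>x. ?f n x - g x"] abs_lsq_diff[of "?f n" g]
    by (simp add: square_integrable_rep_lsq square_integrable_diff g(1))
  then have "(\<lambda>n. sqrt ((norm (X n - abs_lsq g))\<^sup>2)) \<longlonglongrightarrow> sqrt 0"
    using g(2) by (intro tendsto_real_sqrt) simp
  then have "X \<longlonglongrightarrow> abs_lsq g"
    by (intro LIM_zero_cancel[of X]) (simp add: tendsto_norm_zero_iff)
  then show "convergent X" by (auto simp: convergent_def)
qed

instance lsq :: (euclidean_space) banach ..

text \<open>The indicator of the unit cube has norm 1, so the space is nontrivial. Nontriviality is
  what gives the identity operator norm 1, and thereby makes the bounded operators a unital normed
  algebra.\<close>

instance lsq :: (euclidean_space) perfect_space
proof
  fix h :: "'a lsq"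
  let ?f = "indicator (cbox 0 One) :: 'a \<Rightarrow> real"
  have sq: "(?f x)\<^sup>2 = ?f x" for x by (simp add: indicator_def)
  have "integrable lebesgue ?f" using lmeasurable_cbox lmeasurable_iff_integrable by blast
  then have f: "square_integrable lebesgue ?f"
    using borel_measurable_integrable[of lebesgue ?f] by (simp add: square_integrable_def sq)
  have "(norm (abs_lsq ?f))\<^sup>2 = 1"
    unfolding norm_abs_lsq[OF f] sq by (simp add: measure_completion content_unit del: content_cbox_if)
  then have n: "abs_lsq ?f \<noteq> 0" by auto
  show "\<not> open {h}"
  proof
    assume "open {h}"
    then obtain e where e: "e > 0" "\<And>y. dist y h < e \<Longrightarrow> y = h" by (auto simp: open_dist)
    let ?y = "h + (e / (2 * norm (abs_lsq ?f))) *\<^sub>R abs_lsq ?f"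
    have "dist ?y h < e" using n e(1) by (simp add: dist_norm)
    then have "?y = h" by (rule e(2))
    then show False using n e(1) by simp
  qed
qed

text \<open>All order information about the semigroup is expressed as invariance of these sets,
  which are closed, convex and, for nonnegative bounds, contain 0.\<close>

definition below :: "real \<Rightarrow> 'a::euclidean_space lsq set" where
  "below c = {h. AE x in lebesgue. rep_lsq h x \<le> c}"

lemma abs_lsq_below_iff:
  assumes "square_integrable lebesgue f"
  shows "abs_lsq f \<in> below c \<longleftrightarrow> (AE x in lebesgue. f x \<le> c)"
proof -
  have "AE x in lebesgue. rep_lsq (abs_lsq f) x \<le> c \<longleftrightarrow> f x \<le> c"
    using rep_abs_lsq[OF assms] by eventually_elim simp
  then show ?thesis unfolding below_def mem_Collect_eq by (rule eventually_subst)
qed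

lemma zero_in_below: "0 \<le> c \<Longrightarrow> 0 \<in> below c"
  unfolding zero_lsq_def using abs_lsq_below_iff[OF square_integrable_zero, of c] by simp

lemma convex_below: "convex (below c)"
proof (rule convexI)
  fix h k :: "'a lsq" and u v :: real
  assume hk: "h \<in> below c" "k \<in> below c" and uv: "0 \<le> u" "0 \<le> v" "u + v = 1"
  let ?f = "\<lambda>x. u * rep_lsq h x + v * rep_lsq k x"
  have "u *\<^sub>R h + v *\<^sub>R k = abs_lsq ?f"
    using abs_lsq_add[of "\<lambda>x. u * rep_lsq h x" "\<lambda>x. v * rep_lsq k x"]
      abs_lsq_scaleR[of "rep_lsq h" u] abs_lsq_scaleR[of "rep_lsq k" v]
    by (simp add: square_integrable_rep_lsq square_integrable_cmult)
  moreover have "AE x in lebesgue. ?f x \<le> c"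
    using hk[unfolded below_def mem_Collect_eq]
  proof eventually_elim
    fix x assume "rep_lsq h x \<le> c" "rep_lsq k x \<le> c"
    then have "?f x \<le> u * c + v * c" using uv by (intro add_mono mult_left_mono)
    then show "?f x \<le> c" using uv by (simp flip: distrib_right)
  qed
  ultimately show "u *\<^sub>R h + v *\<^sub>R k \<in> below c"
    by (simp add: abs_lsq_below_iff square_integrable_add square_integrable_cmult square_integrable_rep_lsq)
qed

text \<open>As \<open>X n\<close> is at most \<open>c\<close>, the positive part of
  \<open>h - c\<close> is bounded pointwise by the distance of \<open>h\<close> to
  \<open>X n\<close>; hence its L2 norm is at most \<open>norm (h - X n)\<close> for every
  \<open>n\<close> and must vanish.\<close>

lemma closed_below: "closed (below c)"
  unfolding closed_sequential_limits
proof (intro allI impI, elim conjE)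
  fix X and h :: "'a lsq" assume X: "\<forall>n. X n \<in> below c" and lim: "X \<longlonglongrightarrow> h"
  let ?p = "\<lambda>x. max 0 (rep_lsq h x - c)"
  have [measurable]: "rep_lsq k \<in> borel_measurable lebesgue" for k :: "'a lsq"
    using square_integrable_rep_lsq by (auto simp: square_integrable_def)
  have le: "(\<integral>\<^sup>+x. ennreal ((?p x)\<^sup>2) \<partial>lebesgue) \<le> ennreal ((norm (h - X n))\<^sup>2)" for n
  proof -
    have sq: "square_integrable lebesgue (\<lambda>x. rep_lsq h x - rep_lsq (X n) x)"
      by (intro square_integrable_diff square_integrable_rep_lsq)
    have "(\<integral>\<^sup>+x. ennreal ((?p x)\<^sup>2) \<partial>lebesgue) \<le> (\<integral>\<^sup>+x. ennreal ((rep_lsq h x - rep_lsq (X n) x)\<^sup>2) \<partial>lebesgue)"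
    proof (rule nn_integral_mono_AE)
      have "AE x in lebesgue. rep_lsq (X n) x \<le> c" using X by (simp add: below_def)
      then show "AE x in lebesgue. ennreal ((?p x)\<^sup>2) \<le> ennreal ((rep_lsq h x - rep_lsq (X n) x)\<^sup>2)"
      proof eventually_elim
        fix x assume "rep_lsq (X n) x \<le> c"
        then have "\<bar>?p x\<bar> \<le> \<bar>rep_lsq h x - rep_lsq (X n) x\<bar>" by auto
        then show "ennreal ((?p x)\<^sup>2) \<le> ennreal ((rep_lsq h x - rep_lsq (X n) x)\<^sup>2)"
          by (intro ennreal_leI) (simp only: abs_le_square_iff)
      qed
    qed
    also have "\<dots> \<le> ennreal ((norm (h - X n))\<^sup>2)"
    proof -
      have "h - X n = abs_lsq (\<lambda>x. rep_lsq h x - rep_lsq (X n) x)"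
        using abs_lsq_diff[of "rep_lsq h" "rep_lsq (X n)"] by (simp add: square_integrable_rep_lsq)
      then show ?thesis
        using integral_square_le_iff_nn[OF sq, of "(norm (h - X n))\<^sup>2"] norm_abs_lsq[OF sq] by simp
    qed
    finally show ?thesis .
  qed
  have "(\<lambda>n. ennreal ((norm (h - X n))\<^sup>2)) \<longlonglongrightarrow> ennreal ((norm (h - h))\<^sup>2)"
    by (intro tendsto_ennrealI tendsto_power tendsto_norm tendsto_diff tendsto_const lim)
  then have "(\<integral>\<^sup>+x. ennreal ((?p x)\<^sup>2) \<partial>lebesgue) \<le> ennreal ((norm (h - h))\<^sup>2)"
    by (rule LIMSEQ_le_const) (use le in blast)
  then have "(\<integral>\<^sup>+x. ennreal ((?p x)\<^sup>2) \<partial>lebesgue) = 0" by simp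
  then have "AE x in lebesgue. ennreal ((?p x)\<^sup>2) = 0"
    by (subst (asm) nn_integral_0_iff_AE) auto
  then have "AE x in lebesgue. rep_lsq h x \<le> c"
    by eventually_elim (auto simp: max_def split: if_splits)
  then show "h \<in> below c" by (simp add: below_def)
qed

section \<open>The Banach algebra of bounded operators\<close>

text \<open>A copy of the bounded operators whose multiplication is composition. As a unital Banach
  algebra it has \<open>exp\<close> with its power series, its derivative and the law for commuting
  exponents.\<close>

typedef (overloaded) 'a endo = "UNIV :: ('a::real_normed_vector \<Rightarrow>\<^sub>L 'a) set"
  by simp

setup_lifting type_definition_endo

instantiation endo :: (real_normed_vector) real_normed_vector
begin

lift_definition zero_endo :: "'a endo" is 0 .
lift_definition plus_endo :: "'a endo \<Rightarrow> 'a endo \<Rightarrow> 'a endo" is plus .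
lift_definition minus_endo :: "'a endo \<Rightarrow> 'a endo \<Rightarrow> 'a endo" is minus .
lift_definition uminus_endo :: "'a endo \<Rightarrow> 'a endo" is uminus .
lift_definition scaleR_endo :: "real \<Rightarrow> 'a endo \<Rightarrow> 'a endo" is scaleR .
lift_definition norm_endo :: "'a endo \<Rightarrow> real" is norm .
definition sgn_endo :: "'a endo \<Rightarrow> 'a endo" where "sgn_endo f = scaleR (inverse (norm f)) f"
definition dist_endo :: "'a endo \<Rightarrow> 'a endo \<Rightarrow> real" where "dist_endo f g = norm (f - g)"
definition uniformity_endo :: "('a endo \<times> 'a endo) filter" where
  "uniformity_endo = (INF e\<in>{0<..}. principal {(x, y). dist x y < e})"
definition open_endo :: "'a endo set \<Rightarrow> bool" where
  "open_endo U = (\<forall>x\<in>U. eventually (\<lambda>(x', y). x' = x \<longrightarrow> y \<in> U) uniformity)"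

instance
proof
  fix f g h :: "'a endo" and a b :: real
  show "f + g + h = f + (g + h)" by transfer simp
  show "f + g = g + f" by transfer simp
  show "0 + f = f" by transfer simp
  show "- f + f = 0" by transfer simp
  show "f - g = f + - g" by transfer simp
  show "a *\<^sub>R (f + g) = a *\<^sub>R f + a *\<^sub>R g" by transfer (rule scaleR_add_right)
  show "(a + b) *\<^sub>R f = a *\<^sub>R f + b *\<^sub>R f" by transfer (rule scaleR_add_left)
  show "a *\<^sub>R b *\<^sub>R f = (a * b) *\<^sub>R f" by transfer simp
  show "1 *\<^sub>R f = f" by transfer simp
  show "norm f = 0 \<longleftrightarrow> f = 0" by transfer simp
  show "norm (f + g) \<le> norm f + norm g" by transfer (rule norm_triangle_ineq)
  show "norm (a *\<^sub>R f) = \<bar>a\<bar> * norm f" by transfer simp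
  show "sgn f = scaleR (inverse (norm f)) f" by (rule sgn_endo_def)
  show "dist f g = norm (f - g)" by (rule dist_endo_def)
next
  show "uniformity = (INF e\<in>{0<..}. principal {(x, y::'a endo). dist x y < e})"
    by (rule uniformity_endo_def)
next
  fix U :: "'a endo set"
  show "open U = (\<forall>x\<in>U. \<forall>\<^sub>F (x', y) in uniformity. x' = x \<longrightarrow> y \<in> U)"
    by (rule open_endo_def)
qed

end

instance endo :: (banach) banach
proof
  fix X :: "nat \<Rightarrow> 'a endo" assume X: "Cauchy X"
  have "Cauchy (\<lambda>n. Rep_endo (X n))"
    using X unfolding Cauchy_def dist_norm norm_endo.rep_eq minus_endo.rep_eq .
  then obtain l where "(\<lambda>n. Rep_endo (X n)) \<longlonglongrightarrow> l"
    using Cauchy_convergent_iff convergent_def by blast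
  then have "X \<longlonglongrightarrow> Abs_endo l"
    unfolding lim_sequentially dist_norm norm_endo.rep_eq minus_endo.rep_eq
    by (simp add: Abs_endo_inverse)
  then show "convergent X" by (auto simp: convergent_def)
qed

instantiation endo :: ("{real_normed_vector, perfect_space}") real_normed_algebra_1
begin

lift_definition one_endo :: "'a endo" is id_blinfun .
lift_definition times_endo :: "'a endo \<Rightarrow> 'a endo \<Rightarrow> 'a endo" is blinfun_compose .

instance
proof
  fix f g h :: "'a endo" and a b :: real
  show "f * g * h = f * (g * h)" by transfer (auto intro!: blinfun_eqI)
  show "1 * f = f" by transfer (auto intro!: blinfun_eqI)
  show "f * 1 = f" by transfer (auto intro!: blinfun_eqI)
  show "(f + g) * h = f * h + g * h"
    by transfer (rule bounded_bilinear.add_left[OF bounded_bilinear_blinfun_compose])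
  show "f * (g + h) = f * g + f * h"
    by transfer (rule bounded_bilinear.add_right[OF bounded_bilinear_blinfun_compose])
  show "a *\<^sub>R f * g = a *\<^sub>R (f * g)"
    by transfer (rule bounded_bilinear.scaleR_left[OF bounded_bilinear_blinfun_compose])
  show "f * a *\<^sub>R g = a *\<^sub>R (f * g)"
    by transfer (rule bounded_bilinear.scaleR_right[OF bounded_bilinear_blinfun_compose])
  show "norm (1::'a endo) = 1" by transfer simp
  then show "(0::'a endo) \<noteq> 1" by (metis norm_zero zero_neq_one)
  show "norm (f * g) \<le> norm f * norm g"
    by transfer (rule norm_blinfun_compose)
qed

end

lift_definition ap :: "'a::real_normed_vector endo \<Rightarrow> 'a \<Rightarrow> 'a" is blinfun_apply .

lemma bounded_bilinear_ap: "bounded_bilinear ap"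
proof
  fix f g :: "'a endo" and x y :: 'a and r :: real
  show "ap (f + g) x = ap f x + ap g x" by transfer (rule blinfun.add_left)
  show "ap f (x + y) = ap f x + ap f y" by transfer (rule blinfun.add_right)
  show "ap (r *\<^sub>R f) x = r *\<^sub>R ap f x" by transfer (rule blinfun.scaleR_left)
  show "ap f (r *\<^sub>R x) = r *\<^sub>R ap f x" by transfer (rule blinfun.scaleR_right)
  have "\<forall>(f::'a endo) x. norm (ap f x) \<le> norm f * norm x * 1"
    by transfer (simp add: norm_blinfun)
  then show "\<exists>K. \<forall>(f::'a endo) x. norm (ap f x) \<le> norm f * norm x * K" by blast
qed

interpretation ap: bounded_bilinear ap
  by (rule bounded_bilinear_ap)

lemma norm_ap: "norm (ap f x) \<le> norm f * norm x"
  by transfer (rule norm_blinfun)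

lemma ap_one [simp]: "ap 1 x = x" by transfer simp

lemma ap_mult: "ap (f * g) x = ap f (ap g x)" by transfer simp

lemma endo_eqI: "(\<And>x. ap f x = ap g x) \<Longrightarrow> f = g"
  by transfer (rule blinfun_eqI)

definition Endo :: "('a::real_normed_vector \<Rightarrow> 'a) \<Rightarrow> 'a endo" where
  "Endo f = Abs_endo (Blinfun f)"

lemma ap_Endo: "bounded_linear f \<Longrightarrow> ap (Endo f) x = f x"
  by (simp add: Endo_def ap.rep_eq Abs_endo_inverse bounded_linear_Blinfun_apply)

lemma norm_endo_bound: "0 \<le> b \<Longrightarrow> (\<And>x. norm (ap f x) \<le> b * norm x) \<Longrightarrow> norm f \<le> b"
  by transfer (rule norm_blinfun_bound)

section \<open>Exponentials of bounded operators\<close>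

text \<open>The mass missing from 1 is placed at 0, after the given weights have been
  normalised.\<close>

lemma convex_sub_sum:
  assumes C: "convex C" "0 \<in> C" and "finite I"
    and a: "\<And>i. i \<in> I \<Longrightarrow> 0 \<le> a i" "sum a I \<le> 1" and y: "\<And>i. i \<in> I \<Longrightarrow> y i \<in> C"
  shows "(\<Sum>i\<in>I. a i *\<^sub>R y i) \<in> C"
proof (cases "sum a I = 0")
  case True
  then have "\<And>i. i \<in> I \<Longrightarrow> a i = 0" using a(1) \<open>finite I\<close> by (simp add: sum_nonneg_eq_0_iff)
  then show ?thesis using C(2) by simp
next
  case False
  let ?S = "sum a I"
  have S: "?S > 0" using False sum_nonneg[of I a] a(1) by simp
  have "(\<Sum>i\<in>I. (a i / ?S) *\<^sub>R y i) \<in> C"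
    by (rule convex_sum[OF \<open>finite I\<close> C(1)]) (use a y S in \<open>auto simp flip: sum_divide_distrib\<close>)
  then have "?S *\<^sub>R (\<Sum>i\<in>I. (a i / ?S) *\<^sub>R y i) + (1 - ?S) *\<^sub>R 0 \<in> C"
    by (intro convexD[OF C(1) _ C(2)]) (use S a in auto)
  then show ?thesis using S by (simp add: scaleR_right.sum)
qed

text \<open>The scalar part is split off so that a power series in \<open>b\<close> with nonnegative
  coefficients remains; estimates by norm and by convexity both depend on this form.\<close>

lemma exp_shift:
  fixes b :: "'a::{banach, perfect_space} endo"
  shows "exp (s *\<^sub>R (b - 1)) = exp (- s) *\<^sub>R exp (s *\<^sub>R b)"
proof -
  have "exp (s *\<^sub>R (b - 1)) = exp (s *\<^sub>R b + of_real (- s))"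
    by (simp add: scaleR_diff_right of_real_def)
  also have "\<dots> = exp (s *\<^sub>R b) * exp (of_real (- s))"
    by (rule exp_add_commuting) (simp add: of_real_def)
  also have "exp (of_real (- s)) = (of_real (exp (- s)) :: 'a endo)" by (rule exp_of_real)
  finally show ?thesis by (simp add: of_real_def)
qed

lemma ap_exp_sums: "(\<lambda>n. (1 / fact n) *\<^sub>R ap (X ^ n) f) sums ap (exp X) f"
  for X :: "'a::{banach, perfect_space} endo"
  using bounded_linear.sums[OF ap.bounded_linear_left exp_converges[of X], of f]
  by (simp add: ap.scaleR_left divide_inverse)

text \<open>The coefficients \<open>exp (- s) * s ^ n / fact n\<close> are Poisson weights. Each
  partial sum is thus a sub-convex combination of the iterates of \<open>b\<close> at
  \<open>f\<close>, which stay in \<open>C\<close>.\<close>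

lemma exp_invariant:
  fixes b :: "'a::{banach, perfect_space} endo"
  assumes C: "closed C" "convex C" "0 \<in> C" and b: "\<And>x. x \<in> C \<Longrightarrow> ap b x \<in> C"
    and s: "0 \<le> s" and f: "f \<in> C"
  shows "ap (exp (s *\<^sub>R (b - 1))) f \<in> C"
proof -
  have pow: "ap (b ^ n) f \<in> C" for n
    by (induction n) (auto simp: f ap_mult b)
  let ?a = "\<lambda>n. exp (- s) * s ^ n / fact n"
  have "(\<lambda>n. exp (- s) *\<^sub>R (1 / fact n) *\<^sub>R ap ((s *\<^sub>R b) ^ n) f) sums (exp (- s) *\<^sub>R ap (exp (s *\<^sub>R b)) f)"
    by (intro sums_scaleR_right ap_exp_sums)
  then have "(\<lambda>n. ?a n *\<^sub>R ap (b ^ n) f) sums ap (exp (s *\<^sub>R (b - 1))) f"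
    by (simp add: exp_shift ap.scaleR_left scaleR_power)
  then have lim: "(\<lambda>N. \<Sum>n<N. ?a n *\<^sub>R ap (b ^ n) f) \<longlonglongrightarrow> ap (exp (s *\<^sub>R (b - 1))) f"
    by (simp add: sums_def)
  have asum: "?a sums 1"
  proof -
    have "(\<lambda>n. exp (- s) * (s ^ n /\<^sub>R fact n)) sums (exp (- s) * exp s)"
      by (intro sums_mult exp_converges)
    then show ?thesis by (simp add: divide_inverse mult_ac flip: exp_add)
  qed
  have "(\<Sum>n<N. ?a n) \<le> 1" for N
    using sum_le_suminf[of ?a "{..<N}"] asum s by (simp add: sums_iff)
  then have "(\<Sum>n<N. ?a n *\<^sub>R ap (b ^ n) f) \<in> C" for N
    by (intro convex_sub_sum C pow) (use s in auto)
  then show ?thesis by (rule closed_sequentially[OF C(1) _ lim])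
qed

text \<open>The exponential of \<open>s\<close> times \<open>b\<close> grows at most like
  \<open>exp s\<close>, which the scalar factor cancels. A direct estimate by the norm of
  \<open>b - 1\<close> would only give \<open>exp (2 * s)\<close>.\<close>

lemma norm_exp_contraction:
  fixes b :: "'a::{banach, perfect_space} endo"
  assumes "norm b \<le> 1" "0 \<le> s"
  shows "norm (exp (s *\<^sub>R (b - 1))) \<le> 1"
proof -
  have "norm (exp (s *\<^sub>R (b - 1))) \<le> exp (- s) * exp (norm (s *\<^sub>R b))"
    using norm_exp[of "s *\<^sub>R b"] by (simp only: exp_shift norm_scaleR abs_exp_cancel mult_left_mono exp_ge_zero)
  also have "\<dots> \<le> exp (- s) * exp s"
    using assms mult_left_le[of "norm b" s] by (intro mult_left_mono) auto
  finally show ?thesis by (simp flip: exp_add)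
qed

lemma exp_symmetric:
  fixes X :: "'a::{real_inner, banach, perfect_space} endo"
  assumes X: "\<And>f g. ap X f \<bullet> g = f \<bullet> ap X g"
  shows "ap (exp X) f \<bullet> g = f \<bullet> ap (exp X) g"
proof -
  have pow: "ap (X ^ n) f \<bullet> g = f \<bullet> ap (X ^ n) g" for n f g
  proof (induction n arbitrary: f g)
    case (Suc n)
    have "ap (X ^ Suc n) f \<bullet> g = ap (X ^ n) f \<bullet> ap X g" by (simp add: ap_mult X)
    also have "\<dots> = f \<bullet> ap (X ^ Suc n) g"
      unfolding power_Suc2 by (simp add: ap_mult Suc)
    finally show ?case .
  qed simp
  have "(\<lambda>n. ((1 / fact n) *\<^sub>R ap (X ^ n) f) \<bullet> g) sums (ap (exp X) f \<bullet> g)"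
    by (rule bounded_linear.sums[OF bounded_linear_inner_left ap_exp_sums])
  moreover have "(\<lambda>n. f \<bullet> ((1 / fact n) *\<^sub>R ap (X ^ n) g)) sums (f \<bullet> ap (exp X) g)"
    by (rule bounded_linear.sums[OF bounded_linear_inner_right ap_exp_sums])
  ultimately show ?thesis by (simp add: pow sums_iff)
qed

text \<open>The mean value inequality for the orbit minus the line with velocity \<open>w\<close>.
  With \<open>w = 0\<close> it compares orbits, with \<open>w\<close> the expected derivative it
  controls difference quotients.\<close>

lemma exp_derivative_bound:
  fixes X P :: "'a::{banach, perfect_space} endo"
  assumes K: "\<And>s. 0 \<le> s \<Longrightarrow> s \<le> t \<Longrightarrow> norm (ap (P * exp (s *\<^sub>R X)) (ap X u) - w) \<le> K" and t: "0 \<le> t"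
  shows "norm (ap (P * exp (t *\<^sub>R X)) u - ap P u - t *\<^sub>R w) \<le> K * t"
proof -
  let ?f = "\<lambda>s. ap (P * exp (s *\<^sub>R X)) u - s *\<^sub>R w"
  have der: "(?f has_vector_derivative (ap (P * exp (s *\<^sub>R X)) (ap X u) - w)) (at s within {0..t})" for s
  proof -
    have "((\<lambda>s. ap P (ap (exp (s *\<^sub>R X)) u)) has_vector_derivative ap P (ap (exp (s *\<^sub>R X) * X) u)) (at s within {0..t})"
      by (intro bounded_linear.has_vector_derivative[OF ap.bounded_linear_right]
          bounded_linear.has_vector_derivative[OF ap.bounded_linear_left] exp_scaleR_has_vector_derivative_right)
    moreover have "((\<lambda>s. s *\<^sub>R w) has_vector_derivative 1 *\<^sub>R w) (at s within {0..t})"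
      by (auto intro!: derivative_eq_intros)
    ultimately show ?thesis
      unfolding ap_mult by (metis (mono_tags) has_vector_derivative_diff scaleR_one)
  qed
  have "norm (?f t - ?f 0) \<le> K * norm (t - 0)"
  proof (rule differentiable_bound[of "{0..t}"])
    show "(?f has_derivative (\<lambda>h. h *\<^sub>R (ap (P * exp (s *\<^sub>R X)) (ap X u) - w))) (at s within {0..t})" for s
      using der[of s] by (simp add: has_vector_derivative_def)
    show "onorm (\<lambda>h. h *\<^sub>R (ap (P * exp (s *\<^sub>R X)) (ap X u) - w)) \<le> K" if "s \<in> {0..t}" for s
      using K[of s] that by (simp add: onorm_scaleR_left onorm_id bounded_linear_ident)
  qed (use t in auto)
  then show ?thesis using t by (simp add: algebra_simps)
qed


section \<open>The semigroup generated by a symmetric monotone linear relation\<close>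

lemma subspace_closure:
  fixes V :: "'a::real_normed_vector set"
  assumes "subspace V"
  shows "subspace (closure V)"
proof (rule subspaceI)
  show "0 \<in> closure V" using closure_subset subspace_0[OF assms] by blast
  show "x + y \<in> closure V" if xy: "x \<in> closure V" "y \<in> closure V" for x y
  proof -
    obtain a where "\<forall>n. a n \<in> V" "a \<longlonglongrightarrow> x" using xy(1) unfolding closure_sequential by blast
    moreover obtain b where "\<forall>n. b n \<in> V" "b \<longlonglongrightarrow> y" using xy(2) unfolding closure_sequential by blast
    ultimately have "\<forall>n. a n + b n \<in> V" "(\<lambda>n. a n + b n) \<longlonglongrightarrow> x + y"
      using subspace_add[OF assms] by (auto intro: tendsto_add)
    then show ?thesis unfolding closure_sequential by (intro exI[of _ "\<lambda>n. a n + b n"]) blast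
  qed
  show "c *\<^sub>R x \<in> closure V" if x: "x \<in> closure V" for c x
  proof -
    obtain a where "\<forall>n. a n \<in> V" "a \<longlonglongrightarrow> x" using x unfolding closure_sequential by blast
    then have "\<forall>n. c *\<^sub>R a n \<in> V" "(\<lambda>n. c *\<^sub>R a n) \<longlonglongrightarrow> c *\<^sub>R x"
      using subspace_scale[OF assms] by (auto intro: tendsto_scaleR)
    then show ?thesis unfolding closure_sequential by (intro exI[of _ "\<lambda>n. c *\<^sub>R a n"]) blast
  qed
qed

text \<open>
  A pair in \<open>G\<close> consists of a vector and a value of the \<^emph>\<open>negative\<close> of the generator. The domain of
  \<open>G\<close> need not be dense; \<open>G\<close> is single-valued only modulo the orthogonal complement of the domain,
  and the semigroup lives on the closure \<open>H0\<close> of the domain.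
\<close>

locale monotone_relation =
  fixes G :: "('h::{real_inner, banach, perfect_space} \<times> 'h) set"
  assumes lin: "\<And>u v u' v' c. (u, v) \<in> G \<Longrightarrow> (u', v') \<in> G \<Longrightarrow> (u + c *\<^sub>R u', v + c *\<^sub>R v') \<in> G"
    and mono: "\<And>u v. (u, v) \<in> G \<Longrightarrow> 0 \<le> u \<bullet> v"
    and sym: "\<And>u v u' v'. (u, v) \<in> G \<Longrightarrow> (u', v') \<in> G \<Longrightarrow> v \<bullet> u' = u \<bullet> v'"
    and surj: "\<And>c f. 0 < c \<Longrightarrow> \<exists>u v. (u, v) \<in> G \<and> v + c *\<^sub>R u = f"
begin

lemma diff: "(u, v) \<in> G \<Longrightarrow> (u', v') \<in> G \<Longrightarrow> (u - u', v - v') \<in> G"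
  using lin[of u v u' v' "-1"] by simp

lemma zero: "(0, 0) \<in> G"
  using surj[of 1 0] diff by fastforce

definition H0 :: "'h set" where "H0 = closure (fst ` G)"

lemma subspace_H0: "subspace H0"
proof -
  have "subspace (fst ` G)"
  proof (rule subspaceI)
    show "0 \<in> fst ` G" using zero by force
    show "x + y \<in> fst ` G" if "x \<in> fst ` G" "y \<in> fst ` G" for x y
      using that lin[of _ _ _ _ 1] by force
    show "c *\<^sub>R x \<in> fst ` G" if "x \<in> fst ` G" for c x
      using that lin[OF zero, of _ _ c] by force
  qed
  then show ?thesis unfolding H0_def by (rule subspace_closure)
qed

lemma closed_H0: "closed H0" by (simp add: H0_def)

lemma domain_H0: "(u, v) \<in> G \<Longrightarrow> u \<in> H0"
  unfolding H0_def using closure_subset by force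

section \<open>Resolvents and Yosida approximations\<close>

definition res :: "real \<Rightarrow> 'h \<Rightarrow> 'h" where
  "res c f = (THE u. (u, f - c *\<^sub>R u) \<in> G)"

text \<open>Pair \<open>v + c *\<^sub>R u\<close> with \<open>u\<close>: monotonicity discards the
  product of \<open>u\<close> and \<open>v\<close>, and the Cauchy-Schwarz inequality cancels one
  factor \<open>norm u\<close>.\<close>

lemma resolvent_bound:
  assumes "(u, v) \<in> G" "0 < c"
  shows "c * norm u \<le> norm (v + c *\<^sub>R u)"
proof (cases "u = 0")
  case False
  have "c * (norm u)\<^sup>2 \<le> (v + c *\<^sub>R u) \<bullet> u"
    using mono[OF assms(1)]
    by (simp only: inner_add_left inner_scaleR_left power2_norm_eq_inner) (simp add: inner_commute)
  also have "\<dots> \<le> norm (v + c *\<^sub>R u) * norm u" by (rule norm_cauchy_schwarz)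
  finally show ?thesis using False by (simp add: power2_eq_square)
qed simp

text \<open>The difference of two solutions solves the equation with right-hand side 0, so
  \<open>resolvent_bound\<close> makes it vanish. The first entry is therefore determined even where
  \<open>G\<close> is multivalued.\<close>

lemma res_eq:
  assumes "(u, v) \<in> G" "0 < c"
  shows "res c (v + c *\<^sub>R u) = u"
  unfolding res_def
proof (rule the_equality)
  show "(u, v + c *\<^sub>R u - c *\<^sub>R u) \<in> G" using assms by simp
  fix w assume "(w, v + c *\<^sub>R u - c *\<^sub>R w) \<in> G"
  from diff[OF this assms(1)] have "(w - u, c *\<^sub>R u - c *\<^sub>R w) \<in> G" by (simp add: algebra_simps)
  from resolvent_bound[OF this assms(2)] show "w = u"
    using assms(2) by (simp add: algebra_simps mult_le_0_iff)
qed

lemma res_in: "0 < c \<Longrightarrow> (res c f, f - c *\<^sub>R res c f) \<in> G"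
  using surj[of c f] res_eq by force

lemma res_eqI: "(u, f - c *\<^sub>R u) \<in> G \<Longrightarrow> 0 < c \<Longrightarrow> res c f = u"
  using res_eq[of u "f - c *\<^sub>R u" c] by simp

lemma norm_res: "0 < c \<Longrightarrow> c * norm (res c f) \<le> norm f"
  using resolvent_bound[OF res_in, of c c f] by simp

lemma bounded_linear_res: "0 < c \<Longrightarrow> bounded_linear (res c)"
proof (rule bounded_linear_intro)
  assume c: "0 < c"
  show "res c (x + y) = res c x + res c y" for x y
    using lin[OF res_in[OF c] res_in[OF c], of x 1 y] c by (intro res_eqI) (simp_all add: algebra_simps)
  show "res c (r *\<^sub>R x) = r *\<^sub>R res c x" for r x
    using lin[OF zero res_in[OF c], of r x] c by (intro res_eqI) (simp_all add: algebra_simps)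
  show "norm (res c x) \<le> norm x * (1 / c)" for x
    using norm_res[OF c, of x] c by (simp add: field_simps)
qed

definition B :: "real \<Rightarrow> 'h endo" where "B c = Endo (\<lambda>f. c *\<^sub>R res c f)"

definition A :: "real \<Rightarrow> 'h endo" where "A c = c *\<^sub>R (B c - 1)"

lemma ap_B: "0 < c \<Longrightarrow> ap (B c) f = c *\<^sub>R res c f"
  unfolding B_def by (rule ap_Endo) (intro bounded_linear_scaleR_const bounded_linear_const_scaleR bounded_linear_res)

lemma norm_B: "0 < c \<Longrightarrow> norm (B c) \<le> 1"
  using norm_res by (intro norm_endo_bound) (auto simp: ap_B)

text \<open>On the domain the large factor \<open>c\<close> is absorbed by the resolvent, and only a
  contraction applied to \<open>- v\<close> remains. This gives a bound uniform in \<open>c\<close>,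
  and convergence as \<open>c\<close> grows whenever \<open>v\<close> lies in
  \<open>H0\<close>.\<close>

lemma ap_A:
  assumes "(u, v) \<in> G" "0 < c"
  shows "ap (A c) u = - ap (B c) v"
proof -
  have "u = res c v + c *\<^sub>R res c u"
    using res_eq[OF assms] bounded_linear.linear[OF bounded_linear_res[OF assms(2)]]
    by (simp add: linear_add linear_scale)
  then have "c *\<^sub>R u = c *\<^sub>R res c v + c *\<^sub>R c *\<^sub>R res c u"
    by (metis scaleR_add_right)
  then show ?thesis
    using assms(2) by (simp add: A_def ap.scaleR_left ap.diff_left ap_B algebra_simps)
qed

lemma norm_A: "(u, v) \<in> G \<Longrightarrow> 0 < c \<Longrightarrow> norm (ap (A c) u) \<le> norm v"
  using norm_ap[of "B c" v] norm_B[of c] mult_right_mono[of "norm (B c)" 1 "norm v"] by (simp add: ap_A)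

text \<open>The steps \<open>1\<close> and \<open>2\<close> are the resolvent identity with the
  roles of \<open>c\<close> and \<open>d\<close> exchanged; their left-hand sides are opposite, and
  the factor \<open>c - d\<close> can be cancelled.\<close>

lemma res_commute: "0 < c \<Longrightarrow> 0 < d \<Longrightarrow> res c (res d f) = res d (res c f)"
proof (cases "c = d")
  case False
  assume cd: "0 < c" "0 < d"
  let ?p = "res d f" and ?u = "res c f"
  have lin': "res e (x - y) = res e x - res e y" "res e (r *\<^sub>R x) = r *\<^sub>R res e x" if "0 < e" for e x y r
    using bounded_linear.linear[OF bounded_linear_res[OF that]] by (auto simp: linear_diff linear_scale)
  have 1: "?p - ?u = (c - d) *\<^sub>R res d ?u"
  proof -
    have "f - c *\<^sub>R ?u + d *\<^sub>R ?u = f - (c - d) *\<^sub>R ?u" by (simp add: algebra_simps)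
    then have "?u = ?p - (c - d) *\<^sub>R res d ?u"
      using res_eq[OF res_in[OF cd(1), of f] cd(2)] by (simp only: lin'[OF cd(2)])
    then show ?thesis by (simp add: algebra_simps)
  qed
  have 2: "?u - ?p = (d - c) *\<^sub>R res c ?p"
  proof -
    have "f - d *\<^sub>R ?p + c *\<^sub>R ?p = f - (d - c) *\<^sub>R ?p" by (simp add: algebra_simps)
    then have "?p = ?u - (d - c) *\<^sub>R res c ?p"
      using res_eq[OF res_in[OF cd(2), of f] cd(1)] by (simp only: lin'[OF cd(1)])
    then show ?thesis by (simp add: algebra_simps)
  qed
  have "(c - d) *\<^sub>R res d ?u = - ((d - c) *\<^sub>R res c ?p)"
    unfolding 1[symmetric] 2[symmetric] by simp
  then have "(c - d) *\<^sub>R res d ?u = (c - d) *\<^sub>R res c ?p"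
    by (metis minus_diff_eq scaleR_minus_left)
  then show ?thesis using False by simp
qed simp

lemma A_commute: 
  assumes "0 < c" "0 < d"
  shows "A c * A d = A d * A c"
proof -
  have "B c * B d = B d * B c"
    using assms bounded_linear.linear[OF bounded_linear_res]
    by (intro endo_eqI) (simp add: ap_mult ap_B linear_scale res_commute)
  then show ?thesis by (simp add: A_def algebra_simps)
qed

text \<open>In the symmetry of \<open>G\<close> for the two resolvent pairs the terms with the
  factor \<open>c\<close> are equal and cancel.\<close>

lemma res_symmetric: "0 < c \<Longrightarrow> res c f \<bullet> g = f \<bullet> res c g"
  using sym[OF res_in res_in, of c c f g] by (simp add: algebra_simps)

lemma A_symmetric: "0 < c \<Longrightarrow> ap (A c) f \<bullet> g = f \<bullet> ap (A c) g"
  using res_symmetric by (simp add: A_def ap.scaleR_left ap.diff_left ap_B inner_diff_left inner_diff_right)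

section \<open>Exponentials of the Yosida approximations\<close>

definition E :: "real \<Rightarrow> real \<Rightarrow> 'h endo" where "E c t = exp (t *\<^sub>R A c)"

lemma norm_E: "0 < c \<Longrightarrow> 0 \<le> t \<Longrightarrow> norm (E c t) \<le> 1"
  using norm_exp_contraction[OF norm_B, of c "t * c"] by (simp add: E_def A_def)

lemma norm_ap_E: "0 < c \<Longrightarrow> 0 \<le> t \<Longrightarrow> norm (ap (E c t) f) \<le> norm f"
  using norm_ap[of "E c t" f] norm_E[of c t] mult_right_mono[of "norm (E c t)" 1 "norm f"] by simp

lemma E_invariant:
  assumes "closed C" "convex C" "0 \<in> C" "\<And>x. x \<in> C \<Longrightarrow> ap (B c) x \<in> C" "0 < c" "0 \<le> t" "f \<in> C"
  shows "ap (E c t) f \<in> C"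
  using exp_invariant[OF assms(1-4), of "t * c" f] assms(5-7) by (simp add: E_def A_def)

text \<open>A closed subspace is a closed convex set containing 0, so the invariance principle for
  order bounds applies to it as well.\<close>

lemma E_H0: "0 < c \<Longrightarrow> 0 \<le> t \<Longrightarrow> f \<in> H0 \<Longrightarrow> ap (E c t) f \<in> H0"
  using domain_H0[OF res_in] subspace_H0
  by (intro E_invariant closed_H0) (auto simp: ap_B subspace_imp_convex subspace_0 subspace_scale)

lemma E_add: "E c (s + t) = E c s * E c t"
  unfolding E_def by (subst exp_add_commuting[symmetric]) (simp_all add: scaleR_add_left)

lemma E_minus_id: "0 < c \<Longrightarrow> 0 \<le> t \<Longrightarrow> norm (ap (E c t) x - x) \<le> t * norm (ap (A c) x)"
  using exp_derivative_bound[of t 1 "A c" x 0 "norm (ap (A c) x)"] norm_ap_E[of c]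
  by (simp add: E_def mult.commute)

text \<open>Interpolate between the two exponentials by \<open>E c s * E d (t - s)\<close>. Since
  the generators commute, its derivative in \<open>s\<close> is this contraction composed with
  \<open>A c - A d\<close>.\<close>

lemma E_diff:
  assumes "0 < c" "0 < d" "0 \<le> t"
  shows "norm (ap (E c t) x - ap (E d t) x) \<le> t * norm (ap (A c) x - ap (A d) x)"
proof -
  let ?X = "A c - A d"
  have com: "A d * ?X = ?X * A d" using A_commute[OF assms(1,2)] by (simp add: algebra_simps)
  have split: "exp (t *\<^sub>R A d) * exp (s *\<^sub>R ?X) = E c s * E d (t - s)" for s
  proof -
    have "exp (t *\<^sub>R A d) * exp (s *\<^sub>R ?X) = exp (t *\<^sub>R A d + s *\<^sub>R ?X)"
      using com by (intro exp_add_commuting[symmetric]) simp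
    also have "t *\<^sub>R A d + s *\<^sub>R ?X = s *\<^sub>R A c + (t - s) *\<^sub>R A d" by (simp add: algebra_simps)
    also have "exp \<dots> = E c s * E d (t - s)"
      unfolding E_def using A_commute[OF assms(1,2)] by (intro exp_add_commuting) simp
    finally show ?thesis .
  qed
  have "norm (ap (exp (t *\<^sub>R A d) * exp (s *\<^sub>R ?X)) (ap ?X x) - 0) \<le> norm (ap ?X x)" if "0 \<le> s" "s \<le> t" for s
  proof -
    have "norm (ap (E c s) (ap (E d (t - s)) (ap ?X x))) \<le> norm (ap (E d (t - s)) (ap ?X x))"
      using assms that by (intro norm_ap_E)
    also have "\<dots> \<le> norm (ap ?X x)" using assms that by (intro norm_ap_E) auto
    finally show ?thesis by (simp add: split ap_mult)
  qed
  from exp_derivative_bound[OF this assms(3)]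
  have "norm (ap (exp (t *\<^sub>R A d) * exp (t *\<^sub>R ?X)) x - ap (exp (t *\<^sub>R A d)) x) \<le> norm (ap ?X x) * t" by simp
  then show ?thesis unfolding split by (simp add: E_def ap.diff_left mult.commute)
qed

text \<open>The part of \<open>G\<close> in \<open>H0\<close>. It is single-valued: if
  \<open>(0, v)\<close> lies in \<open>G\<close>, then symmetry makes \<open>v\<close> orthogonal to
  the domain and hence to \<open>H0\<close>.\<close>

definition D2 :: "('h \<times> 'h) set" where "D2 = {(u, v) \<in> G. v \<in> H0}"

lemma B_minus_id: "(u, v) \<in> G \<Longrightarrow> 0 < c \<Longrightarrow> norm (ap (B c) u - u) \<le> norm v / c"
  using norm_A[of u v c]
  by (simp add: A_def ap.scaleR_left ap.diff_left pos_le_divide_eq mult.commute flip: scaleR_diff_right)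

lemma norm_ap_B: "0 < c \<Longrightarrow> norm (ap (B c) f) \<le> norm f"
  using norm_res[of c f] by (simp add: ap_B)

text \<open>On the domain the error is at most \<open>norm v / c\<close>; uniform contractivity of
  \<open>B c\<close> carries the convergence over to the closure of the domain.\<close>

lemma B_tendsto:
  assumes f: "f \<in> H0"
  shows "((\<lambda>c. ap (B c) f) \<longlongrightarrow> f) at_top"
proof (rule tendstoI)
  fix e :: real assume e: "0 < e"
  obtain u v where uv: "(u, v) \<in> G" "norm (u - f) < e / 4"
  proof -
    have "e / 4 > 0" using e by simp
    then obtain u where "u \<in> fst ` G" "norm (u - f) < e / 4"
      using f unfolding H0_def closure_approachable dist_norm by blast
    then show ?thesis using that by force
  qed
  have "\<forall>\<^sub>F c in at_top. c > max 0 (norm v / (e / 4))" by (rule eventually_gt_at_top)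
  then show "\<forall>\<^sub>F c in at_top. dist (ap (B c) f) f < e"
  proof eventually_elim
    fix c assume c: "c > max 0 (norm v / (e / 4))"
    have eq: "ap (B c) f - f = ap (B c) (f - u) + (ap (B c) u - u) + (u - f)"
      by (simp add: ap.diff_right)
    have "norm (ap (B c) f - f) \<le> norm (ap (B c) (f - u)) + norm (ap (B c) u - u) + norm (u - f)"
      unfolding eq by (intro norm_triangle_le add_mono norm_triangle_ineq order_refl)
    moreover have "norm (ap (B c) (f - u)) \<le> norm (u - f)"
      using norm_ap_B[of c "f - u"] c by (simp add: norm_minus_commute)
    moreover have "norm v / c < e / 4"
    proof -
      have "0 < c" "norm v / (e / 4) < c" using c by auto
      then show ?thesis using e by (simp add: field_simps)
    qed
    moreover have "norm (ap (B c) u - u) \<le> norm v / c" using B_minus_id[OF uv(1)] c by simp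
    ultimately show "dist (ap (B c) f) f < e" using uv(2) e unfolding dist_norm by linarith
  qed
qed

text \<open>Integer parameters make the limit that defines \<open>S\<close> sequential; the
  successor keeps the resolvent parameter positive.\<close>

definition step :: "nat \<Rightarrow> real" where "step n = real (Suc n)"

lemma step_pos [simp]: "0 < step n" by (simp add: step_def)

lemma B_tendsto_seq: "f \<in> H0 \<Longrightarrow> (\<lambda>n. ap (B (step n)) f) \<longlonglongrightarrow> f"
  unfolding step_def
  by (rule filterlim_compose[OF B_tendsto filterlim_compose[OF filterlim_real_sequentially filterlim_Suc]])

text \<open>The approximants \<open>ap (B c) f\<close> already belong to the domain of
  \<open>D2\<close>: their values are \<open>c\<close> times the difference of \<open>f\<close> and
  \<open>ap (B c) f\<close>, and both of these lie in \<open>H0\<close>.\<close>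

lemma D2_dense:
  assumes f: "f \<in> H0" and e: "0 < e"
  obtains u v where "(u, v) \<in> D2" "norm (u - f) < e"
proof -
  have "\<forall>\<^sub>F c in at_top. dist (ap (B c) f) f < e \<and> c > 0"
    using tendstoD[OF B_tendsto[OF f] e] eventually_gt_at_top[of 0] by (rule eventually_conj)
  then obtain c where c: "dist (ap (B c) f) f < e" "c > 0"
    by (metis (no_types, lifting) eventually_happens trivial_limit_at_top_linorder)
  have "(c *\<^sub>R res c f, c *\<^sub>R (f - c *\<^sub>R res c f)) \<in> G"
    using lin[OF zero res_in[OF c(2)], of c f] by simp
  moreover have "c *\<^sub>R (f - c *\<^sub>R res c f) \<in> H0"
    using subspace_H0 f domain_H0[OF res_in[OF c(2)]] by (simp add: subspace_diff subspace_scale)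
  ultimately show ?thesis using c that by (simp add: D2_def ap_B dist_norm)
qed

section \<open>The limit semigroup and its generator\<close>

definition S :: "real \<Rightarrow> 'h \<Rightarrow> 'h" where
  "S t f = lim (\<lambda>n. ap (E (step n) t) f)"

text \<open>For a pair of \<open>D2\<close>, \<open>E_diff\<close> and \<open>ap_A\<close> reduce
  the Cauchy property to that of \<open>ap (B (step n)) v\<close>, which converges as
  \<open>v\<close> lies in \<open>H0\<close>. Contractivity and density of \<open>D2\<close> extend
  this to \<open>H0\<close>.\<close>

lemma S_lim:
  assumes f: "f \<in> H0" and t: "0 \<le> t"
  shows "(\<lambda>n. ap (E (step n) t) f) \<longlonglongrightarrow> S t f"
proof -
  have "Cauchy (\<lambda>n. ap (E (step n) t) f)"
  proof (rule metric_CauchyI)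
    fix e :: real assume e: "0 < e"
    obtain u v where uv: "(u, v) \<in> D2" "norm (u - f) < e / 4" using D2_dense[OF f, of "e/4"] e by auto
    then have G: "(u, v) \<in> G" and v: "v \<in> H0" by (auto simp: D2_def)
    have "Cauchy (\<lambda>n. ap (B (step n)) v)"
      using B_tendsto_seq[OF v] by (rule LIMSEQ_imp_Cauchy)
    \<comment> \<open>The summand 1 keeps the denominator positive for \<open>t = 0\<close>; after
      multiplication by \<open>t\<close> at most \<open>e / 2\<close> is left.\<close>
    then obtain N where N: "\<And>m n. m \<ge> N \<Longrightarrow> n \<ge> N \<Longrightarrow> dist (ap (B (step m)) v) (ap (B (step n)) v) < e / (2 * (t + 1))"
      unfolding Cauchy_def using e t by (metis add_nonneg_pos divide_pos_pos mult_pos_pos zero_less_numeral zero_less_one)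
    show "\<exists>M. \<forall>m\<ge>M. \<forall>n\<ge>M. dist (ap (E (step m) t) f) (ap (E (step n) t) f) < e"
    proof (intro exI allI impI)
      fix m n assume mn: "m \<ge> N" "n \<ge> N"
      let ?P = "E (step m) t" and ?Q = "E (step n) t"
      have eq: "ap ?P f - ap ?Q f = ap ?P (f - u) + (ap ?P u - ap ?Q u) + ap ?Q (u - f)"
        by (simp add: ap.diff_right)
      have "norm (ap ?P f - ap ?Q f) \<le> norm (ap ?P (f - u)) + norm (ap ?P u - ap ?Q u) + norm (ap ?Q (u - f))"
        unfolding eq by (intro norm_triangle_le add_mono norm_triangle_ineq order_refl)
      moreover have "norm (ap ?P (f - u)) \<le> norm (u - f)" "norm (ap ?Q (u - f)) \<le> norm (u - f)"
        using norm_ap_E[of "step m" t "f - u"] norm_ap_E[of "step n" t "u - f"] t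
        by (simp_all add: norm_minus_commute)
      moreover have "norm (ap ?P u - ap ?Q u) \<le> t * (e / (2 * (t + 1)))"
      proof -
        have "norm (ap ?P u - ap ?Q u) \<le> t * norm (ap (A (step m)) u - ap (A (step n)) u)"
          by (rule E_diff) (use t in auto)
        also have "norm (ap (A (step m)) u - ap (A (step n)) u) =
            dist (ap (B (step m)) v) (ap (B (step n)) v)"
          by (simp add: ap_A[OF G] dist_norm norm_minus_commute)
        also have "t * \<dots> \<le> t * (e / (2 * (t + 1)))" using N[OF mn] t by (intro mult_left_mono) auto
        finally show ?thesis .
      qed
      moreover have "t * (e / (2 * (t + 1))) \<le> e / 2" using t e by (simp add: field_simps)
      ultimately show "dist (ap ?P f) (ap ?Q f) < e" using uv(2) e unfolding dist_norm by linarith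
    qed
  qed
  then show ?thesis unfolding S_def by (simp add: Cauchy_convergent_iff convergent_LIMSEQ_iff)
qed

lemma S_invariant:
  assumes "closed C" "convex C" "0 \<in> C" "\<And>c x. 0 < c \<Longrightarrow> x \<in> C \<Longrightarrow> c *\<^sub>R res c x \<in> C"
    and "f \<in> C" "f \<in> H0" "0 \<le> t"
  shows "S t f \<in> C"
  by (rule closed_sequentially[OF assms(1) _ S_lim[OF assms(6,7)]])
    (intro E_invariant, use assms ap_B in auto)

lemma S_H0: "f \<in> H0 \<Longrightarrow> 0 \<le> t \<Longrightarrow> S t f \<in> H0"
  by (rule closed_sequentially[OF closed_H0 _ S_lim]) (auto intro: E_H0)

lemma norm_S: "f \<in> H0 \<Longrightarrow> 0 \<le> t \<Longrightarrow> norm (S t f) \<le> norm f"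
  by (rule LIMSEQ_le_const2[OF tendsto_norm[OF S_lim]]) (auto intro!: exI[of _ 0] norm_ap_E)

lemma S_add: "f \<in> H0 \<Longrightarrow> g \<in> H0 \<Longrightarrow> 0 \<le> t \<Longrightarrow> S t (f + g) = S t f + S t g"
  by (rule LIMSEQ_unique[OF S_lim[OF subspace_add[OF subspace_H0]]])
    (auto simp: ap.add_right intro!: tendsto_add S_lim)

lemma S_scaleR: "f \<in> H0 \<Longrightarrow> 0 \<le> t \<Longrightarrow> S t (c *\<^sub>R f) = c *\<^sub>R S t f"
  by (rule LIMSEQ_unique[OF S_lim[OF subspace_scale[OF subspace_H0]]])
    (auto simp: ap.scaleR_right intro!: tendsto_scaleR S_lim)

lemma S_diff: "f \<in> H0 \<Longrightarrow> g \<in> H0 \<Longrightarrow> 0 \<le> t \<Longrightarrow> S t (f - g) = S t f - S t g"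
  using S_add[of f "- 1 *\<^sub>R g" t] S_scaleR[of g t "-1"] subspace_scale[OF subspace_H0, of g "-1"] by simp

lemma S_0: "f \<in> H0 \<Longrightarrow> S 0 f = f"
  by (rule LIMSEQ_unique[OF S_lim]) (auto simp: E_def)

text \<open>The law holds for each exponential and passes to the limit because the outer factor is a
  contraction and does not amplify the error of the inner one.\<close>

lemma S_plus:
  assumes f: "f \<in> H0" and st: "0 \<le> s" "0 \<le> t"
  shows "S (s + t) f = S s (S t f)"
proof (rule LIMSEQ_unique[OF S_lim[OF f]])
  let ?E = "\<lambda>n. E (step n)"
  have "(\<lambda>n. norm (ap (?E n t) f - S t f) + norm (ap (?E n s) (S t f) - S s (S t f))) \<longlonglongrightarrow> 0 + 0"
    using S_lim[OF f st(2)] S_lim[OF S_H0[OF f st(2)] st(1)]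
    by (intro tendsto_add) (simp_all add: tendsto_norm_zero_iff LIM_zero_iff)
  then have lim: "(\<lambda>n. norm (ap (?E n t) f - S t f) + norm (ap (?E n s) (S t f) - S s (S t f))) \<longlonglongrightarrow> 0" by simp
  have "(\<lambda>n. ap (?E n (s + t)) f - S s (S t f)) \<longlonglongrightarrow> 0"
  proof (rule Lim_null_comparison[OF _ lim], intro always_eventually allI)
    fix n
    have "ap (?E n (s + t)) f - S s (S t f) =
        ap (?E n s) (ap (?E n t) f - S t f) + (ap (?E n s) (S t f) - S s (S t f))"
      by (simp add: E_add ap_mult ap.diff_right)
    then show "norm (ap (?E n (s + t)) f - S s (S t f)) \<le>
        norm (ap (?E n t) f - S t f) + norm (ap (?E n s) (S t f) - S s (S t f))"
      using norm_ap_E[of "step n" s "ap (?E n t) f - S t f"] st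
      by (metis add_right_mono norm_triangle_le step_pos)
  qed
  then show "(\<lambda>n. ap (?E n (s + t)) f) \<longlonglongrightarrow> S s (S t f)" by (rule LIM_zero_cancel)
qed (use st in simp)

lemma S_symmetric:
  assumes "f \<in> H0" "g \<in> H0" "0 \<le> t"
  shows "S t f \<bullet> g = f \<bullet> S t g"
proof (rule LIMSEQ_unique)
  let ?E = "\<lambda>n. E (step n) t"
  show "(\<lambda>n. ap (?E n) f \<bullet> g) \<longlonglongrightarrow> S t f \<bullet> g"
    using assms by (intro tendsto_inner S_lim tendsto_const)
  have "ap (?E n) f \<bullet> g = f \<bullet> ap (?E n) g" for n
    unfolding E_def by (rule exp_symmetric) (simp add: ap.scaleR_left A_symmetric)
  then show "(\<lambda>n. ap (?E n) f \<bullet> g) \<longlonglongrightarrow> f \<bullet> S t g"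
    using assms by (simp add: tendsto_inner S_lim)
qed

lemma S_minus_id:
  assumes uv: "(u, v) \<in> D2" and t: "0 \<le> t"
  shows "norm (S t u - u) \<le> t * norm v"
proof -
  have G: "(u, v) \<in> G" using uv by (simp add: D2_def)
  show ?thesis
  proof (rule LIMSEQ_le_const2)
    show "(\<lambda>n. norm (ap (E (step n) t) u - u)) \<longlonglongrightarrow> norm (S t u - u)"
      by (intro tendsto_norm tendsto_diff S_lim domain_H0[OF G] t tendsto_const)
    show "\<exists>N. \<forall>n\<ge>N. norm (ap (E (step n) t) u - u) \<le> t * norm v"
      using E_minus_id[of "step n" t u for n] norm_A[OF G] t
      by (meson mult_left_mono step_pos order_trans)
  qed
qed

lemma S_continuous:
  assumes f: "f \<in> H0"
  shows "((\<lambda>t. S t f) \<longlongrightarrow> f) (at_right 0)"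
proof (rule tendstoI)
  fix e :: real assume e: "0 < e"
  obtain u v where uv: "(u, v) \<in> D2" "norm (u - f) < e / 4" using D2_dense[OF f, of "e/4"] e by auto
  then have u: "u \<in> H0" using domain_H0 by (auto simp: D2_def)
  \<comment> \<open>The summand 1 covers the case \<open>v = 0\<close>.\<close>
  have "\<forall>\<^sub>F t in at_right 0. t > 0 \<and> t < e / (4 * (norm v + 1))"
    by (intro eventually_conj eventually_at_right_less order_tendstoD[OF tendsto_ident_at])
      (use e in \<open>auto intro!: divide_pos_pos add_nonneg_pos\<close>)
  then show "\<forall>\<^sub>F t in at_right 0. dist (S t f) f < e"
  proof eventually_elim
    fix t assume t: "t > 0 \<and> t < e / (4 * (norm v + 1))"
    have eq: "S t f - f = S t (f - u) + (S t u - u) + (u - f)"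
      using S_diff[OF f u, of t] t by simp
    have "norm (S t f - f) \<le> norm (S t (f - u)) + norm (S t u - u) + norm (u - f)"
      unfolding eq by (intro norm_triangle_le add_mono norm_triangle_ineq order_refl)
    moreover have "norm (S t (f - u)) \<le> norm (u - f)"
      using norm_S[of "f - u" t] t f u subspace_H0 by (simp add: norm_minus_commute subspace_diff)
    moreover have "norm (S t u - u) \<le> t * norm v" using S_minus_id[OF uv(1)] t by simp
    moreover have "t * norm v \<le> e / 4"
    proof -
      have "t * norm v \<le> t * (norm v + 1)" using t by (intro mult_left_mono) auto
      also have "\<dots> \<le> (e / (4 * (norm v + 1))) * (norm v + 1)" using t by (intro mult_right_mono) auto
      also have "\<dots> = e / 4" by (simp add: field_simps add_nonneg_eq_0_iff)
      finally show ?thesis .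
    qed
    ultimately show "dist (S t f) f < e" using uv(2) e unfolding dist_norm by linarith
  qed
qed

text \<open>The derivative of an approximating orbit has to be close to \<open>- v\<close> uniformly
  in \<open>n\<close>. As \<open>v\<close> itself need not belong to the domain, a nearby
  \<open>w\<close> from \<open>D2\<close> replaces it: there \<open>E_minus_id\<close> and
  \<open>norm_A\<close> give the bound \<open>t * norm z\<close>, free of \<open>n\<close>. Only
  afterwards does \<open>n\<close> tend to infinity, and then \<open>t\<close> to 0.\<close>

lemma generator_D2:
  assumes uv: "(u, v) \<in> D2"
  shows "((\<lambda>t. (1 / t) *\<^sub>R (S t u - u)) \<longlongrightarrow> - v) (at_right 0)"
proof (rule tendstoI)
  fix e :: real assume e: "0 < e"
  have G: "(u, v) \<in> G" and v: "v \<in> H0" using uv by (auto simp: D2_def)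
  note u = domain_H0[OF G]
  obtain w z where wz: "(w, z) \<in> D2" "norm (w - v) < e / 4" using D2_dense[OF v, of "e/4"] e by auto
  then have Gw: "(w, z) \<in> G" by (simp add: D2_def)
  have "\<forall>\<^sub>F t in at_right 0. t > 0 \<and> t < e / (4 * (norm z + 1))"
    by (intro eventually_conj eventually_at_right_less order_tendstoD[OF tendsto_ident_at])
      (use e in \<open>auto intro!: divide_pos_pos add_nonneg_pos\<close>)
  then show "\<forall>\<^sub>F t in at_right 0. dist ((1 / t) *\<^sub>R (S t u - u)) (- v) < e"
  proof eventually_elim
    fix t assume t: "t > 0 \<and> t < e / (4 * (norm z + 1))"
    let ?r = "\<lambda>n. norm (ap (B (step n)) v - v)"
    have "norm (ap (E (step n) t) u - u - t *\<^sub>R (- v)) \<le> (?r n + 2 * norm (w - v) + t * norm z) * t" for n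
    proof -
      let ?c = "step n"
      have "norm (ap (1 * exp (s *\<^sub>R A ?c)) (ap (A ?c) u) - (- v)) \<le> ?r n + 2 * norm (w - v) + t * norm z"
        if s: "0 \<le> s" "s \<le> t" for s
      proof -
        have c: "0 < ?c" by simp
        have eq: "ap (E ?c s) (ap (A ?c) u) - (- v) =
            - (ap (E ?c s) (ap (B ?c) v - v) + ap (E ?c s) (v - w) + (ap (E ?c s) w - w) + (w - v))"
          by (simp add: ap_A[OF G c] ap.minus_right ap.diff_right)
        have "norm (ap (E ?c s) (ap (A ?c) u) - (- v)) \<le>
            norm (ap (E ?c s) (ap (B ?c) v - v)) + norm (ap (E ?c s) (v - w)) + norm (ap (E ?c s) w - w) + norm (w - v)"
          unfolding eq norm_minus_cancel by (intro norm_triangle_le add_mono norm_triangle_ineq order_refl)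
        moreover have "norm (ap (E ?c s) (ap (B ?c) v - v)) \<le> ?r n" by (rule norm_ap_E[OF c s(1)])
        moreover have "norm (ap (E ?c s) (v - w)) \<le> norm (w - v)"
          using norm_ap_E[OF c s(1), of "v - w"] by (simp add: norm_minus_commute)
        moreover have "norm (ap (E ?c s) w - w) \<le> t * norm z"
          using E_minus_id[OF c s(1), of w] norm_A[OF Gw c] s
          by (meson mult_mono norm_ge_zero order_trans)
        ultimately show ?thesis by (simp add: E_def)
      qed
      from exp_derivative_bound[OF this] t show ?thesis by (simp add: E_def)
    qed
    moreover have "(\<lambda>n. (?r n + 2 * norm (w - v) + t * norm z) * t) \<longlonglongrightarrow> (norm (v - v) + 2 * norm (w - v) + t * norm z) * t"
      by (intro tendsto_intros B_tendsto_seq[OF v])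
    moreover have "(\<lambda>n. norm (ap (E (step n) t) u - u - t *\<^sub>R (- v))) \<longlonglongrightarrow> norm (S t u - u - t *\<^sub>R (- v))"
      using t by (intro tendsto_norm tendsto_diff S_lim u tendsto_const) auto
    ultimately have "norm (S t u - u - t *\<^sub>R (- v)) \<le> (norm (v - v) + 2 * norm (w - v) + t * norm z) * t"
      by (meson LIMSEQ_le)
    then have le: "norm (S t u - u - t *\<^sub>R (- v)) \<le> (2 * norm (w - v) + t * norm z) * t" by simp
    have "(1 / t) *\<^sub>R (S t u - u) - (- v) = (1 / t) *\<^sub>R (S t u - u - t *\<^sub>R (- v))"
      using t by (simp add: algebra_simps)
    then have "norm ((1 / t) *\<^sub>R (S t u - u) - (- v)) = norm (S t u - u - t *\<^sub>R (- v)) / t"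
      using t by simp
    also have "\<dots> \<le> 2 * norm (w - v) + t * norm z" using le t by (simp add: field_simps)
    also have "t * norm z \<le> e / 4"
    proof -
      have "t * norm z \<le> t * (norm z + 1)" using t by (intro mult_left_mono) auto
      also have "\<dots> \<le> (e / (4 * (norm z + 1))) * (norm z + 1)" using t by (intro mult_right_mono) auto
      also have "\<dots> = e / 4" by (simp add: field_simps add_nonneg_eq_0_iff)
      finally show ?thesis .
    qed
    finally show "dist ((1 / t) *\<^sub>R (S t u - u)) (- v) < e" using wz(2) e unfolding dist_norm by linarith
  qed
qed

text \<open>The converse is maximality of a resolvent equation. The solution \<open>u\<close> for
  the right-hand side \<open>f - g\<close> lies in the domain, and the orbit of \<open>f - u\<close>
  has derivative \<open>f - u\<close> at time 0. A contraction semigroup is dissipative, so the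
  square norm of \<open>f - u\<close> is at most 0.\<close>

theorem generator_iff:
  "(f, - g) \<in> D2 \<longleftrightarrow> f \<in> H0 \<and> g \<in> H0 \<and> ((\<lambda>t. (1 / t) *\<^sub>R (S t f - f)) \<longlongrightarrow> g) (at_right 0)"
proof
  assume "(f, - g) \<in> D2"
  then show "f \<in> H0 \<and> g \<in> H0 \<and> ((\<lambda>t. (1 / t) *\<^sub>R (S t f - f)) \<longlongrightarrow> g) (at_right 0)"
    using generator_D2[of f "- g"] domain_H0[of f "- g"] subspace_neg[OF subspace_H0, of "- g"]
    by (auto simp: D2_def)
next
  assume *: "f \<in> H0 \<and> g \<in> H0 \<and> ((\<lambda>t. (1 / t) *\<^sub>R (S t f - f)) \<longlongrightarrow> g) (at_right 0)"
  define u where "u = res 1 (f - g)"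
  have uG: "(u, f - g - u) \<in> G" using res_in[of 1 "f - g"] by (simp add: u_def)
  note u = domain_H0[OF uG]
  have uD: "(u, f - g - u) \<in> D2" using uG u * subspace_H0 by (simp add: D2_def subspace_diff)
  have w: "f - u \<in> H0" using * u subspace_H0 by (simp add: subspace_diff)
  have "((\<lambda>t. (1 / t) *\<^sub>R (S t f - f) - (1 / t) *\<^sub>R (S t u - u)) \<longlongrightarrow> g - (- (f - g - u))) (at_right 0)"
    using * by (intro tendsto_diff generator_D2[OF uD]) simp
  then have "((\<lambda>t. ((1 / t) *\<^sub>R (S t f - f) - (1 / t) *\<^sub>R (S t u - u)) \<bullet> (f - u)) \<longlongrightarrow> (f - u) \<bullet> (f - u)) (at_right 0)"
    by (intro tendsto_inner tendsto_const) (simp add: algebra_simps)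
  moreover have "\<forall>\<^sub>F t in at_right 0. ((1 / t) *\<^sub>R (S t f - f) - (1 / t) *\<^sub>R (S t u - u)) \<bullet> (f - u) \<le> 0"
    using eventually_at_right_less[of 0]
  proof eventually_elim
    fix t :: real assume t: "0 < t"
    have "S t f - f - (S t u - u) = S t (f - u) - (f - u)" using S_diff[of f u t] * u t by simp
    then have "(1 / t) *\<^sub>R (S t f - f) - (1 / t) *\<^sub>R (S t u - u) = (1 / t) *\<^sub>R (S t (f - u) - (f - u))"
      by (simp only: flip: scaleR_diff_right)
    moreover have "S t (f - u) \<bullet> (f - u) \<le> norm (f - u) * norm (f - u)"
      using norm_cauchy_schwarz[of "S t (f - u)" "f - u"] norm_S[OF w, of t] t
      by (meson mult_right_mono norm_ge_zero order.trans less_imp_le)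
    moreover have "(f - u) \<bullet> (f - u) = norm (f - u) * norm (f - u)"
      by (simp add: power2_norm_eq_inner flip: power2_eq_square)
    ultimately show "((1 / t) *\<^sub>R (S t f - f) - (1 / t) *\<^sub>R (S t u - u)) \<bullet> (f - u) \<le> 0"
      using t by (simp add: inner_diff_left divide_le_0_iff)
  qed
  ultimately have "(f - u) \<bullet> (f - u) \<le> 0" by (rule tendsto_upperbound) simp
  then have "(f - u) \<bullet> (f - u) = 0" using inner_ge_zero[of "f - u"] by linarith
  then have "f = u" by simp
  then show "(f, - g) \<in> D2" using uD by simp
qed

end

section \<open>The operator associated with a symmetric form\<close>

text \<open>
  The map \<open>j\<close> need not be injective and no closability is assumed: the elements of the completion of
  \<open>D\<close> are represented by Cauchy sequences.
\<close>

locale symmetric_form =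
  fixes D :: "('x \<Rightarrow> real) set" and a :: "('x \<Rightarrow> real) \<Rightarrow> ('x \<Rightarrow> real) \<Rightarrow> real"
    and j :: "('x \<Rightarrow> real) \<Rightarrow> 'h::{real_inner, banach, perfect_space}"
  assumes D_zero: "(\<lambda>x. 0) \<in> D"
    and D_lin: "\<And>f g c. f \<in> D \<Longrightarrow> g \<in> D \<Longrightarrow> (\<lambda>x. f x - c * g x) \<in> D"
    and a_sym: "\<And>f g. f \<in> D \<Longrightarrow> g \<in> D \<Longrightarrow> a f g = a g f"
    and a_lin: "\<And>f g h c. f \<in> D \<Longrightarrow> g \<in> D \<Longrightarrow> h \<in> D \<Longrightarrow> a (\<lambda>x. f x - c * g x) h = a f h - c * a g h"
    and a_pos: "\<And>f. f \<in> D \<Longrightarrow> 0 \<le> a f f"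
    and j_lin: "\<And>f g c. f \<in> D \<Longrightarrow> g \<in> D \<Longrightarrow> j (\<lambda>x. f x - c * g x) = j f - c *\<^sub>R j g"
begin

lemma a_lin_right:
  "f \<in> D \<Longrightarrow> g \<in> D \<Longrightarrow> h \<in> D \<Longrightarrow> a h (\<lambda>x. f x - c * g x) = a h f - c * a h g"
  using a_lin[of f g h c] a_sym D_lin by simp

lemma D_diff: "f \<in> D \<Longrightarrow> g \<in> D \<Longrightarrow> (\<lambda>x. f x - g x) \<in> D"
  using D_lin[of f g 1] by simp

lemma a_quadratic:
  assumes "f \<in> D" "g \<in> D"
  shows "a (\<lambda>x. f x - c * g x) (\<lambda>x. f x - c * g x) = a f f - 2 * c * a f g + c\<^sup>2 * a g g"
  using a_sym[OF assms]
  by (simp add: a_lin a_lin_right D_lin assms power2_eq_square algebra_simps)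

text \<open>The value of the form at \<open>f + c * g\<close> is nonnegative and completes the
  left-hand side to the right-hand side.\<close>

lemma a_parallelogram:
  assumes "f \<in> D" "g \<in> D"
  shows "a (\<lambda>x. f x - c * g x) (\<lambda>x. f x - c * g x) \<le> 2 * a f f + 2 * c\<^sup>2 * a g g"
  using a_quadratic[OF assms, of c] a_quadratic[OF assms, of "- c"] a_pos[OF D_lin[OF assms, of "- c"]]
  by (simp add: algebra_simps)

text \<open>The abstract counterpart of \<open>approximates\<close>, with convergence read through
  \<open>j\<close>; \<open>approximates_iff\<close> connects the two.\<close>

definition appr :: "(nat \<Rightarrow> 'x \<Rightarrow> real) \<Rightarrow> 'h \<Rightarrow> bool" where
  "appr us h \<longleftrightarrow> (\<forall>n. us n \<in> D) \<and> (\<lambda>n. j (us n)) \<longlonglongrightarrow> h \<and>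
     (\<forall>e>0. \<exists>N. \<forall>m\<ge>N. \<forall>n\<ge>N. a (\<lambda>x. us m x - us n x) (\<lambda>x. us m x - us n x) < e)"

lemma appr_D: "appr us h \<Longrightarrow> us n \<in> D" by (simp add: appr_def)

lemma appr_lim: "appr us h \<Longrightarrow> (\<lambda>n. j (us n)) \<longlonglongrightarrow> h" by (simp add: appr_def)

lemma appr_lin:
  assumes us: "appr us h" and vs: "appr vs k"
  shows "appr (\<lambda>n x. us n x - c * vs n x) (h - c *\<^sub>R k)"
  unfolding appr_def
proof (intro conjI allI impI)
  note D = appr_D[OF us] appr_D[OF vs]
  show "(\<lambda>x. us n x - c * vs n x) \<in> D" for n by (intro D_lin D)
  show "(\<lambda>n. j (\<lambda>x. us n x - c * vs n x)) \<longlonglongrightarrow> h - c *\<^sub>R k"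
    unfolding j_lin[OF D] by (intro tendsto_intros appr_lim us vs)
  fix e :: real assume e: "0 < e"
  \<comment> \<open>Each quarter is doubled by \<open>a_parallelogram\<close>; the summand 1 covers
    \<open>c = 0\<close>.\<close>
  have "0 < e / 4" "0 < e / (4 * (c\<^sup>2 + 1))" using e by (auto intro!: divide_pos_pos add_nonneg_pos)
  then obtain N N' where N: "\<And>m n. m \<ge> N \<Longrightarrow> n \<ge> N \<Longrightarrow> a (\<lambda>x. us m x - us n x) (\<lambda>x. us m x - us n x) < e / 4"
    and N': "\<And>m n. m \<ge> N' \<Longrightarrow> n \<ge> N' \<Longrightarrow> a (\<lambda>x. vs m x - vs n x) (\<lambda>x. vs m x - vs n x) < e / (4 * (c\<^sup>2 + 1))"
    using us vs unfolding appr_def by meson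
  show "\<exists>N. \<forall>m\<ge>N. \<forall>n\<ge>N. a (\<lambda>x. (us m x - c * vs m x) - (us n x - c * vs n x))
      (\<lambda>x. (us m x - c * vs m x) - (us n x - c * vs n x)) < e"
  proof (intro exI[of _ "max N N'"] allI impI)
    fix m n assume mn: "max N N' \<le> m" "max N N' \<le> n"
    let ?u = "\<lambda>x. us m x - us n x" and ?v = "\<lambda>x. vs m x - vs n x"
    have eq: "(\<lambda>x. (us m x - c * vs m x) - (us n x - c * vs n x)) = (\<lambda>x. ?u x - c * ?v x)"
      by (simp add: algebra_simps)
    have "c\<^sup>2 * a ?v ?v \<le> (c\<^sup>2 + 1) * a ?v ?v" using a_pos[OF D_diff[OF D(2,2)]] by (intro mult_right_mono) auto
    also have "\<dots> < (c\<^sup>2 + 1) * (e / (4 * (c\<^sup>2 + 1)))"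
      using mn by (intro mult_strict_left_mono N' add_nonneg_pos) auto
    also have "\<dots> = e / 4" by (simp add: field_simps add_nonneg_eq_0_iff)
    finally have "c\<^sup>2 * a ?v ?v < e / 4" .
    moreover have "a ?u ?u < e / 4" using mn by (intro N) auto
    ultimately show "a (\<lambda>x. (us m x - c * vs m x) - (us n x - c * vs n x))
      (\<lambda>x. (us m x - c * vs m x) - (us n x - c * vs n x)) < e"
      unfolding eq using a_parallelogram[OF D_diff[OF D(1,1)] D_diff[OF D(2,2)], of m n c m n] by simp
  qed
qed

lemma appr_bounded:
  assumes us: "appr us h"
  shows "\<exists>K. \<forall>n. a (us n) (us n) \<le> K"
proof -
  obtain N where N: "\<And>m n. m \<ge> N \<Longrightarrow> n \<ge> N \<Longrightarrow> a (\<lambda>x. us m x - us n x) (\<lambda>x. us m x - us n x) < 1"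
    using us unfolding appr_def by (meson zero_less_one)
  have "a (us n) (us n) \<le> max (Max ((\<lambda>n. a (us n) (us n)) ` {..N})) (2 + 2 * a (us N) (us N))" for n
  proof (cases "n \<le> N")
    case True
    then show ?thesis by (intro max.coboundedI1 Max_ge) auto
  next
    case False
    have eq: "us n = (\<lambda>x. (us n x - us N x) - (-1) * us N x)" by auto
    have "a (us n) (us n) \<le> 2 * a (\<lambda>x. us n x - us N x) (\<lambda>x. us n x - us N x) + 2 * a (us N) (us N)"
      using a_parallelogram[OF D_diff[OF appr_D[OF us] appr_D[OF us]] appr_D[OF us], of n N "-1" N] eq by simp
    then show ?thesis using N[of n N] False by (intro max.coboundedI2) simp
  qed
  then show ?thesis by blast
qed

definition G :: "('h \<times> 'h) set" where
  "G = {(u, v). \<exists>us. appr us u \<and> (\<forall>\<phi>s \<phi>. appr \<phi>s \<phi> \<longrightarrow> (\<lambda>n. a (us n) (\<phi>s n)) \<longlonglongrightarrow> v \<bullet> \<phi>)}"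

text \<open>The quadratic part of \<open>J\<close>, and the square of the form norm in which
  minimising sequences turn out to be Cauchy.\<close>

definition q :: "real \<Rightarrow> ('x \<Rightarrow> real) \<Rightarrow> real" where
  "q c u = a u u + c * (norm (j u))\<^sup>2"

text \<open>For \<open>c > 0\<close> the minimiser of \<open>J c g\<close> in the completion of \<open>D\<close> is \<open>c\<close> times the resolvent of \<open>g\<close> at \<open>c\<close>.\<close>

definition J :: "real \<Rightarrow> 'h \<Rightarrow> ('x \<Rightarrow> real) \<Rightarrow> real" where
  "J c g u = a u u + c * (norm (j u - g))\<^sup>2"

definition J_inf :: "real \<Rightarrow> 'h \<Rightarrow> real" where "J_inf c g = (INF u\<in>D. J c g u)"

text \<open>Half the derivative of \<open>J c g\<close> at \<open>u\<close> in the direction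
  \<open>\<phi>\<close>.\<close>

definition dJ :: "real \<Rightarrow> 'h \<Rightarrow> ('x \<Rightarrow> real) \<Rightarrow> ('x \<Rightarrow> real) \<Rightarrow> real" where
  "dJ c g u \<phi> = a u \<phi> + c * ((j u - g) \<bullet> j \<phi>)"

lemma J_nonneg: "0 < c \<Longrightarrow> u \<in> D \<Longrightarrow> 0 \<le> J c g u"
  by (simp add: J_def a_pos)

lemma q_nonneg: "0 < c \<Longrightarrow> u \<in> D \<Longrightarrow> 0 \<le> q c u"
  by (simp add: q_def a_pos)

lemma J_inf_le: "0 < c \<Longrightarrow> u \<in> D \<Longrightarrow> J_inf c g \<le> J c g u"
  unfolding J_inf_def by (rule cINF_lower[OF bdd_belowI2]) (auto intro: J_nonneg)

lemma J_expand:
  assumes "u \<in> D" "\<phi> \<in> D"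
  shows "J c g (\<lambda>x. u x - t * \<phi> x) = J c g u - 2 * t * dJ c g u \<phi> + t\<^sup>2 * q c \<phi>"
proof -
  have "j u - t *\<^sub>R j \<phi> - g = (j u - g) - t *\<^sub>R j \<phi>" by simp
  then have "(norm (j u - t *\<^sub>R j \<phi> - g))\<^sup>2 = (norm (j u - g))\<^sup>2 - 2 * t * ((j u - g) \<bullet> j \<phi>) + t\<^sup>2 * (norm (j \<phi>))\<^sup>2"
    unfolding power2_norm_eq_inner
    by (simp add: inner_diff_left inner_diff_right inner_commute power2_eq_square algebra_simps)
  then show ?thesis
    unfolding J_def dJ_def q_def a_quadratic[OF assms] j_lin[OF assms] by (simp only:) (simp add: algebra_simps)
qed

text \<open>The parabola \<open>t \<mapsto> J c g (u - t \<phi>)\<close> stays above the infimum.\<close>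

lemma dJ_bound:
  assumes c: "0 < c" and u: "u \<in> D" and \<phi>: "\<phi> \<in> D"
  shows "\<bar>dJ c g u \<phi>\<bar> \<le> sqrt (J c g u - J_inf c g) * sqrt (q c \<phi>)"
proof -
  let ?d = "dJ c g u \<phi>" and ?k = "J c g u - J_inf c g"
  have k: "0 \<le> ?k" using J_inf_le[OF c u] by simp
  have par: "0 \<le> ?k - 2 * t * ?d + t\<^sup>2 * q c \<phi>" for t
    using J_inf_le[OF c D_lin[OF u \<phi>, of t], of g] by (simp add: J_expand[OF u \<phi>])
  have "?d\<^sup>2 \<le> ?k * q c \<phi>"
  proof (cases "q c \<phi> = 0")
    case True
    show ?thesis
    proof (rule ccontr)
      assume "\<not> ?thesis"
      then have "?d \<noteq> 0" using True by auto
      \<comment> \<open>The parabola has degenerated to a line, which takes the value -1 at this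
        parameter.\<close>
      then show False using par[of "(?k + 1) / (2 * ?d)"] True by simp
    qed
  next
    case False
    then have q: "0 < q c \<phi>" using q_nonneg[OF c \<phi>] by simp
    from par[of "?d / q c \<phi>"] have "0 \<le> ?k - ?d\<^sup>2 / q c \<phi>"
      using q by (simp add: power2_eq_square field_simps)
    then show ?thesis using q by (simp add: field_simps)
  qed
  then have "\<bar>?d\<bar> \<le> sqrt (?k * q c \<phi>)" by (metis real_sqrt_abs real_sqrt_le_iff)
  then show ?thesis by (simp add: real_sqrt_mult)
qed

text \<open>The terms with \<open>g\<close> cancel in the difference of the two derivatives, so that
  \<open>q c\<close> of the difference \<open>z\<close> equals \<open>dJ\<close> at \<open>u\<close>
  minus \<open>dJ\<close> at \<open>w\<close>, both in the direction \<open>z\<close>. Then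
  \<open>dJ_bound\<close> applies twice, and one factor \<open>sqrt (q c z)\<close> is
  cancelled.\<close>

lemma q_diff_bound:
  assumes c: "0 < c" and u: "u \<in> D" and w: "w \<in> D"
  shows "sqrt (q c (\<lambda>x. u x - w x)) \<le> sqrt (J c g u - J_inf c g) + sqrt (J c g w - J_inf c g)"
proof -
  let ?z = "\<lambda>x. u x - w x"
  have z: "?z \<in> D" by (rule D_diff[OF u w])
  have "a ?z ?z = a u ?z - a w ?z" using a_lin[OF u w z, of 1] by simp
  moreover have jz: "j ?z = j u - j w" using j_lin[OF u w, of 1] by simp
  ultimately have "q c ?z = dJ c g u ?z - dJ c g w ?z"
    unfolding q_def dJ_def power2_norm_eq_inner by (simp add: jz inner_diff_left inner_diff_right algebra_simps)
  also have "\<dots> \<le> (sqrt (J c g u - J_inf c g) + sqrt (J c g w - J_inf c g)) * sqrt (q c ?z)"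
    using dJ_bound[OF c u z, of g] dJ_bound[OF c w z, of g] by (simp add: distrib_right)
  finally have le: "sqrt (q c ?z) * sqrt (q c ?z) \<le> (sqrt (J c g u - J_inf c g) + sqrt (J c g w - J_inf c g)) * sqrt (q c ?z)"
    using q_nonneg[OF c z] by simp
  show ?thesis
  proof (cases "sqrt (q c ?z) = 0")
    case True
    then show ?thesis using J_inf_le[OF c u] J_inf_le[OF c w] by simp
  next
    case False
    then show ?thesis using le q_nonneg[OF c z] by (intro mult_right_le_imp_le[OF le]) simp
  qed
qed

definition minimising :: "real \<Rightarrow> 'h \<Rightarrow> (nat \<Rightarrow> 'x \<Rightarrow> real) \<Rightarrow> bool" where
  "minimising c g us \<longleftrightarrow> (\<forall>n. us n \<in> D) \<and> (\<lambda>n. J c g (us n)) \<longlonglongrightarrow> J_inf c g"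

lemma ex_minimising: "0 < c \<Longrightarrow> \<exists>us. minimising c g us"
proof -
  assume c: "0 < c"
  have "\<exists>u\<in>D. J c g u < J_inf c g + 1 / real (Suc n)" for n
  proof -
    have "(INF u\<in>D. J c g u) < J_inf c g + 1 / real (Suc n)" by (simp add: J_inf_def)
    then show ?thesis
      using D_zero by (subst (asm) cINF_less_iff) (auto intro!: bdd_belowI2[of _ 0] J_nonneg[OF c])
  qed
  then obtain us where us: "\<And>n. us n \<in> D" "\<And>n. J c g (us n) < J_inf c g + 1 / real (Suc n)" by metis
  have "(\<lambda>n. J c g (us n)) \<longlonglongrightarrow> J_inf c g"
  proof (rule tendsto_sandwich[of "\<lambda>_. J_inf c g"])
    show "(\<lambda>n. J_inf c g + 1 / real (Suc n)) \<longlonglongrightarrow> J_inf c g"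
      using tendsto_add[OF tendsto_const LIMSEQ_Suc[OF lim_inverse_n'], of "J_inf c g"] by simp
    show "\<forall>\<^sub>F n in sequentially. J c g (us n) \<le> J_inf c g + 1 / real (Suc n)"
      using us(2) by (intro always_eventually allI less_imp_le)
  qed (use J_inf_le[OF c us(1)] in simp_all)
  then show ?thesis using us(1) by (auto simp: minimising_def)
qed

text \<open>By \<open>q_diff_bound\<close> the sequence is Cauchy both for the form and under
  \<open>j\<close>. By \<open>dJ_bound\<close> its derivatives tend to 0 along every sequence of
  directions bounded in \<open>q c\<close>, in particular along approximating sequences; the limit
  is the Euler equation of the minimisation problem.\<close>

lemma minimising_G:
  assumes c: "0 < c" and us: "minimising c g us"
  shows "\<exists>h. (\<lambda>n. j (us n)) \<longlonglongrightarrow> h \<and> (h, c *\<^sub>R (g - h)) \<in> G"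
proof -
  have D: "us n \<in> D" for n using us by (simp add: minimising_def)
  let ?d = "\<lambda>n. sqrt (J c g (us n) - J_inf c g)"
  have d0: "?d \<longlonglongrightarrow> 0"
    using us tendsto_real_sqrt[of "\<lambda>n. J c g (us n) - J_inf c g" 0 sequentially]
    by (simp add: minimising_def LIM_zero)
  have qC: "\<exists>N. \<forall>m\<ge>N. \<forall>n\<ge>N. q c (\<lambda>x. us m x - us n x) < e" if e: "0 < e" for e
  proof -
    have "0 < sqrt e / 2" using e by simp
    from order_tendstoD(2)[OF d0 this] obtain N where N: "\<And>n. n \<ge> N \<Longrightarrow> ?d n < sqrt e / 2"
      by (auto simp: eventually_sequentially)
    have "q c (\<lambda>x. us m x - us n x) < e" if "m \<ge> N" "n \<ge> N" for m n
    proof -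
      have "sqrt (q c (\<lambda>x. us m x - us n x)) < sqrt e"
        using q_diff_bound[OF c D D, of m n g] N[OF that(1)] N[OF that(2)] by linarith
      then show ?thesis by simp
    qed
    then show ?thesis by blast
  qed
  have ja: "a (\<lambda>x. us m x - us n x) (\<lambda>x. us m x - us n x) \<le> q c (\<lambda>x. us m x - us n x)"
    "c * (norm (j (us m) - j (us n)))\<^sup>2 \<le> q c (\<lambda>x. us m x - us n x)" for m n
    using c a_pos[OF D_diff[OF D D], of m n] j_lin[OF D D, of m 1 n] by (simp_all add: q_def)
  have "Cauchy (\<lambda>n. j (us n))"
  proof (rule metric_CauchyI)
    fix e :: real assume e: "0 < e"
    then have "0 < c * e\<^sup>2" using c by simp
    then obtain N where N: "\<And>m n. m \<ge> N \<Longrightarrow> n \<ge> N \<Longrightarrow> q c (\<lambda>x. us m x - us n x) < c * e\<^sup>2"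
      using qC by meson
    have "dist (j (us m)) (j (us n)) < e" if "m \<ge> N" "n \<ge> N" for m n
    proof -
      have "(norm (j (us m) - j (us n)))\<^sup>2 < e\<^sup>2" using ja(2)[of m n] N[OF that] c
        by (meson le_less_trans mult_less_cancel_left_pos)
      then show ?thesis using e by (simp add: dist_norm power2_less_imp_less)
    qed
    then show "\<exists>M. \<forall>m\<ge>M. \<forall>n\<ge>M. dist (j (us m)) (j (us n)) < e" by blast
  qed
  then obtain h where h: "(\<lambda>n. j (us n)) \<longlonglongrightarrow> h" by (auto simp: Cauchy_convergent_iff convergent_def)
  have "appr us h"
    unfolding appr_def using D h qC ja(1) by (meson le_less_trans)
  moreover have "(\<lambda>n. a (us n) (\<phi>s n)) \<longlonglongrightarrow> (c *\<^sub>R (g - h)) \<bullet> \<phi>" if \<phi>: "appr \<phi>s \<phi>" for \<phi>s \<phi>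
  proof -
    obtain K where K: "\<And>n. a (\<phi>s n) (\<phi>s n) \<le> K" using appr_bounded[OF \<phi>] by blast
    have "(\<lambda>n. ?d n * sqrt (K + c * (norm (j (\<phi>s n)))\<^sup>2)) \<longlonglongrightarrow> 0 * sqrt (K + c * (norm \<phi>)\<^sup>2)"
      by (intro tendsto_intros d0 appr_lim \<phi>)
    then have lim: "(\<lambda>n. ?d n * sqrt (K + c * (norm (j (\<phi>s n)))\<^sup>2)) \<longlonglongrightarrow> 0" by simp
    have "(\<lambda>n. dJ c g (us n) (\<phi>s n)) \<longlonglongrightarrow> 0"
    proof (rule Lim_null_comparison[OF _ lim], intro always_eventually allI)
      fix n
      have "\<bar>dJ c g (us n) (\<phi>s n)\<bar> \<le> ?d n * sqrt (q c (\<phi>s n))" by (rule dJ_bound[OF c D appr_D[OF \<phi>]])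
      also have "\<dots> \<le> ?d n * sqrt (K + c * (norm (j (\<phi>s n)))\<^sup>2)"
        using K[of n] J_inf_le[OF c D] by (intro mult_left_mono) (auto simp: q_def)
      finally show "norm (dJ c g (us n) (\<phi>s n)) \<le> ?d n * sqrt (K + c * (norm (j (\<phi>s n)))\<^sup>2)" by simp
    qed
    then have "(\<lambda>n. dJ c g (us n) (\<phi>s n) - c * ((j (us n) - g) \<bullet> j (\<phi>s n))) \<longlonglongrightarrow> 0 - c * ((h - g) \<bullet> \<phi>)"
      by (intro tendsto_intros h appr_lim[OF \<phi>])
    then show ?thesis by (simp add: dJ_def inner_diff_left algebra_simps)
  qed
  ultimately show ?thesis using h unfolding G_def by blast
qed

sublocale rel: monotone_relation G
proof
  fix u v u' v' :: 'h and c :: real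
  assume "(u, v) \<in> G" "(u', v') \<in> G"
  then obtain us us' where us: "appr us u" "\<And>\<phi>s \<phi>. appr \<phi>s \<phi> \<Longrightarrow> (\<lambda>n. a (us n) (\<phi>s n)) \<longlonglongrightarrow> v \<bullet> \<phi>"
    and us': "appr us' u'" "\<And>\<phi>s \<phi>. appr \<phi>s \<phi> \<Longrightarrow> (\<lambda>n. a (us' n) (\<phi>s n)) \<longlonglongrightarrow> v' \<bullet> \<phi>"
    unfolding G_def by blast
  show "v \<bullet> u' = u \<bullet> v'"
  proof (rule LIMSEQ_unique[OF us(2)[OF us'(1)]])
    show "(\<lambda>n. a (us n) (us' n)) \<longlonglongrightarrow> u \<bullet> v'"
      using us'(2)[OF us(1)] by (simp add: a_sym[OF appr_D[OF us(1)] appr_D[OF us'(1)]] inner_commute)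
  qed
  let ?w = "\<lambda>n x. us n x - (- c) * us' n x"
  have "appr ?w (u + c *\<^sub>R u')" using appr_lin[OF us(1) us'(1), of "- c"] by simp
  moreover have "(\<lambda>n. a (?w n) (\<phi>s n)) \<longlonglongrightarrow> (v + c *\<^sub>R v') \<bullet> \<phi>" if \<phi>: "appr \<phi>s \<phi>" for \<phi>s \<phi>
  proof -
    have "(\<lambda>n. a (us n) (\<phi>s n) - (- c) * a (us' n) (\<phi>s n)) \<longlonglongrightarrow> v \<bullet> \<phi> - (- c) * (v' \<bullet> \<phi>)"
      by (intro tendsto_intros us(2) us'(2) \<phi>)
    then show ?thesis
      unfolding a_lin[OF appr_D[OF us(1)] appr_D[OF us'(1)] appr_D[OF \<phi>]] by (simp add: inner_add_left)
  qed
  ultimately show "(u + c *\<^sub>R u', v + c *\<^sub>R v') \<in> G" unfolding G_def by blast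
next
  fix u v :: 'h assume "(u, v) \<in> G"
  then obtain us where us: "appr us u" "\<And>\<phi>s \<phi>. appr \<phi>s \<phi> \<Longrightarrow> (\<lambda>n. a (us n) (\<phi>s n)) \<longlonglongrightarrow> v \<bullet> \<phi>"
    unfolding G_def by blast
  have "0 \<le> v \<bullet> u"
    by (rule LIMSEQ_le_const[OF us(2)[OF us(1)]]) (use a_pos appr_D[OF us(1)] in blast)
  then show "0 \<le> u \<bullet> v" by (simp add: inner_commute)
next
  fix c :: real and f :: 'h assume c: "0 < c"
  \<comment> \<open>With the target \<open>f / c\<close> the Euler equation for the limit
    \<open>h\<close> has the value \<open>f - c *\<^sub>R h\<close>.\<close>
  obtain us where "minimising c (f /\<^sub>R c) us" using ex_minimising[OF c] by blast
  from minimising_G[OF c this] obtain h where "(h, c *\<^sub>R (f /\<^sub>R c - h)) \<in> G" by blast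
  then show "\<exists>u v. (u, v) \<in> G \<and> v + c *\<^sub>R u = f" using c
    by (intro exI[of _ h] exI[of _ "c *\<^sub>R (f /\<^sub>R c - h)"]) (simp add: scaleR_diff_right)
qed

lemma minimising_lim:
  assumes "0 < c" "minimising c g us"
  shows "(\<lambda>n. j (us n)) \<longlonglongrightarrow> c *\<^sub>R rel.res c g"
proof -
  obtain h where h: "(\<lambda>n. j (us n)) \<longlonglongrightarrow> h" "(h, c *\<^sub>R (g - h)) \<in> G"
    using minimising_G[OF assms] by blast
  have "rel.res c (c *\<^sub>R g) = h"
    by (rule rel.res_eqI) (use h assms in \<open>simp_all add: scaleR_diff_right\<close>)
  moreover have "rel.res c (c *\<^sub>R g) = c *\<^sub>R rel.res c g"
    by (rule linear_scale[OF bounded_linear.linear[OF rel.bounded_linear_res[OF assms(1)]]])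
  ultimately show ?thesis using h by simp
qed

text \<open>For a large penalty \<open>c\<close> the minimiser belonging to the target
  \<open>j \<phi>\<close> must be close to it, since \<open>\<phi>\<close> itself is a competitor
  with the value \<open>a \<phi> \<phi>\<close>.\<close>

lemma j_in_H0:
  assumes \<phi>: "\<phi> \<in> D"
  shows "j \<phi> \<in> rel.H0"
  unfolding rel.H0_def closure_approachable
proof (intro allI impI)
  fix e :: real assume e: "0 < e"
  \<comment> \<open>Chosen so that \<open>c * e\<^sup>2\<close> exceeds
    \<open>a \<phi> \<phi>\<close> by 1.\<close>
  define c where "c = (a \<phi> \<phi> + 1) / e\<^sup>2"
  have c: "0 < c" using a_pos[OF \<phi>] e by (simp add: c_def add_nonneg_pos)
  obtain us where us: "minimising c (j \<phi>) us" using ex_minimising[OF c] by blast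
  from minimising_G[OF c this] obtain h where h: "(\<lambda>n. j (us n)) \<longlonglongrightarrow> h" "(h, c *\<^sub>R (j \<phi> - h)) \<in> G" by blast
  have "c * (norm (h - j \<phi>))\<^sup>2 \<le> J_inf c (j \<phi>)"
  proof (rule LIMSEQ_le)
    show "(\<lambda>n. c * (norm (j (us n) - j \<phi>))\<^sup>2) \<longlonglongrightarrow> c * (norm (h - j \<phi>))\<^sup>2"
      by (intro tendsto_intros h)
    show "(\<lambda>n. J c (j \<phi>) (us n)) \<longlonglongrightarrow> J_inf c (j \<phi>)" using us by (simp add: minimising_def)
    show "\<exists>N. \<forall>n\<ge>N. c * (norm (j (us n) - j \<phi>))\<^sup>2 \<le> J c (j \<phi>) (us n)"
      using us a_pos by (auto simp: J_def minimising_def)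
  qed
  also have "\<dots> \<le> a \<phi> \<phi>" using J_inf_le[OF c \<phi>, of "j \<phi>"] by (simp add: J_def)
  also have "\<dots> < c * e\<^sup>2" using e by (simp add: c_def)
  finally have "norm (h - j \<phi>) < e" using c e by (simp add: power2_less_imp_less)
  then show "\<exists>y\<in>fst ` G. dist y (j \<phi>) < e" using h(2) by (force simp: dist_norm)
qed

text \<open>\<open>F\<close> acts on elements of \<open>D\<close>, never on limits: the image of a
  minimising sequence is again minimising, and all such sequences have the same limit.\<close>

lemma res_in_closed:
  assumes c: "0 < c" and K: "closed K"
    and F: "\<And>u. u \<in> D \<Longrightarrow> F u \<in> D" "\<And>u. u \<in> D \<Longrightarrow> a (F u) (F u) \<le> a u u"
      "\<And>u. u \<in> D \<Longrightarrow> norm (j (F u) - g) \<le> norm (j u - g)" "\<And>u. u \<in> D \<Longrightarrow> j (F u) \<in> K"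
  shows "c *\<^sub>R rel.res c g \<in> K"
proof -
  obtain us where us: "minimising c g us" using ex_minimising[OF c] by blast
  then have D: "us n \<in> D" for n by (simp add: minimising_def)
  have "minimising c g (\<lambda>n. F (us n))"
    unfolding minimising_def
  proof (intro conjI allI)
    show "F (us n) \<in> D" for n by (intro F D)
    have "J c g (F u) \<le> J c g u" if "u \<in> D" for u
      using F(2,3)[OF that] c unfolding J_def by (intro add_mono mult_left_mono power_mono) auto
    then have "\<And>n. J c g (F (us n)) \<le> J c g (us n)" using D by blast
    moreover have "\<And>n. J_inf c g \<le> J c g (F (us n))" by (rule J_inf_le[OF c F(1)[OF D]])
    moreover have "(\<lambda>n. J c g (us n)) \<longlonglongrightarrow> J_inf c g" using us by (simp add: minimising_def)
    ultimately show "(\<lambda>n. J c g (F (us n))) \<longlonglongrightarrow> J_inf c g"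
      by - (rule tendsto_sandwich[of "\<lambda>_. J_inf c g" _ sequentially "\<lambda>n. J c g (us n)"], simp_all)
  qed
  then show ?thesis
    by (intro closed_sequentially[OF K _ minimising_lim[OF c]]) (auto intro: F(4) D)
qed

end

section \<open>Test functions\<close>

text \<open>The recursion of \<open>Ck\<close> runs over partial derivatives, so lowering the order
  takes an induction of its own; the product rule needs it for the factors left
  undifferentiated.\<close>

lemma Ck_SucD: "Ck (Suc k) f \<Longrightarrow> Ck k f"
proof (induction k arbitrary: f)
  case 0
  then have "f differentiable at x" for x by simp
  then show ?case
    by (simp add: continuous_at_imp_continuous_on differentiable_imp_continuous_within)
next
  case (Suc k)
  then have "Ck (Suc k) (\<lambda>x. frechet_derivative f (at x) i)" if "i \<in> Basis" for i
    using that by auto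
  then have "\<forall>i\<in>Basis. Ck k (\<lambda>x. frechet_derivative f (at x) i)" using Suc.IH by blast
  then show ?case using Suc.prems by simp
qed

lemma frechet_derivative_eqI: "(f has_derivative f') (at x) \<Longrightarrow> frechet_derivative f (at x) = f'"
  by (rule frechet_derivative_at[symmetric])

lemma Ck_SucI:
  assumes "\<And>x. (f has_derivative f' x) (at x)" "\<And>i. i \<in> Basis \<Longrightarrow> Ck k (\<lambda>x. f' x i)"
  shows "Ck (Suc k) f"
  using assms by (auto simp: differentiable_def frechet_derivative_eqI[OF assms(1)])

lemma Ck_has_derivative:
  "Ck (Suc k) f \<Longrightarrow> (f has_derivative frechet_derivative f (at x)) (at x)"
  by (simp add: frechet_derivative_works[symmetric])

lemma Ck_const: "Ck k (\<lambda>x. c)"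
proof (induction k arbitrary: c)
  case (Suc k)
  show ?case by (rule Ck_SucI[of _ "\<lambda>x h. 0"]) (auto simp: Suc)
qed simp

lemma Ck_add: "Ck k f \<Longrightarrow> Ck k g \<Longrightarrow> Ck k (\<lambda>x. f x + g x)"
proof (induction k arbitrary: f g)
  case 0
  then show ?case by (auto intro: continuous_on_add)
next
  case (Suc k)
  show ?case
  proof (rule Ck_SucI)
    show "((\<lambda>x. f x + g x) has_derivative (\<lambda>h. frechet_derivative f (at x) h + frechet_derivative g (at x) h)) (at x)" for x
      by (intro has_derivative_add Ck_has_derivative[OF Suc.prems(1)] Ck_has_derivative[OF Suc.prems(2)])
  qed (use Suc in auto)
qed

lemma Ck_mult: "Ck k f \<Longrightarrow> Ck k g \<Longrightarrow> Ck k (\<lambda>x. f x * g x)"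
proof (induction k arbitrary: f g)
  case 0
  then show ?case by (auto intro: continuous_on_mult)
next
  case (Suc k)
  show ?case
  proof (rule Ck_SucI)
    show "((\<lambda>x. f x * g x) has_derivative (\<lambda>h. f x * frechet_derivative g (at x) h + frechet_derivative f (at x) h * g x)) (at x)" for x
      by (intro has_derivative_mult Ck_has_derivative[OF Suc.prems(1)] Ck_has_derivative[OF Suc.prems(2)])
    show "Ck k (\<lambda>x. f x * frechet_derivative g (at x) i + frechet_derivative f (at x) i * g x)" if "i \<in> Basis" for i
      using Suc.prems that by (intro Ck_add Suc.IH Ck_SucD[of k f] Ck_SucD[of k g]) auto
  qed
qed

lemma Ck_cmult: "Ck k f \<Longrightarrow> Ck k (\<lambda>x. c * f x)"
  by (rule Ck_mult[OF Ck_const])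

lemma Ck_prod: "(\<And>i. i \<in> I \<Longrightarrow> Ck k (f i)) \<Longrightarrow> Ck k (\<lambda>x. \<Prod>i\<in>I. f i x)"
  by (induction I rule: infinite_finite_induct) (auto simp: Ck_const Ck_mult)

text \<open>The powers of \<open>1 / t\<close> make the family stable under differentiation: the
  derivative of \<open>flat n\<close> is a combination of \<open>flat (n + 2)\<close> and
  \<open>flat (n + 1)\<close>. Smoothness of the usual \<open>exp (- (1 / t))\<close> then follows
  by induction on the order, with \<open>n\<close> arbitrary.\<close>

definition flat :: "nat \<Rightarrow> real \<Rightarrow> real" where
  "flat n t = (if t > 0 then (1 / t) ^ n * exp (- (1 / t)) else 0)"

lemma flat_nonneg: "0 \<le> flat n t" by (simp add: flat_def)

lemma flat_0_le_1: "flat 0 t \<le> 1" by (simp add: flat_def)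

lemma flat_tendsto_0: "((\<lambda>t. flat n t / t) \<longlongrightarrow> 0) (at_right 0)"
proof -
  have "((\<lambda>s::real. s ^ Suc n / exp s) \<longlongrightarrow> 0) at_top" by (rule tendsto_power_div_exp_0)
  from filterlim_compose[OF this filterlim_inverse_at_top_right]
  have "((\<lambda>t::real. inverse t ^ Suc n / exp (inverse t)) \<longlongrightarrow> 0) (at_right 0)" .
  moreover have "\<forall>\<^sub>F t in at_right 0. inverse t ^ Suc n / exp (inverse t) = flat n t / t"
    using eventually_at_right_less[of "0::real"]
    by eventually_elim (simp add: flat_def exp_minus divide_inverse)
  ultimately show ?thesis by (rule Lim_transform_eventually)
qed

lemma flat_deriv: "(flat n has_real_derivative flat (n + 2) t - real n * flat (n + 1) t) (at t)"
proof (cases t "0::real" rule: linorder_cases)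
  case less
  have "((\<lambda>t. 0) has_real_derivative 0) (at t)" by simp
  then have "(flat n has_real_derivative 0) (at t)"
    by (rule has_field_derivative_transform_within_open[of _ _ _ "{..<0}"]) (use less in \<open>auto simp: flat_def\<close>)
  then show ?thesis using less by (simp add: flat_def)
next
  case greater
  have "((\<lambda>t. (1 / t) ^ n * exp (- (1 / t))) has_real_derivative
      (1 / t) ^ (n + 2) * exp (- (1 / t)) - real n * ((1 / t) ^ (n + 1) * exp (- (1 / t)))) (at t)"
  proof -
    have d: "((\<lambda>t. 1 / t) has_real_derivative - ((1 / t)\<^sup>2)) (at t)"
      using greater by (auto intro!: derivative_eq_intros simp: power2_eq_square)
    have "((\<lambda>t. exp (- (1 / t))) has_real_derivative exp (- (1 / t)) * (1 / t)\<^sup>2) (at t)"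
      using DERIV_fun_exp[OF DERIV_minus[OF d]] by simp
    from DERIV_mult[OF DERIV_power[OF d, of n] this] show ?thesis
      by (rule DERIV_cong) (cases n; simp add: power2_eq_square algebra_simps)
  qed
  then have "(flat n has_real_derivative
      (1 / t) ^ (n + 2) * exp (- (1 / t)) - real n * ((1 / t) ^ (n + 1) * exp (- (1 / t)))) (at t)"
    by (rule has_field_derivative_transform_within_open[of _ _ _ "{0<..}"]) (use greater in \<open>auto simp: flat_def\<close>)
  then show ?thesis using greater by (simp add: flat_def)
next
  case equal
  have "((\<lambda>t. flat n t / t) \<longlongrightarrow> 0) (at 0)"
  proof (rule filterlim_split_at)
    have "\<forall>\<^sub>F t in at_left 0. 0 = flat n t / t"
      using eventually_at_left_real[of "-1::real" 0] by (auto elim!: eventually_mono simp: flat_def)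
    then show "((\<lambda>t. flat n t / t) \<longlongrightarrow> 0) (at_left 0)"
      by (rule Lim_transform_eventually[OF tendsto_const])
  qed (rule flat_tendsto_0)
  then show ?thesis using equal by (simp add: has_field_derivative_iff flat_def)
qed

lemma Ck_flat: "Ck k (\<lambda>x::'a::euclidean_space. flat n (x \<bullet> v + d))"
proof (induction k arbitrary: n)
  case 0
  have "continuous_on UNIV (flat n)"
    using flat_deriv by (meson DERIV_isCont continuous_at_imp_continuous_on)
  then show ?case by (auto intro!: continuous_intros intro: continuous_on_compose2)
next
  case (Suc k)
  show ?case
  proof (rule Ck_SucI)
    let ?f' = "\<lambda>t. flat (n + 2) t - real n * flat (n + 1) t"
    show "((\<lambda>x. flat n (x \<bullet> v + d)) has_derivative (\<lambda>h. (h \<bullet> v) * ?f' (x \<bullet> v + d))) (at x)" for x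
    proof (rule has_derivative_compose[of "\<lambda>x. x \<bullet> v + d" "\<lambda>h. h \<bullet> v" x UNIV "flat n" "\<lambda>h. h * ?f' (x \<bullet> v + d)"])
      show "((\<lambda>x. x \<bullet> v + d) has_derivative (\<lambda>h. h \<bullet> v)) (at x)"
        by (auto intro!: derivative_eq_intros)
      show "(flat n has_derivative (\<lambda>h. h * ?f' (x \<bullet> v + d))) (at (x \<bullet> v + d))"
        using flat_deriv[of n "x \<bullet> v + d"] by (simp add: has_field_derivative_def mult_commute_abs)
    qed
    have "Ck k (\<lambda>x. flat (n + 2) (x \<bullet> v + d) + (- real n) * flat (n + 1) (x \<bullet> v + d))"
      by (intro Ck_add Ck_cmult Suc)
    then show "Ck k (\<lambda>x. (i \<bullet> v) * ?f' (x \<bullet> v + d))" for i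
      by (intro Ck_cmult) simp
  qed
qed

text \<open>Positive exactly on the open box when \<open>k\<close> is positive. Letting
  \<open>k\<close> grow steepens the flanks, and the limit is the indicator of the box; the
  mollifiers use \<open>k = 1\<close>.\<close>

definition bump :: "real \<Rightarrow> 'a::euclidean_space \<Rightarrow> 'a \<Rightarrow> 'a \<Rightarrow> real" where
  "bump k a b x = (\<Prod>i\<in>Basis. flat 0 (k * (x \<bullet> i - a \<bullet> i)) * flat 0 (k * (b \<bullet> i - x \<bullet> i)))"

lemma Ck_bump: "Ck m (bump k a b)"
proof -
  have "Ck m (\<lambda>x. flat 0 (k * (x \<bullet> i - a \<bullet> i)) * flat 0 (k * (b \<bullet> i - x \<bullet> i)))" for i
    using Ck_mult[OF Ck_flat[of m 0 "k *\<^sub>R i" "- (k * (a \<bullet> i))"] Ck_flat[of m 0 "- k *\<^sub>R i" "k * (b \<bullet> i)"]]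
    by (simp add: algebra_simps)
  then show ?thesis unfolding bump_def by (intro Ck_prod)
qed

lemma bump_nonneg: "0 \<le> bump k a b x"
  unfolding bump_def by (intro prod_nonneg mult_nonneg_nonneg flat_nonneg)

lemma bump_le_1: "bump k a b x \<le> 1"
  unfolding bump_def by (intro prod_le_1 conjI mult_nonneg_nonneg mult_le_one flat_nonneg flat_0_le_1)

lemma bump_eq_0_iff: "0 < k \<Longrightarrow> bump k a b x = 0 \<longleftrightarrow> x \<notin> box a b"
proof -
  assume "0 < k"
  then have "flat 0 (k * s) = 0 \<longleftrightarrow> \<not> 0 < s" for s
    by (simp add: flat_def zero_less_mult_iff)
  then show ?thesis
    unfolding bump_def prod_zero_iff[OF finite_Basis] mem_box by auto
qed

lemma bump_tendsto: "(\<lambda>n. bump (real (Suc n)) a b x) \<longlonglongrightarrow> indicator (box a b) x"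
proof (cases "x \<in> box a b")
  case True
  have "(\<lambda>n. flat 0 (real (Suc n) * t)) \<longlonglongrightarrow> 1" if "0 < t" for t
  proof -
    have "(\<lambda>n. exp (- (inverse (real (Suc n)) * (1 / t)))) \<longlonglongrightarrow> exp (- (0 * (1 / t)))"
      by (intro tendsto_intros LIMSEQ_inverse_real_of_nat)
    then show ?thesis using that by (simp add: flat_def divide_inverse mult.commute)
  qed
  then have "(\<lambda>n. bump (real (Suc n)) a b x) \<longlonglongrightarrow> (\<Prod>i\<in>(Basis::'a set). 1 * 1)"
    unfolding bump_def using True by (intro tendsto_prod tendsto_mult) (auto simp: mem_box)
  then show ?thesis using True by simp
next
  case False
  then have "bump (real (Suc n)) a b x = 0" for n using bump_eq_0_iff[of "real (Suc n)" a b x] by simp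
  then show ?thesis using False by simp
qed

lemma bump_test_function:
  assumes "0 < k" "cbox a b \<subseteq> \<Omega>"
  shows "bump k a b \<in> test_functions \<Omega>"
proof -
  have sub: "closure {x. bump k a b x \<noteq> 0} \<subseteq> cbox a b"
    using box_subset_cbox[of a b] by (intro closure_minimal closed_cbox) (auto simp: bump_eq_0_iff[OF assms(1)])
  then have "compact (closure {x. bump k a b x \<noteq> 0})"
    by (metis bounded_cbox bounded_subset closed_closure compact_eq_bounded_closed)
  then show ?thesis using sub assms(2) Ck_bump by (auto simp: test_functions_def)
qed

lemma test_function_cmult:
  assumes "\<phi> \<in> test_functions \<Omega>"
  shows "(\<lambda>x. c * \<phi> x) \<in> test_functions \<Omega>"
proof -
  have "closure {x. c * \<phi> x \<noteq> 0} \<subseteq> closure {x. \<phi> x \<noteq> 0}" by (intro closure_mono) auto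
  moreover from this have "compact (closure {x. c * \<phi> x \<noteq> 0})"
    using assms unfolding test_functions_def compact_eq_bounded_closed by (auto intro: bounded_subset)
  ultimately show ?thesis using assms by (auto simp: test_functions_def intro: Ck_cmult)
qed

lemma test_function_derivative:
  "\<phi> \<in> test_functions \<Omega> \<Longrightarrow> (\<phi> has_derivative frechet_derivative \<phi> (at x)) (at x)"
  unfolding test_functions_def using Ck_has_derivative by blast

lemma test_function_continuous: "\<phi> \<in> test_functions \<Omega> \<Longrightarrow> continuous_on S \<phi>"
  unfolding test_functions_def using continuous_on_subset by (metis (mono_tags, lifting) Ck.simps(1) mem_Collect_eq subset_UNIV)

lemma test_function_derivative_continuous:
  "\<phi> \<in> test_functions \<Omega> \<Longrightarrow> i \<in> Basis \<Longrightarrow> continuous_on S (\<lambda>x. frechet_derivative \<phi> (at x) i)"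
proof -
  assume "\<phi> \<in> test_functions \<Omega>" and i: "i \<in> Basis"
  then have "Ck (Suc 0) \<phi>" unfolding test_functions_def by blast
  then have "continuous_on UNIV (\<lambda>x. frechet_derivative \<phi> (at x) i)" using i by simp
  then show ?thesis using continuous_on_subset by blast
qed

lemma test_function_borel: "\<phi> \<in> test_functions \<Omega> \<Longrightarrow> \<phi> \<in> borel_measurable borel"
  by (intro borel_measurable_continuous_onI test_function_continuous)

lemma test_function_derivative_borel:
  "\<phi> \<in> test_functions \<Omega> \<Longrightarrow> i \<in> Basis \<Longrightarrow> (\<lambda>x. frechet_derivative \<phi> (at x) i) \<in> borel_measurable borel"
  by (intro borel_measurable_continuous_onI test_function_derivative_continuous)

lemma test_function_outside:
  assumes \<phi>: "\<phi> \<in> test_functions \<Omega>" and x: "x \<notin> closure {x. \<phi> x \<noteq> 0}"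
  shows "\<phi> x = 0" "frechet_derivative \<phi> (at x) = (\<lambda>h. 0)"
proof -
  show "\<phi> x = 0" using x closure_subset[of "{x. \<phi> x \<noteq> 0}"] by auto
  have "((\<lambda>x. 0) has_derivative (\<lambda>h. 0)) (at x)" by simp
  then have "(\<phi> has_derivative (\<lambda>h. 0)) (at x)"
    by (rule has_derivative_transform_within_open[of _ _ _ _ "- closure {x. \<phi> x \<noteq> 0}"])
      (use x closure_subset[of "{x. \<phi> x \<noteq> 0}"] in auto)
  then show "frechet_derivative \<phi> (at x) = (\<lambda>h. 0)" by (rule frechet_derivative_eqI)
qed

lemma continuous_compact_support_bounded:
  fixes f :: "'a::topological_space \<Rightarrow> real"
  assumes "compact K" "continuous_on K f" "\<And>x. x \<notin> K \<Longrightarrow> f x = 0"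
  obtains M where "0 \<le> M" "\<And>x. \<bar>f x\<bar> \<le> M"
proof -
  have "bounded (f ` K)" using assms by (intro compact_imp_bounded compact_continuous_image)
  then obtain M where M: "\<And>x. x \<in> K \<Longrightarrow> \<bar>f x\<bar> \<le> M" by (auto simp: bounded_iff)
  have "\<bar>f x\<bar> \<le> max 0 M" for x using M[of x] assms(3)[of x] by (cases "x \<in> K") auto
  then show ?thesis using that[of "max 0 M"] by simp
qed

lemma test_function_support_compact: "\<phi> \<in> test_functions \<Omega> \<Longrightarrow> compact (closure {x. \<phi> x \<noteq> 0})"
  by (simp add: test_functions_def)

lemma test_function_bounded:
  assumes \<phi>: "\<phi> \<in> test_functions \<Omega>"
  obtains M where "0 \<le> M" "\<And>x. \<bar>\<phi> x\<bar> \<le> M"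
  using continuous_compact_support_bounded[OF test_function_support_compact[OF \<phi>] test_function_continuous[OF \<phi>]]
    test_function_outside(1)[OF \<phi>] by blast

lemma test_function_derivative_bounded:
  assumes \<phi>: "\<phi> \<in> test_functions \<Omega>" and i: "i \<in> Basis"
  obtains M where "0 \<le> M" "\<And>x. \<bar>frechet_derivative \<phi> (at x) i\<bar> \<le> M"
  using continuous_compact_support_bounded[OF test_function_support_compact[OF \<phi>] test_function_derivative_continuous[OF \<phi> i]]
    test_function_outside(2)[OF \<phi>] by metis

lemma test_function_line_derivative:
  assumes \<phi>: "\<phi> \<in> test_functions \<Omega>"
  shows "((\<lambda>t. \<phi> (x + t *\<^sub>R i)) has_real_derivative frechet_derivative \<phi> (at (x + t *\<^sub>R i)) i) (at t)"
proof -
  have "((\<lambda>t. \<phi> (x + t *\<^sub>R i)) has_derivative (\<lambda>h. frechet_derivative \<phi> (at (x + t *\<^sub>R i)) (h *\<^sub>R i))) (at t)"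
    by (rule has_derivative_compose[OF _ test_function_derivative[OF \<phi>]]) (auto intro!: derivative_eq_intros)
  moreover have "frechet_derivative \<phi> (at (x + t *\<^sub>R i)) (h *\<^sub>R i) = frechet_derivative \<phi> (at (x + t *\<^sub>R i)) i * h" for h
    using linear_scale[OF has_derivative_linear[OF test_function_derivative[OF \<phi>]]] by simp
  ultimately show ?thesis by (simp add: has_field_derivative_def)
qed

text \<open>Supplies the dominating functions for difference quotients.\<close>

lemma test_function_lipschitz:
  assumes \<phi>: "\<phi> \<in> test_functions \<Omega>" and i: "i \<in> Basis"
  obtains L where "0 \<le> L" "\<And>x t. \<bar>\<phi> (x + t *\<^sub>R i) - \<phi> x\<bar> \<le> L * \<bar>t\<bar>"
proof -
  obtain M where M: "0 \<le> M" "\<And>x. \<bar>frechet_derivative \<phi> (at x) i\<bar> \<le> M"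
    using test_function_derivative_bounded[OF \<phi> i] by blast
  have "\<bar>\<phi> (x + t *\<^sub>R i) - \<phi> x\<bar> \<le> M * \<bar>t\<bar>" for x t
    using field_differentiable_bound[of UNIV "\<lambda>t. \<phi> (x + t *\<^sub>R i)" "\<lambda>t. frechet_derivative \<phi> (at (x + t *\<^sub>R i)) i" M t 0]
      test_function_line_derivative[OF \<phi>] M(2) by simp
  then show ?thesis using that M(1) by blast
qed

section \<open>The fundamental lemma of the calculus of variations\<close>

lemma integral_bump_tendsto:
  fixes w :: "'a::euclidean_space \<Rightarrow> real"
  assumes w: "integrable lborel w"
  shows "(\<lambda>n. \<integral>x. w x * bump (real (Suc n)) a b x \<partial>lborel) \<longlonglongrightarrow> (\<integral>x. w x * indicator (box a b) x \<partial>lborel)"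
proof (rule integral_dominated_convergence[where w = "\<lambda>x. \<bar>w x\<bar>"])
  have [measurable]: "w \<in> borel_measurable borel" "bump k a b \<in> borel_measurable borel" for k
    using w test_function_borel[OF bump_test_function[of 1 a b UNIV]]
    by (auto intro!: borel_measurable_continuous_onI simp del: Ck.simps simp add: Ck.simps(1)[symmetric] Ck_bump)
  show "(\<lambda>x. w x * indicator (box a b) x) \<in> borel_measurable lborel" by measurable
  show "(\<lambda>x. w x * bump (real (Suc n)) a b x) \<in> borel_measurable lborel" for n by measurable
  show "AE x in lborel. (\<lambda>n. w x * bump (real (Suc n)) a b x) \<longlonglongrightarrow> w x * indicator (box a b) x"
    by (intro AE_I2 tendsto_mult tendsto_const bump_tendsto)
  show "AE x in lborel. norm (w x * bump (real (Suc n)) a b x) \<le> \<bar>w x\<bar>" for n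
    by (intro AE_I2) (simp add: abs_mult mult_left_le bump_nonneg bump_le_1)
qed (use w in auto)

text \<open>Bumps approximate indicators of boxes, so \<open>w\<close> has integral 0 over every box
  whose closure lies in \<Omega>. Inside such a box the positive and the negative part of
  \<open>w\<close> are densities of finite measures that agree on all boxes, an intersection-stable
  generator; hence the parts agree almost everywhere. Countably many boxes cover \<Omega>.\<close>

lemma fundamental_lemma:
  fixes w :: "'a::euclidean_space \<Rightarrow> real"
  assumes "open \<Omega>" and w: "integrable lborel w"
    and 0: "\<And>\<phi>. \<phi> \<in> test_functions \<Omega> \<Longrightarrow> (\<integral>x. w x * \<phi> x \<partial>lborel) = 0"
  shows "AE x in lborel. x \<in> \<Omega> \<longrightarrow> w x = 0"
proof -
  have [measurable]: "w \<in> borel_measurable borel" using w by auto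
  have box: "(\<integral>x. w x * indicator (box a b) x \<partial>lborel) = 0" if "cbox a b \<subseteq> \<Omega>" for a b
    using integral_bump_tendsto[OF w, of a b] 0[OF bump_test_function[OF _ that]]
    by (simp add: LIMSEQ_const_iff del: of_nat_Suc)
  have loc: "AE x in lborel. x \<in> box a b \<longrightarrow> w x = 0" if ab: "cbox a b \<subseteq> \<Omega>" for a b
  proof -
    let ?p = "\<lambda>x. ennreal (w x * indicator (box a b) x)" and ?m = "\<lambda>x. ennreal (- w x * indicator (box a b) x)"
    have wfin: "(\<integral>\<^sup>+x. ennreal \<bar>w x\<bar> \<partial>lborel) < \<infinity>"
      using w by (simp add: integrable_iff_bounded)
    have fin: "emeasure (density lborel ?p) X \<noteq> \<infinity>" "emeasure (density lborel ?m) X \<noteq> \<infinity>" if "X \<in> sets borel" for X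
    proof -
      have "(\<integral>\<^sup>+x. ?p x * indicator X x \<partial>lborel) \<le> (\<integral>\<^sup>+x. ennreal \<bar>w x\<bar> \<partial>lborel)"
        "(\<integral>\<^sup>+x. ?m x * indicator X x \<partial>lborel) \<le> (\<integral>\<^sup>+x. ennreal \<bar>w x\<bar> \<partial>lborel)"
        by (intro nn_integral_mono; auto simp: indicator_def intro!: ennreal_leI)+
      then show "emeasure (density lborel ?p) X \<noteq> \<infinity>" "emeasure (density lborel ?m) X \<noteq> \<infinity>"
        using wfin that by (auto simp: emeasure_density top_unique)
    qed
    have "density lborel ?p = density lborel ?m"
    proof (rule measure_eqI_generator_eq)
      let ?E = "range (\<lambda>(a, b). box a b::'a set)"
      show "Int_stable ?E" by (auto simp: Int_stable_def box_Int_box)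
      show "?E \<subseteq> Pow UNIV" "sets (density lborel ?p) = sigma_sets UNIV ?E" "sets (density lborel ?m) = sigma_sets UNIV ?E"
        by (simp_all add: borel_eq_box)
      let ?A = "\<lambda>n::nat. box (- (real n *\<^sub>R One)) (real n *\<^sub>R One) :: 'a set"
      show "range ?A \<subseteq> ?E" "(\<Union>i. ?A i) = UNIV" unfolding UN_box_eq_UNIV by auto
      show "emeasure (density lborel ?p) (?A i) \<noteq> \<infinity>" for i by (rule fin) simp
      show "emeasure (density lborel ?p) X = emeasure (density lborel ?m) X" if "X \<in> ?E" for X
      proof -
        obtain c d where X: "X = box c d" using \<open>X \<in> ?E\<close> by auto
        \<comment> \<open>The generator consists of all boxes of the space; intersected with the
          fixed box they are boxes whose closures again lie in \<Omega>.\<close>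
        obtain e f where ef: "box a b \<inter> X = box e f" "cbox e f \<subseteq> cbox a b"
        proof
          let ?e = "\<Sum>i\<in>Basis. max (a \<bullet> i) (c \<bullet> i) *\<^sub>R i" and ?f = "\<Sum>i\<in>Basis. min (b \<bullet> i) (d \<bullet> i) *\<^sub>R i"
          show "box a b \<inter> X = box ?e ?f" unfolding X by (rule box_Int_box)
          show "cbox ?e ?f \<subseteq> cbox a b" by (auto simp: mem_box)
        qed
        let ?v = "\<lambda>x. w x * indicator (box e f) x"
        have v: "integrable lborel ?v" by (rule integrable_real_mult_indicator[OF _ w]) simp
        have "?p x * indicator X x = ennreal (?v x)" "?m x * indicator X x = ennreal (- ?v x)" for x
          unfolding ef(1)[symmetric] by (auto simp: indicator_def)
        then have *: "emeasure (density lborel ?p) X = (\<integral>\<^sup>+x. ennreal (?v x) \<partial>lborel)"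
            "emeasure (density lborel ?m) X = (\<integral>\<^sup>+x. ennreal (- ?v x) \<partial>lborel)"
          by (simp_all add: emeasure_density X)
        have "X \<in> sets borel" by (simp add: X)
        note f = fin[OF this, unfolded *]
        have "enn2real (\<integral>\<^sup>+x. ennreal (?v x) \<partial>lborel) = enn2real (\<integral>\<^sup>+x. ennreal (- ?v x) \<partial>lborel)"
          using box[of e f] ef(2) ab real_lebesgue_integral_def[OF v] by simp
        then have "ennreal (enn2real (\<integral>\<^sup>+x. ennreal (?v x) \<partial>lborel)) =
            ennreal (enn2real (\<integral>\<^sup>+x. ennreal (- ?v x) \<partial>lborel))" by (rule arg_cong)
        then show ?thesis unfolding * using f by (simp only: ennreal_enn2real less_top infinity_ennreal_def)
      qed
    qed
    then have "AE x in lborel. ?p x = ?m x"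
      by (intro sigma_finite_measure.density_unique[OF sigma_finite_lborel]) auto
    \<comment> \<open>\<open>ennreal\<close> truncates at 0, so at least one side of the equation is
      0.\<close>
    moreover have "r = 0" if "ennreal r = ennreal (- r)" for r
    proof (cases "r \<ge> 0")
      case True
      then have "ennreal r = 0" using that by (simp add: ennreal_neg)
      then show ?thesis using True by simp
    next
      case False
      then have "ennreal (- r) = 0" using that by (simp add: ennreal_neg)
      then show ?thesis using False by (simp add: ennreal_eq_0_iff)
    qed
    ultimately show ?thesis
      by (auto simp: indicator_def elim!: eventually_mono split: if_splits)
  qed
  obtain D where D: "countable D" "\<And>X. X \<in> D \<Longrightarrow> \<exists>a b. X = cbox a b" "D \<subseteq> Pow \<Omega>" "\<Union>D = \<Omega>"
    using open_countable_Union_open_cbox[OF \<open>open \<Omega>\<close>] by metis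
  have "AE x in lborel. x \<in> X \<longrightarrow> w x = 0" if XD: "X \<in> D" for X
  proof -
    obtain a b where X: "X = cbox a b" using D(2) XD by blast
    \<comment> \<open>The cover is by closed boxes, the local statement is for open ones; the faces
      in between are null.\<close>
    have "AE x in lborel. x \<notin> cbox a b - box a b"
      by (rule AE_not_in) (simp add: null_sets_def emeasure_Diff box_subset_cbox emeasure_lborel_cbox_eq emeasure_lborel_box_eq)
    moreover have "AE x in lborel. x \<in> box a b \<longrightarrow> w x = 0" using D(3) XD X by (intro loc) auto
    ultimately show ?thesis unfolding X by eventually_elim auto
  qed
  then have "AE x in lborel. \<forall>X\<in>D. x \<in> X \<longrightarrow> w x = 0" using D(1) by (intro AE_ball_countable') auto
  then show ?thesis by eventually_elim (use D(4) in auto)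
qed

section \<open>Mollification and the chain rule\<close>

lemma lborel_reflect: "distr lborel borel (\<lambda>x. c - x) = (lborel :: 'a::euclidean_space measure)"
  using lborel_affine[of "-1" c] by (simp add: density_1)

lemma integral_reflect:
  fixes f :: "'a::euclidean_space \<Rightarrow> real"
  assumes [measurable]: "f \<in> borel_measurable borel"
  shows "(\<integral>x. f (c - x) \<partial>lborel) = (\<integral>x. f x \<partial>lborel)"
  using integral_distr[of "\<lambda>x. c - x" lborel borel f] by (simp add: lborel_reflect)

lemma integrable_reflect:
  fixes f :: "'a::euclidean_space \<Rightarrow> real"
  assumes "integrable lborel f"
  shows "integrable lborel (\<lambda>x. f (c - x))"
proof -
  have [measurable]: "f \<in> borel_measurable borel" using assms by auto
  show ?thesis
    using integrable_distr_eq[of "\<lambda>x. c - x" lborel borel f] assms by (simp add: lborel_reflect)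
qed

lemma integral_translate:
  fixes f :: "'a::euclidean_space \<Rightarrow> real"
  assumes [measurable]: "f \<in> borel_measurable borel"
  shows "(\<integral>x. f (c + x) \<partial>lborel) = (\<integral>x. f x \<partial>lborel)"
  using integral_distr[of "(+) c" lborel borel f] by (simp add: lborel_distr_plus)

lemma integrable_translate:
  fixes f :: "'a::euclidean_space \<Rightarrow> real"
  assumes "integrable lborel f"
  shows "integrable lborel (\<lambda>x. f (c + x))"
proof -
  have [measurable]: "f \<in> borel_measurable borel" using assms by auto
  show ?thesis
    using integrable_distr_eq[of "(+) c" lborel borel f] assms by (simp add: lborel_distr_plus)
qed

lemma integrable_bounded_indicator:
  fixes c :: real
  shows "bounded S \<Longrightarrow> S \<in> sets borel \<Longrightarrow> integrable lborel (\<lambda>x. c * indicator S x)"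
  using emeasure_bounded_finite[of S] by (intro integrable_mult_right integrable_real_indicator) auto

text \<open>Dominated convergence is sequential, so derivatives are taken as limits of difference
  quotients along this one sequence. It also measures the size of the mollifiers.\<close>

definition tick :: "nat \<Rightarrow> real" where "tick n = 1 / real (Suc n)"

lemma tick_pos [simp]: "0 < tick n" by (simp add: tick_def)

lemma tick_neq_0 [simp]: "tick n \<noteq> 0" by (simp add: tick_def)

lemma abs_tick [simp]: "\<bar>tick n\<bar> = tick n" by (simp add: tick_def)

lemma tick_le_1: "tick n \<le> 1" by (simp add: tick_def)

lemma tick_tendsto: "tick \<longlonglongrightarrow> 0"
  unfolding tick_def using LIMSEQ_Suc[OF lim_inverse_n'] by simp

text \<open>By translation invariance every difference quotient has integral 0, and the Lipschitz
  bound on a fixed ball dominates them all.\<close>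

lemma integral_directional_derivative:
  fixes f f' :: "'a::euclidean_space \<Rightarrow> real"
  assumes f: "integrable lborel f"
    and L: "\<And>n x. \<bar>f (x + tick n *\<^sub>R e) - f x\<bar> \<le> L * tick n * indicator (cball 0 R) x"
    and lim: "\<And>x. (\<lambda>n. (f (x + tick n *\<^sub>R e) - f x) / tick n) \<longlonglongrightarrow> f' x"
  shows "(\<integral>x. f' x \<partial>lborel) = 0"
proof -
  have [measurable]: "f \<in> borel_measurable borel" using f by auto
  have m: "(\<lambda>x. (f (x + tick n *\<^sub>R e) - f x) / tick n) \<in> borel_measurable lborel" for n by measurable
  have "(\<lambda>n. \<integral>x. (f (x + tick n *\<^sub>R e) - f x) / tick n \<partial>lborel) \<longlonglongrightarrow> (\<integral>x. f' x \<partial>lborel)"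
  proof (rule integral_dominated_convergence[where w = "\<lambda>x. L * indicator (cball 0 R) x"])
    show "f' \<in> borel_measurable lborel" by (rule borel_measurable_LIMSEQ_real[OF lim m])
    show "integrable lborel (\<lambda>x. L * indicator (cball 0 R) x)"
      by (rule integrable_bounded_indicator) auto
    show "AE x in lborel. norm ((f (x + tick n *\<^sub>R e) - f x) / tick n) \<le> L * indicator (cball 0 R) x" for n
      using L by (intro AE_I2) (simp add: pos_divide_le_eq mult_ac abs_of_pos)
  qed (use m lim in auto)
  moreover have "(\<integral>x. (f (x + tick n *\<^sub>R e) - f x) / tick n \<partial>lborel) = 0" for n
    using integral_translate[of f "tick n *\<^sub>R e"] integrable_translate[OF f, of "tick n *\<^sub>R e"] f
    by (simp add: add.commute)
  ultimately show ?thesis by (simp add: LIMSEQ_const_iff)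
qed

text \<open>Integration by parts for a factor \<open>h\<close> that is known only through its
  Lipschitz bound and its difference quotients in one direction. The directional derivative of the
  product with \<open>\<phi>\<close> is integrated.\<close>

lemma integral_mult_test_function_derivative:
  fixes h h' \<phi> :: "'a::euclidean_space \<Rightarrow> real"
  assumes h [measurable]: "h \<in> borel_measurable borel" and A: "\<And>x. \<bar>h x\<bar> \<le> A"
    and L': "\<And>x t. \<bar>h (x + t *\<^sub>R i) - h x\<bar> \<le> L' * \<bar>t\<bar>"
    and h': "\<And>x. (\<lambda>m. (h (x + tick m *\<^sub>R i) - h x) / tick m) \<longlonglongrightarrow> h' x"
    and \<phi>: "\<phi> \<in> test_functions \<Omega>" and i: "i \<in> Basis"
  shows "(\<integral>x. h' x * \<phi> x + h x * frechet_derivative \<phi> (at x) i \<partial>lborel) = 0"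
proof -
  let ?K = "closure {x. \<phi> x \<noteq> 0}" and ?f = "\<lambda>x. h x * \<phi> x"
  have A0: "0 \<le> A" using A[of 0] by simp
  have [measurable]: "\<phi> \<in> borel_measurable borel" by (rule test_function_borel[OF \<phi>])
  obtain P where P: "0 \<le> P" "\<And>x. \<bar>\<phi> x\<bar> \<le> P" using test_function_bounded[OF \<phi>] by blast
  obtain L where L: "0 \<le> L" "\<And>x t. \<bar>\<phi> (x + t *\<^sub>R i) - \<phi> x\<bar> \<le> L * \<bar>t\<bar>"
    using test_function_lipschitz[OF \<phi> i] by blast
  have bK: "bounded ?K" using test_function_support_compact[OF \<phi>] by (rule compact_imp_bounded)
  then obtain R where R: "\<And>x. x \<in> ?K \<Longrightarrow> norm x \<le> R" by (auto simp: bounded_iff)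
  have split: "?f y - ?f x = (h y - h x) * \<phi> y + h x * (\<phi> y - \<phi> x)" for x y
    by (simp add: algebra_simps)
  show ?thesis
  proof (rule integral_directional_derivative[where f = ?f and e = i and L = "L' * P + A * L" and R = "R + 1"])
    show "integrable lborel ?f"
    proof (rule Bochner_Integration.integrable_bound)
      show "integrable lborel (\<lambda>x. (A * P) * indicator ?K x)"
        using bK by (rule integrable_bounded_indicator) simp
      have "\<bar>?f x\<bar> \<le> A * P * indicator ?K x" for x
        using A[of x] P(2)[of x] A0 test_function_outside(1)[OF \<phi>, of x]
        by (cases "x \<in> ?K") (auto simp: abs_mult intro!: mult_mono)
      then show "AE x in lborel. norm (?f x) \<le> norm ((A * P) * indicator ?K x :: real)"
        using A0 P(1) by (intro AE_I2) (simp add: abs_mult)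
    qed measurable
    \<comment> \<open>A step has length at most 1, so outside the ball of radius
      \<open>R + 1\<close> both \<open>x\<close> and the shifted point miss the support of
      \<open>\<phi>\<close>.\<close>
    show "\<bar>?f (x + tick m *\<^sub>R i) - ?f x\<bar> \<le> (L' * P + A * L) * tick m * indicator (cball 0 (R + 1)) x" for m x
    proof (cases "x \<in> cball 0 (R + 1)")
      case True
      have l: "\<bar>h (x + tick m *\<^sub>R i) - h x\<bar> \<le> L' * tick m" using L'[of x "tick m"] by simp
      have "\<bar>(h (x + tick m *\<^sub>R i) - h x) * \<phi> (x + tick m *\<^sub>R i)\<bar> \<le> L' * tick m * P"
        unfolding abs_mult using P order_trans[OF abs_ge_zero l] by (intro mult_mono l) auto
      moreover have "\<bar>h x * (\<phi> (x + tick m *\<^sub>R i) - \<phi> x)\<bar> \<le> A * (L * tick m)"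
        unfolding abs_mult using A[of x] L(2)[of x "tick m"] A0 by (intro mult_mono) auto
      ultimately show ?thesis
        unfolding split using True by (simp add: algebra_simps)
    next
      case False
      have nx: "R + 1 < norm x" using False by simp
      then have "norm (x + tick m *\<^sub>R i) > R"
        using norm_triangle_ineq4[of "x + tick m *\<^sub>R i" "tick m *\<^sub>R i"] i tick_le_1[of m] by simp
      then have "x \<notin> ?K" "x + tick m *\<^sub>R i \<notin> ?K" using R[of x] R[of "x + tick m *\<^sub>R i"] nx by auto
      then have "\<phi> x = 0" "\<phi> (x + tick m *\<^sub>R i) = 0" using test_function_outside(1)[OF \<phi>] by blast+
      then show ?thesis using False by simp
    qed
    fix x
    have "((\<lambda>t. \<phi> (x + t *\<^sub>R i)) has_real_derivative frechet_derivative \<phi> (at x) i) (at 0)"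
      using test_function_line_derivative[OF \<phi>, of x i 0] by simp
    then have "((\<lambda>h. (\<phi> (x + h *\<^sub>R i) - \<phi> x) / h) \<longlongrightarrow> frechet_derivative \<phi> (at x) i) (at 0)"
      by (simp add: DERIV_def)
    moreover have "filterlim tick (at 0) sequentially"
      using tick_tendsto by (simp add: filterlim_at)
    ultimately have 2: "(\<lambda>m. (\<phi> (x + tick m *\<^sub>R i) - \<phi> x) / tick m) \<longlonglongrightarrow> frechet_derivative \<phi> (at x) i"
      by (rule filterlim_compose)
    have "(\<lambda>m. x + tick m *\<^sub>R i) \<longlonglongrightarrow> x + 0 *\<^sub>R i" by (intro tendsto_intros tick_tendsto)
    moreover have "isCont \<phi> x" using test_function_continuous[OF \<phi>, of UNIV] by (simp add: continuous_on_eq_continuous_at)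
    ultimately have 3: "(\<lambda>m. \<phi> (x + tick m *\<^sub>R i)) \<longlonglongrightarrow> \<phi> x"
      using isCont_tendsto_compose[of x \<phi> "\<lambda>m. x + tick m *\<^sub>R i" sequentially] by simp
    have "(\<lambda>m. (h (x + tick m *\<^sub>R i) - h x) / tick m * \<phi> (x + tick m *\<^sub>R i) +
        h x * ((\<phi> (x + tick m *\<^sub>R i) - \<phi> x) / tick m))
      \<longlonglongrightarrow> h' x * \<phi> x + h x * frechet_derivative \<phi> (at x) i"
      by (intro tendsto_add tendsto_mult h' 2 3 tendsto_const)
    then show "(\<lambda>m. (?f (x + tick m *\<^sub>R i) - ?f x) / tick m) \<longlonglongrightarrow> h' x * \<phi> x + h x * frechet_derivative \<phi> (at x) i"
      unfolding split by (simp add: add_divide_distrib)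
  qed
qed

lemma integral_test_function_derivative:
  "\<phi> \<in> test_functions \<Omega> \<Longrightarrow> i \<in> Basis \<Longrightarrow> (\<integral>x. frechet_derivative \<phi> (at x) i \<partial>lborel) = 0"
  using integral_mult_test_function_derivative[of "\<lambda>x. 1" 1 i 0 "\<lambda>x. 0" \<phi> \<Omega>] by simp

text \<open>An average with respect to a probability density inherits every bound valid where the
  density is nonzero. With \<open>c = 0\<close> this bounds mollified functions, with
  \<open>c\<close> a value of the function it yields their convergence.\<close>

lemma average_close:
  fixes h k :: "'a::euclidean_space \<Rightarrow> real"
  assumes k: "integrable lborel k" "\<And>y. 0 \<le> k y" "(\<integral>y. k y \<partial>lborel) = 1"
    and h [measurable]: "h \<in> borel_measurable borel"
    and close: "\<And>y. k y \<noteq> 0 \<Longrightarrow> \<bar>h y - c\<bar> \<le> e"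
  shows "integrable lborel (\<lambda>y. h y * k y)" "\<bar>(\<integral>y. h y * k y \<partial>lborel) - c\<bar> \<le> e"
proof -
  have [measurable]: "k \<in> borel_measurable borel" using k(1) by auto
  have b: "\<bar>(h y - c) * k y\<bar> \<le> e * k y" for y
    using close[of y] k(2)[of y] by (cases "k y = 0") (auto simp: abs_mult intro: mult_right_mono)
  have i: "integrable lborel (\<lambda>y. (h y - c) * k y)"
  proof (rule Bochner_Integration.integrable_bound)
    show "integrable lborel (\<lambda>y. e * k y)" using k(1) by simp
    show "AE y in lborel. norm ((h y - c) * k y) \<le> norm (e * k y)"
      using b by (intro AE_I2) (smt (verit, best) real_norm_def)
  qed measurable
  from Bochner_Integration.integrable_add[OF this integrable_mult_right[OF k(1), of c]]
  show hk: "integrable lborel (\<lambda>y. h y * k y)" by (simp add: algebra_simps)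
  have "(\<integral>y. h y * k y \<partial>lborel) - c = (\<integral>y. h y * k y \<partial>lborel) - (\<integral>y. c * k y \<partial>lborel)"
    using k by simp
  also have "\<dots> = (\<integral>y. h y * k y - c * k y \<partial>lborel)"
    using hk k(1) by (intro Bochner_Integration.integral_diff[symmetric]) auto
  also have "\<dots> = (\<integral>y. (h y - c) * k y \<partial>lborel)" by (simp add: algebra_simps)
  also have "\<bar>\<dots>\<bar> \<le> (\<integral>y. e * k y \<partial>lborel)"
    by (rule integral_abs_bound_integral[OF i]) (use k(1) b in auto)
  also have "\<dots> = e" using k by simp
  finally show "\<bar>(\<integral>y. h y * k y \<partial>lborel) - c\<bar> \<le> e" .
qed

section \<open>Mollifiers\<close>

definition molly :: "nat \<Rightarrow> 'a::euclidean_space \<Rightarrow> real" where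
  "molly n z = bump 1 (- (tick n *\<^sub>R One)) (tick n *\<^sub>R One) z /
     (\<integral>y. bump 1 (- (tick n *\<^sub>R One)) (tick n *\<^sub>R One) (y::'a) \<partial>lborel)"

text \<open>The bump lives on a cube of half side \<open>tick n\<close>. Euclidean distance is
  bounded there by the sum of the coordinates, hence the factor of the dimension; the type argument
  only carries that dimension.\<close>

definition radius :: "'a::euclidean_space itself \<Rightarrow> nat \<Rightarrow> real" where
  "radius T n = real DIM('a) * tick n"

lemma radius_tendsto: "radius T \<longlonglongrightarrow> 0"
  unfolding radius_def using tendsto_mult_right_zero[OF tick_tendsto] by simp

lemma bump_integrable: "integrable lborel (bump 1 a (b::'a::euclidean_space))"
proof -
  have t: "bump 1 a b \<in> test_functions UNIV" by (rule bump_test_function) auto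
  have [measurable]: "bump 1 a b \<in> borel_measurable borel" by (rule test_function_borel[OF t])
  show ?thesis
  proof (rule Bochner_Integration.integrable_bound)
    show "integrable lborel (indicator (box a b) :: 'a \<Rightarrow> real)"
      using integrable_bounded_indicator[of "box a b" 1] by simp
    show "AE x in lborel. norm (bump 1 a b x) \<le> norm (indicator (box a b) x :: real)"
    proof (intro AE_I2)
      fix x
      show "norm (bump 1 a b x) \<le> norm (indicator (box a b) x :: real)"
        using bump_le_1[of 1 a b x] bump_nonneg[of 1 a b x] bump_eq_0_iff[of 1 a b x] by (cases "x \<in> box a b") auto
    qed
  qed measurable
qed

lemma bump_integral_pos:
  assumes "box a b \<noteq> {}"
  shows "0 < (\<integral>y. bump 1 a b (y::'a::euclidean_space) \<partial>lborel)"
proof -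
  have "(\<integral>y. bump 1 a b y \<partial>lborel) \<noteq> 0"
  proof
    assume "(\<integral>y. bump 1 a b y \<partial>lborel) = 0"
    then have "AE x in lborel. bump 1 a b x = 0"
      using integral_nonneg_eq_0_iff_AE[OF bump_integrable, of a b] by (simp add: bump_nonneg)
    then have "AE x in lborel. x \<notin> box a b" by (simp add: bump_eq_0_iff)
    then have "box a b \<in> null_sets lborel" by (subst (asm) AE_iff_null_sets[symmetric]) auto
    then show False using open_not_negligible[OF open_box assms]
      by (metis negligible_iff_null_sets null_sets_completionI)
  qed
  moreover have "0 \<le> (\<integral>y. bump 1 a b y \<partial>lborel)"
    by (rule Bochner_Integration.integral_nonneg) (rule bump_nonneg)
  ultimately show ?thesis by (simp add: order_less_le)
qed

lemma molly_norm_pos: "0 < (\<integral>y. bump 1 (- (tick n *\<^sub>R One)) (tick n *\<^sub>R One) (y::'a::euclidean_space) \<partial>lborel)"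
proof (rule bump_integral_pos)
  have "(0::'a) \<in> box (- (tick n *\<^sub>R One)) (tick n *\<^sub>R One)" by (simp add: mem_box)
  then show "box (- (tick n *\<^sub>R One)) (tick n *\<^sub>R One) \<noteq> ({}::'a set)" by blast
qed

lemma molly_nonneg: "0 \<le> molly n z"
  unfolding molly_def by (intro divide_nonneg_pos bump_nonneg molly_norm_pos)

lemma molly_integrable: "integrable lborel (molly n)"
  unfolding molly_def by (intro integrable_divide_zero) (simp add: bump_integrable)

lemma molly_integral: "(\<integral>z. molly n (z::'a::euclidean_space) \<partial>lborel) = 1"
  unfolding molly_def using molly_norm_pos[of n, where ?'a='a] by simp

lemma molly_support: "molly n z \<noteq> 0 \<Longrightarrow> norm (z::'a::euclidean_space) \<le> radius TYPE('a) n"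
proof -
  assume "molly n z \<noteq> 0"
  then have "z \<in> box (- (tick n *\<^sub>R One)) (tick n *\<^sub>R One)" by (auto simp: molly_def bump_eq_0_iff)
  then have "\<bar>z \<bullet> i\<bar> \<le> tick n" if "i \<in> Basis" for i using that by (force simp: mem_box)
  then have "(\<Sum>i\<in>Basis. \<bar>z \<bullet> i\<bar>) \<le> (\<Sum>i\<in>(Basis::'a set). tick n)" by (intro sum_mono)
  then show ?thesis using norm_le_l1[of z] by (simp add: radius_def)
qed

lemma molly_test_function:
  fixes x :: "'a::euclidean_space"
  assumes "cball x (radius TYPE('a) n) \<subseteq> \<Omega>"
  shows "(\<lambda>y. molly n (y - x)) \<in> test_functions \<Omega>"
proof -
  let ?a = "x - tick n *\<^sub>R One" and ?b = "x + tick n *\<^sub>R One"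
  have "bump 1 (- (tick n *\<^sub>R One)) (tick n *\<^sub>R One) (y - x) = bump 1 ?a ?b y" for y
    by (simp add: bump_def inner_diff_left inner_add_left algebra_simps)
  moreover have "cbox ?a ?b \<subseteq> \<Omega>"
  proof
    fix y assume "y \<in> cbox ?a ?b"
    then have "\<bar>(y - x) \<bullet> i\<bar> \<le> tick n" if "i \<in> Basis" for i
      using that by (force simp: mem_box inner_diff_left inner_add_left abs_le_iff)
    then have "(\<Sum>i\<in>Basis. \<bar>(y - x) \<bullet> i\<bar>) \<le> (\<Sum>i\<in>(Basis::'a set). tick n)" by (intro sum_mono)
    then have "dist x y \<le> radius TYPE('a) n"
      using norm_le_l1[of "y - x"] by (simp add: radius_def dist_norm norm_minus_commute)
    then show "y \<in> \<Omega>" using assms by auto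
  qed
  from test_function_cmult[OF bump_test_function[OF zero_less_one this]]
  show ?thesis unfolding molly_def calculation by (simp add: divide_inverse mult.commute)
qed

lemma molly_test_UNIV: "molly n \<in> test_functions UNIV"
  using molly_test_function[of 0 n UNIV] by simp

lemma molly_borel [measurable]: "molly n \<in> borel_measurable borel"
  by (rule test_function_borel[OF molly_test_UNIV])

lemma molly_shift_integral: "(\<integral>y. molly n (y - x) \<partial>lborel) = 1"
  using integral_translate[of "molly n" "- x"] molly_integral by simp

lemma molly_shift_integrable: "integrable lborel (\<lambda>y. molly n (y - x))"
  using integrable_translate[OF molly_integrable, of n "- x"] by simp

lemma molly_reflect_integral: "(\<integral>x. molly n (y - x) \<partial>lborel) = 1"
  using integral_reflect[of "molly n" y] molly_integral by simp

lemma molly_reflect_integrable: "integrable lborel (\<lambda>x. molly n (y - x))"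
  by (rule integrable_reflect[OF molly_integrable])

lemma molly_shift_derivative:
  "frechet_derivative (\<lambda>y. molly n (y - x)) (at y) = frechet_derivative (molly n) (at (y - x))"
proof (rule frechet_derivative_eqI)
  have "((\<lambda>y. y - x) has_derivative (\<lambda>h. h)) (at y)" by (auto intro!: derivative_eq_intros)
  from has_derivative_compose[OF this test_function_derivative[OF molly_test_UNIV]]
  show "((\<lambda>y. molly n (y - x)) has_derivative frechet_derivative (molly n) (at (y - x))) (at y)" .
qed

text \<open>With the argument \<open>y - x\<close> the kernel is itself a test function of the
  integration variable, to which the weak derivative identity can be applied.\<close>

definition conv :: "('a::euclidean_space \<Rightarrow> real) \<Rightarrow> nat \<Rightarrow> 'a \<Rightarrow> real" where
  "conv U n x = (\<integral>y. U y * molly n (y - x) \<partial>lborel)"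

text \<open>One direction at a time, with Borel functions on the whole space so that translation and
  Fubini's theorem are at hand. \<open>U\<close> and \<open>G\<close> stand for the zero extensions
  of a function and of a component of its weak gradient. The extension of the function may jump
  across the boundary, hence continuity only inside \<Omega>.\<close>

locale chain_rule =
  fixes \<Omega> :: "'a::euclidean_space set" and U G :: "'a \<Rightarrow> real" and i :: 'a and M :: real
  assumes open_\<Omega>: "open \<Omega>"
    and U_borel [measurable]: "U \<in> borel_measurable borel"
    and U_bound: "\<And>x. \<bar>U x\<bar> \<le> M"
    and U_int: "integrable lborel U"
    and U_cont: "\<And>y. y \<in> \<Omega> \<Longrightarrow> isCont U y"
    and G_int: "integrable lborel G"
    and G_out: "\<And>y. y \<notin> \<Omega> \<Longrightarrow> G y = 0"
    and i: "i \<in> Basis"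
    and weak: "\<And>\<phi>. \<phi> \<in> test_functions \<Omega> \<Longrightarrow>
      (\<integral>x. U x * frechet_derivative \<phi> (at x) i \<partial>lborel) = - (\<integral>x. G x * \<phi> x \<partial>lborel)"
begin

lemma G_borel [measurable]: "G \<in> borel_measurable borel" using G_int by auto

lemma conv_borel [measurable]: "conv U n \<in> borel_measurable borel"
  unfolding conv_def by measurable

lemma conv_integrable: "integrable lborel (\<lambda>y. U y * molly n (y - x))"
  by (rule average_close(1)[OF molly_shift_integrable molly_nonneg molly_shift_integral U_borel, of n x 0 M])
    (use U_bound in auto)

lemma conv_bound: "\<bar>conv U n x\<bar> \<le> M"
  using average_close(2)[OF molly_shift_integrable molly_nonneg molly_shift_integral U_borel, of n x 0 M] U_bound
  by (simp add: conv_def)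

text \<open>The estimate is uniform for \<open>x\<close> near \<open>y\<close> because
  \<open>conv U n\<close> will itself be averaged around \<open>y\<close> in
  \<open>chain_rule_weak\<close>. Two radii below \<open>d / 2\<close> keep the kernel within
  distance \<open>d\<close> of \<open>y\<close>.\<close>

lemma conv_close:
  assumes y: "y \<in> \<Omega>" and e: "0 < e"
  shows "\<forall>\<^sub>F n in sequentially. \<forall>x. dist x y \<le> radius TYPE('a) n \<longrightarrow> \<bar>conv U n x - U y\<bar> \<le> e"
proof -
  obtain d where d: "0 < d" "\<And>z. dist z y < d \<Longrightarrow> dist (U z) (U y) < e"
    using U_cont[OF y] e unfolding continuous_at_eps_delta by blast
  have "\<forall>\<^sub>F n in sequentially. radius TYPE('a) n < d / 2"
    by (rule order_tendstoD[OF radius_tendsto]) (use d in auto)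
  then show ?thesis
  proof eventually_elim
    fix n assume n: "radius TYPE('a) n < d / 2"
    have "\<bar>conv U n x - U y\<bar> \<le> e" if x: "dist x y \<le> radius TYPE('a) n" for x
      unfolding conv_def
    proof (rule average_close(2)[OF molly_shift_integrable molly_nonneg molly_shift_integral U_borel])
      fix z assume "molly n (z - x) \<noteq> 0"
      then have "dist z x \<le> radius TYPE('a) n" using molly_support by (simp add: dist_norm)
      then have "dist z y < d" using x n dist_triangle[of z y x] by simp
      then show "\<bar>U z - U y\<bar> \<le> e" using d(2) by (force simp: dist_real_def)
    qed
    then show "\<forall>x. dist x y \<le> radius TYPE('a) n \<longrightarrow> \<bar>conv U n x - U y\<bar> \<le> e" by blast
  qed
qed

lemma radius_nonneg: "0 \<le> radius TYPE('a) n" by (simp add: radius_def less_imp_le)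

lemma conv_tendsto: "x \<in> \<Omega> \<Longrightarrow> (\<lambda>n. conv U n x) \<longlonglongrightarrow> U x"
proof (rule tendstoI)
  fix e :: real assume x: "x \<in> \<Omega>" and "0 < e"
  then have "0 < e / 2" by simp
  from conv_close[OF x this] show "\<forall>\<^sub>F n in sequentially. dist (conv U n x) (U x) < e"
  proof eventually_elim
    fix n assume "\<forall>z. dist z x \<le> radius TYPE('a) n \<longrightarrow> \<bar>conv U n z - U x\<bar> \<le> e / 2"
    then have "\<bar>conv U n x - U x\<bar> \<le> e / 2" using radius_nonneg by simp
    then show "dist (conv U n x) (U x) < e" using \<open>0 < e\<close> by (simp add: dist_real_def)
  qed
qed

text \<open>The derivative of \<open>conv U n\<close> in the direction \<open>i\<close>, taken under
  the integral; the sign comes from the argument \<open>y - x\<close> of the kernel.\<close>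

definition dconv :: "nat \<Rightarrow> 'a \<Rightarrow> real" where
  "dconv n x = - (\<integral>y. U y * frechet_derivative (molly n) (at (y - x)) i \<partial>lborel)"

lemma conv_lipschitz:
  obtains L where "0 \<le> L" "\<And>x t. \<bar>conv U n (x + t *\<^sub>R i) - conv U n x\<bar> \<le> L * \<bar>t\<bar>"
proof -
  obtain L where L: "0 \<le> L" "\<And>x t. \<bar>molly n (x + t *\<^sub>R i) - molly n x\<bar> \<le> L * \<bar>t\<bar>"
    using test_function_lipschitz[OF molly_test_UNIV i] by blast
  have "\<bar>conv U n (x + t *\<^sub>R i) - conv U n x\<bar> \<le> (\<integral>y. \<bar>U y\<bar> \<partial>lborel) * L * \<bar>t\<bar>" for x t
  proof -
    have "conv U n (x + t *\<^sub>R i) - conv U n x = (\<integral>y. U y * molly n (y - (x + t *\<^sub>R i)) - U y * molly n (y - x) \<partial>lborel)"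
      unfolding conv_def by (rule Bochner_Integration.integral_diff[symmetric]) (rule conv_integrable)+
    also have "\<bar>\<dots>\<bar> \<le> (\<integral>y. \<bar>U y\<bar> * (L * \<bar>t\<bar>) \<partial>lborel)"
    proof (rule integral_abs_bound_integral)
      show "integrable lborel (\<lambda>y. U y * molly n (y - (x + t *\<^sub>R i)) - U y * molly n (y - x))"
        by (intro Bochner_Integration.integrable_diff conv_integrable)
      fix y
      have "\<bar>molly n (y - (x + t *\<^sub>R i)) - molly n (y - x)\<bar> \<le> L * \<bar>t\<bar>"
        using L(2)[of "y - x" "- t"] by (simp add: algebra_simps)
      then show "\<bar>U y * molly n (y - (x + t *\<^sub>R i)) - U y * molly n (y - x)\<bar> \<le> \<bar>U y\<bar> * (L * \<bar>t\<bar>)"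
        by (simp add: abs_mult mult_left_mono flip: right_diff_distrib)
    qed (use U_int in auto)
    finally show ?thesis by (simp add: mult.assoc)
  qed
  then show ?thesis using that L(1) by (metis Bochner_Integration.integral_nonneg abs_ge_zero mult_nonneg_nonneg)
qed

lemma conv_derivative: "(\<lambda>m. (conv U n (x + tick m *\<^sub>R i) - conv U n x) / tick m) \<longlonglongrightarrow> dconv n x"
proof -
  obtain L where L: "0 \<le> L" "\<And>x t. \<bar>molly n (x + t *\<^sub>R i) - molly n x\<bar> \<le> L * \<bar>t\<bar>"
    using test_function_lipschitz[OF molly_test_UNIV i] by blast
  have [measurable]: "(\<lambda>x. frechet_derivative (molly n) (at x) i) \<in> borel_measurable borel"
    by (rule test_function_derivative_borel[OF molly_test_UNIV i])
  let ?s = "\<lambda>m y. U y * ((molly n (y - x + (- tick m) *\<^sub>R i) - molly n (y - x)) / tick m)"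
  have "(\<lambda>m. \<integral>y. ?s m y \<partial>lborel) \<longlonglongrightarrow> (\<integral>y. U y * - frechet_derivative (molly n) (at (y - x)) i \<partial>lborel)"
  proof (rule integral_dominated_convergence[where w = "\<lambda>y. \<bar>U y\<bar> * L"])
    show "AE y in lborel. (\<lambda>m. ?s m y) \<longlonglongrightarrow> U y * - frechet_derivative (molly n) (at (y - x)) i"
    proof (intro AE_I2 tendsto_mult tendsto_const)
      fix y
      have "((\<lambda>t. molly n (y - x + t *\<^sub>R i)) has_real_derivative frechet_derivative (molly n) (at (y - x)) i) (at 0)"
        using test_function_line_derivative[OF molly_test_UNIV, of n "y - x" i 0] by simp
      then have "((\<lambda>h. (molly n (y - x + h *\<^sub>R i) - molly n (y - x)) / h) \<longlongrightarrow> frechet_derivative (molly n) (at (y - x)) i) (at 0)"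
        by (simp add: DERIV_def)
      moreover have "filterlim (\<lambda>m. - tick m) (at 0) sequentially"
        using tendsto_minus[OF tick_tendsto] by (simp add: filterlim_at)
      ultimately have "(\<lambda>m. (molly n (y - x + (- tick m) *\<^sub>R i) - molly n (y - x)) / (- tick m)) \<longlonglongrightarrow> frechet_derivative (molly n) (at (y - x)) i"
        by (rule filterlim_compose)
      from tendsto_minus[OF this]
      show "(\<lambda>m. (molly n (y - x + (- tick m) *\<^sub>R i) - molly n (y - x)) / tick m) \<longlonglongrightarrow> - frechet_derivative (molly n) (at (y - x)) i"
        by simp
    qed
    show "AE y in lborel. norm (?s m y) \<le> \<bar>U y\<bar> * L" for m
    proof (intro AE_I2)
      fix y
      have "\<bar>molly n (y - x + (- tick m) *\<^sub>R i) - molly n (y - x)\<bar> \<le> L * tick m"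
        using L(2)[of "y - x" "- tick m"] by (simp add: less_imp_le)
      then have "\<bar>(molly n (y - x + (- tick m) *\<^sub>R i) - molly n (y - x)) / tick m\<bar> \<le> L"
        by (simp add: pos_divide_le_eq)
      then show "norm (?s m y) \<le> \<bar>U y\<bar> * L" unfolding real_norm_def abs_mult by (rule mult_left_mono) simp
    qed
  qed (use U_int in auto)
  moreover have "(\<integral>y. ?s m y \<partial>lborel) = (conv U n (x + tick m *\<^sub>R i) - conv U n x) / tick m" for m
  proof -
    have "?s m y = (U y * molly n (y - (x + tick m *\<^sub>R i)) - U y * molly n (y - x)) / tick m" for y
      by (simp add: algebra_simps diff_divide_distrib)
    then show ?thesis using conv_integrable by (simp add: conv_def)
  qed
  ultimately show ?thesis by (simp add: dconv_def)
qed

text \<open>Mollification commutes with weak differentiation wherever the support of the kernel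
  stays inside \<Omega>. Through this identity the assumption \<open>weak\<close> enters the chain
  rule.\<close>

lemma dconv_eq:
  assumes "cball x (radius TYPE('a) n) \<subseteq> \<Omega>"
  shows "dconv n x = (\<integral>y. G y * molly n (y - x) \<partial>lborel)"
  using weak[OF molly_test_function[OF assms]] by (simp add: dconv_def molly_shift_derivative)

lemma F_lipschitz:
  fixes F :: "real \<Rightarrow> real"
  assumes F: "\<And>z. (F has_real_derivative F' z) (at z)" and C: "\<And>z. \<bar>F' z\<bar> \<le> C"
  shows "\<bar>F z - F w\<bar> \<le> C * \<bar>z - w\<bar>" "\<bar>F (conv U n x)\<bar> \<le> \<bar>F 0\<bar> + C * M" "F \<in> borel_measurable borel"
proof -
  show l: "\<bar>F z - F w\<bar> \<le> C * \<bar>z - w\<bar>" for z w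
    using field_differentiable_bound[of UNIV F F' C z w] F C by simp
  have "C * \<bar>conv U n x\<bar> \<le> C * M"
    using conv_bound order_trans[OF abs_ge_zero C] by (intro mult_left_mono)
  then show "\<bar>F (conv U n x)\<bar> \<le> \<bar>F 0\<bar> + C * M" using l[of "conv U n x" 0] by simp
  show "F \<in> borel_measurable borel"
    using F by (intro borel_measurable_continuous_onI continuous_at_imp_continuous_on) (blast intro: DERIV_isCont)
qed

lemma conv_chain_identity:
  assumes F: "\<And>z. (F has_real_derivative F' z) (at z)" and C: "\<And>z. \<bar>F' z\<bar> \<le> C"
    and \<phi>: "\<phi> \<in> test_functions \<Omega>"
  shows "(\<integral>x. F' (conv U n x) * dconv n x * \<phi> x + F (conv U n x) * frechet_derivative \<phi> (at x) i \<partial>lborel) = 0"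
proof -
  note Fl = F_lipschitz[OF F C]
  obtain L' where L': "0 \<le> L'" "\<And>x t. \<bar>conv U n (x + t *\<^sub>R i) - conv U n x\<bar> \<le> L' * \<bar>t\<bar>"
    using conv_lipschitz by blast
  show ?thesis
  proof (rule integral_mult_test_function_derivative[where h = "\<lambda>x. F (conv U n x)", OF _ Fl(2) _ _ \<phi> i])
    show "(\<lambda>x. F (conv U n x)) \<in> borel_measurable borel" using Fl(3) by measurable
    show "\<bar>F (conv U n (x + t *\<^sub>R i)) - F (conv U n x)\<bar> \<le> (C * L') * \<bar>t\<bar>" for x t
      using order_trans[OF Fl(1) mult_left_mono[OF L'(2) order_trans[OF abs_ge_zero C]]] by (simp add: mult.assoc)
    fix x
    let ?v = "\<lambda>m. conv U n (x + tick m *\<^sub>R i)"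
    have "(\<lambda>m. ?v m - conv U n x) \<longlonglongrightarrow> 0"
    proof (rule Lim_null_comparison)
      show "\<forall>\<^sub>F m in sequentially. norm (?v m - conv U n x) \<le> L' * tick m"
        using L'(2)[of x "tick _"] by (intro always_eventually) (simp add: less_imp_le)
      show "(\<lambda>m. L' * tick m) \<longlonglongrightarrow> 0" using tendsto_mult_right_zero[OF tick_tendsto] .
    qed
    then have v: "?v \<longlonglongrightarrow> conv U n x" by (rule LIM_zero_cancel)
    \<comment> \<open>Caratheodory's form of the derivative avoids division by an increment of
      \<open>conv U n\<close> that may vanish.\<close>
    obtain g where g: "\<And>z. F z - F (conv U n x) = g z * (z - conv U n x)" "isCont g (conv U n x)" "g (conv U n x) = F' (conv U n x)"
      using F[of "conv U n x"] unfolding CARAT_DERIV by blast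
    have "(\<lambda>m. g (?v m) * ((?v m - conv U n x) / tick m)) \<longlonglongrightarrow> F' (conv U n x) * dconv n x"
      using isCont_tendsto_compose[OF g(2) v] g(3) by (intro tendsto_mult conv_derivative) simp
    then show "(\<lambda>m. (F (?v m) - F (conv U n x)) / tick m) \<longlonglongrightarrow> F' (conv U n x) * dconv n x"
      by (simp add: g(1))
  qed
qed

text \<open>Moves the mollifier from \<open>G\<close>, which is merely integrable, to the bounded
  factor \<open>h\<close>. On that side pointwise limits exist, and a multiple of the absolute value
  of \<open>G\<close> dominates.\<close>

lemma fubini_swap:
  assumes h [measurable]: "h \<in> borel_measurable borel" and b: "\<And>x. \<bar>h x\<bar> \<le> B"
  shows "(\<integral>x. h x * (\<integral>y. G y * molly n (y - x) \<partial>lborel) \<partial>lborel) =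
    (\<integral>y. G y * (\<integral>x. h x * molly n (y - x) \<partial>lborel) \<partial>lborel)"
    "integrable lborel (\<lambda>x. h x * (\<integral>y. G y * molly n (y - x) \<partial>lborel))"
proof -
  let ?f = "\<lambda>(y, x). G y * (h x * molly n (y - x))"
  have hi: "integrable lborel (\<lambda>x. h x * molly n (y - x))" for y
    by (rule average_close(1)[OF molly_reflect_integrable molly_nonneg molly_reflect_integral h, of n y 0 B])
      (use b in auto)
  have int: "integrable (lborel \<Otimes>\<^sub>M lborel) ?f"
  proof (rule lborel_pair.Fubini_integrable)
    show "?f \<in> borel_measurable (lborel \<Otimes>\<^sub>M lborel)" by measurable
    show "AE y in lborel. integrable lborel (\<lambda>x. ?f (y, x))" using hi by simp
    show "integrable lborel (\<lambda>y. \<integral>x. norm (?f (y, x)) \<partial>lborel)"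
    proof (rule Bochner_Integration.integrable_bound)
      show "integrable lborel (\<lambda>y. G y * B)" using G_int by simp
      have "(\<integral>x. \<bar>h x * molly n (y - x)\<bar> \<partial>lborel) \<le> B" for y
      proof -
        have "(\<integral>x. \<bar>h x * molly n (y - x)\<bar> \<partial>lborel) \<le> (\<integral>x. B * molly n (y - x) \<partial>lborel)"
        proof (rule integral_mono)
          show "integrable lborel (\<lambda>x. \<bar>h x * molly n (y - x)\<bar>)" using hi by (rule integrable_abs)
          show "integrable lborel (\<lambda>x. B * molly n (y - x))" by (intro integrable_mult_right molly_reflect_integrable)
          show "\<bar>h x * molly n (y - x)\<bar> \<le> B * molly n (y - x)" for x
            using b[of x] molly_nonneg[of n "y - x"] by (simp add: abs_mult mult_right_mono)
        qed
        then show ?thesis by (simp add: molly_reflect_integral)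
      qed
      moreover have "0 \<le> B" using b[of 0] by simp
      ultimately show "AE y in lborel. norm (\<integral>x. norm (?f (y, x)) \<partial>lborel) \<le> norm (G y * B)"
        by (intro AE_I2) (simp add: abs_mult[of "G _"] Bochner_Integration.integral_nonneg mult_left_mono)
    qed measurable
  qed
  from lborel_pair.Fubini_integral[OF int]
  have "(\<integral>x. \<integral>y. G y * (h x * molly n (y - x)) \<partial>lborel \<partial>lborel) = (\<integral>y. \<integral>x. G y * (h x * molly n (y - x)) \<partial>lborel \<partial>lborel)" .
  moreover have gx: "(\<integral>y. G y * (h x * molly n (y - x)) \<partial>lborel) = h x * (\<integral>y. G y * molly n (y - x) \<partial>lborel)" for x
    by (subst integral_mult_right_zero[symmetric]) (simp add: mult_ac)
  moreover have "(\<integral>x. G y * (h x * molly n (y - x)) \<partial>lborel) = G y * (\<integral>x. h x * molly n (y - x) \<partial>lborel)" for y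
    by (rule integral_mult_right_zero)
  ultimately show "(\<integral>x. h x * (\<integral>y. G y * molly n (y - x) \<partial>lborel) \<partial>lborel) =
    (\<integral>y. G y * (\<integral>x. h x * molly n (y - x) \<partial>lborel) \<partial>lborel)" by simp
  show "integrable lborel (\<lambda>x. h x * (\<integral>y. G y * molly n (y - x) \<partial>lborel))"
    using lborel_pair.integrable_snd[OF int] by (simp add: gx)
qed

lemma eventually_cball_subset:
  assumes "compact K" "K \<subseteq> \<Omega>"
  shows "\<forall>\<^sub>F n in sequentially. \<forall>x\<in>K. cball x (radius TYPE('a) n) \<subseteq> \<Omega>"
proof (cases "K = {}")
  case False
  obtain e where e: "0 < e" "{x. infdist x K \<le> e} \<subseteq> \<Omega>"
    using compact_in_open_separated[OF False assms(1) open_\<Omega> assms(2)] by blast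
  have "\<forall>\<^sub>F n in sequentially. radius TYPE('a) n < e"
    by (rule order_tendstoD[OF radius_tendsto]) (use e in auto)
  then show ?thesis
  proof eventually_elim
    fix n assume n: "radius TYPE('a) n < e"
    show "\<forall>x\<in>K. cball x (radius TYPE('a) n) \<subseteq> \<Omega>"
    proof (intro ballI subsetI)
      fix x y assume "x \<in> K" "y \<in> cball x (radius TYPE('a) n)"
      then have "infdist y K \<le> e" using infdist_le[of x K y] n by (simp add: dist_commute)
      then show "y \<in> \<Omega>" using e(2) by blast
    qed
  qed
qed simp

text \<open>The classical chain rule holds for \<open>conv U n\<close>. After
  \<open>dconv_eq\<close> and \<open>fubini_swap\<close> only two limits remain:
  \<open>F (conv U n x)\<close> on the compact support of \<open>\<phi>\<close>, and the local
  averages \<open>H n y\<close> of \<open>F' (conv U n x) * \<phi> x\<close>, which converge by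
  joint continuity of \<open>F' s * \<phi> x\<close> in \<open>s\<close> and
  \<open>x\<close>.\<close>

theorem chain_rule_weak:
  assumes F: "\<And>z. (F has_real_derivative F' z) (at z)" and C: "\<And>z. \<bar>F' z\<bar> \<le> C"
    and F': "continuous_on UNIV F'" and \<phi>: "\<phi> \<in> test_functions \<Omega>"
  shows "(\<integral>x. F (U x) * frechet_derivative \<phi> (at x) i \<partial>lborel) = - (\<integral>x. F' (U x) * G x * \<phi> x \<partial>lborel)"
proof -
  let ?K = "closure {x. \<phi> x \<noteq> 0}" and ?d = "\<lambda>x. frechet_derivative \<phi> (at x) i"
  have K: "compact ?K" "?K \<subseteq> \<Omega>" using \<phi> by (auto simp: test_functions_def)
  have C0: "0 \<le> C" using C[of 0] by simp
  define A where "A = \<bar>F 0\<bar> + C * M"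
  have A: "\<bar>F (conv U n x)\<bar> \<le> A" for n x unfolding A_def by (rule F_lipschitz(2)[OF F C])
  have A0: "0 \<le> A" using A[of 0 0] by simp
  have Fcont: "isCont F z" for z using F by (rule DERIV_isCont)
  note [measurable] = F_lipschitz(3)[OF F C]
  have [measurable]: "F' \<in> borel_measurable borel" using F' by (intro borel_measurable_continuous_onI)
  have [measurable]: "\<phi> \<in> borel_measurable borel" by (rule test_function_borel[OF \<phi>])
  have [measurable]: "?d \<in> borel_measurable borel" by (rule test_function_derivative_borel[OF \<phi> i])
  obtain P where P: "0 \<le> P" "\<And>x. \<bar>\<phi> x\<bar> \<le> P" using test_function_bounded[OF \<phi>] by blast
  obtain Q where Q: "0 \<le> Q" "\<And>x. \<bar>?d x\<bar> \<le> Q" using test_function_derivative_bounded[OF \<phi> i] by blast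
  have indK: "integrable lborel (\<lambda>x. c * indicator ?K x)" for c :: real
    using compact_imp_bounded[OF K(1)]
    by (rule integrable_bounded_indicator) simp
  have Fd: "\<bar>F (conv U n x) * ?d x\<bar> \<le> (A * Q) * indicator ?K x" for n x
    using A[of n x] Q(2)[of x] A0 test_function_outside(2)[OF \<phi>, of x]
    by (cases "x \<in> ?K") (auto simp: abs_mult intro!: mult_mono)
  have I1: "(\<lambda>n. \<integral>x. F (conv U n x) * ?d x \<partial>lborel) \<longlonglongrightarrow> (\<integral>x. F (U x) * ?d x \<partial>lborel)"
  proof (rule integral_dominated_convergence[where w = "\<lambda>x. (A * Q) * indicator ?K x"])
    show "AE x in lborel. (\<lambda>n. F (conv U n x) * ?d x) \<longlonglongrightarrow> F (U x) * ?d x"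
    proof (intro AE_I2)
      fix x
      show "(\<lambda>n. F (conv U n x) * ?d x) \<longlonglongrightarrow> F (U x) * ?d x"
      proof (cases "x \<in> ?K")
        case True
        then have "x \<in> \<Omega>" using K(2) by blast
        then show ?thesis by (intro tendsto_mult tendsto_const isCont_tendsto_compose[OF Fcont] conv_tendsto)
      next
        case False
        then have "frechet_derivative \<phi> (at x) = (\<lambda>h. 0)" by (rule test_function_outside(2)[OF \<phi>])
        then show ?thesis by simp
      qed
    qed
  qed (use Fd indK in auto)
  define H where "H n y = (\<integral>x. (F' (conv U n x) * \<phi> x) * molly n (y - x) \<partial>lborel)" for n y
  have hb: "\<bar>F' z * \<phi> x\<bar> \<le> C * P" for z x
    unfolding abs_mult using C P by (intro mult_mono C0) auto
  have hm [measurable]: "(\<lambda>x. F' (conv U n x) * \<phi> x) \<in> borel_measurable borel" for n by measurable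
  have Hb: "\<bar>H n y\<bar> \<le> C * P" for n y
    using average_close(2)[OF molly_reflect_integrable molly_nonneg molly_reflect_integral hm, of n y n 0 "C * P"] hb
    by (simp add: H_def)
  have Hlim: "(\<lambda>n. H n y) \<longlonglongrightarrow> F' (U y) * \<phi> y" if y: "y \<in> \<Omega>" for y
  proof (rule tendstoI)
    fix e :: real assume e: "0 < e"
    have "continuous_on UNIV (\<lambda>p::real \<times> 'a. F' (fst p) * \<phi> (snd p))"
      by (rule continuous_on_mult[OF continuous_on_compose2[OF F' continuous_on_fst]
            continuous_on_compose2[OF test_function_continuous[OF \<phi>, of UNIV] continuous_on_snd]])
        (auto intro: continuous_on_id)
    then have "isCont (\<lambda>p::real \<times> 'a. F' (fst p) * \<phi> (snd p)) (U y, y)"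
      by (simp add: continuous_on_eq_continuous_at)
    then have "\<forall>e>0. \<exists>d>0. \<forall>p. dist p (U y, y) < d \<longrightarrow> dist (F' (fst p) * \<phi> (snd p)) (F' (U y) * \<phi> y) < e"
      unfolding continuous_at_eps_delta by simp
    moreover have "0 < e / 2" using e by simp
    ultimately obtain d where d: "0 < d"
      "\<And>p. dist p (U y, y) < d \<Longrightarrow> dist (F' (fst p) * \<phi> (snd p)) (F' (U y) * \<phi> y) < e / 2" by blast
    have "\<forall>\<^sub>F n in sequentially. radius TYPE('a) n < d / 2"
      by (rule order_tendstoD[OF radius_tendsto]) (use d in auto)
    \<comment> \<open>The two coordinates contribute less than \<open>d / 2\<close> and at most
      \<open>d / 3\<close>, together less than \<open>d\<close>.\<close>
    moreover have "\<forall>\<^sub>F n in sequentially. \<forall>x. dist x y \<le> radius TYPE('a) n \<longrightarrow> \<bar>conv U n x - U y\<bar> \<le> d / 3"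
      by (rule conv_close[OF y]) (use d in auto)
    ultimately show "\<forall>\<^sub>F n in sequentially. dist (H n y) (F' (U y) * \<phi> y) < e"
    proof eventually_elim
      fix n assume n: "radius TYPE('a) n < d / 2"
        "\<forall>x. dist x y \<le> radius TYPE('a) n \<longrightarrow> \<bar>conv U n x - U y\<bar> \<le> d / 3"
      have "\<bar>H n y - F' (U y) * \<phi> y\<bar> \<le> e / 2"
        unfolding H_def
      proof (rule average_close(2)[OF molly_reflect_integrable molly_nonneg molly_reflect_integral hm])
        fix x assume "molly n (y - x) \<noteq> 0"
        then have x: "dist x y \<le> radius TYPE('a) n" using molly_support by (metis dist_commute dist_norm)
        have "dist (conv U n x, x) (U y, y) \<le> dist (conv U n x) (U y) + dist x y"
          unfolding dist_prod_def fst_conv snd_conv by (rule sqrt_sum_squares_le_sum) auto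
        also have "\<dots> < d" using n x d(1) by (force simp: dist_real_def)
        finally show "\<bar>F' (conv U n x) * \<phi> x - F' (U y) * \<phi> y\<bar> \<le> e / 2"
          using d(2) by (force simp: dist_real_def)
      qed
      then show "dist (H n y) (F' (U y) * \<phi> y) < e" using e by (simp add: dist_real_def)
    qed
  qed
  have [measurable]: "H n \<in> borel_measurable borel" for n unfolding H_def by measurable
  have I2: "(\<lambda>n. \<integral>y. G y * H n y \<partial>lborel) \<longlonglongrightarrow> (\<integral>y. G y * (F' (U y) * \<phi> y) \<partial>lborel)"
  proof (rule integral_dominated_convergence[where w = "\<lambda>y. \<bar>G y\<bar> * (C * P)"])
    show "AE y in lborel. (\<lambda>n. G y * H n y) \<longlonglongrightarrow> G y * (F' (U y) * \<phi> y)"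
    proof (intro AE_I2)
      fix y show "(\<lambda>n. G y * H n y) \<longlonglongrightarrow> G y * (F' (U y) * \<phi> y)"
        by (cases "y \<in> \<Omega>") (auto intro!: tendsto_mult Hlim simp: G_out)
    qed
    show "AE y in lborel. norm (G y * H n y) \<le> \<bar>G y\<bar> * (C * P)" for n
      using Hb by (intro AE_I2) (simp add: abs_mult mult_left_mono)
  qed (use G_int in auto)
  have "\<forall>\<^sub>F n in sequentially. (\<integral>x. F (conv U n x) * ?d x \<partial>lborel) + (\<integral>y. G y * H n y \<partial>lborel) = 0"
    using eventually_cball_subset[OF K]
  proof eventually_elim
    fix n assume n: "\<forall>x\<in>?K. cball x (radius TYPE('a) n) \<subseteq> \<Omega>"
    let ?g = "\<lambda>x. \<integral>y. G y * molly n (y - x) \<partial>lborel"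
    \<comment> \<open>Off the support both sides vanish with \<open>\<phi>\<close>; on it
      \<open>n\<close> is large enough for \<open>dconv_eq\<close>.\<close>
    have eq: "F' (conv U n x) * dconv n x * \<phi> x = F' (conv U n x) * \<phi> x * ?g x" for x
      using n dconv_eq[of x n] test_function_outside(1)[OF \<phi>, of x] by (cases "x \<in> ?K") auto
    have gi: "integrable lborel (\<lambda>x. F' (conv U n x) * \<phi> x * ?g x)"
      by (rule fubini_swap(2)[OF hm hb])
    have Fi: "integrable lborel (\<lambda>x. F (conv U n x) * ?d x)"
      by (rule Bochner_Integration.integrable_bound[OF indK[of "A * Q"]])
        (use Fd[of n] A0 Q(1) in \<open>auto simp: abs_mult\<close>)
    have "0 = (\<integral>x. F' (conv U n x) * \<phi> x * ?g x + F (conv U n x) * ?d x \<partial>lborel)"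
      using conv_chain_identity[OF F C \<phi>, of n] unfolding eq by simp
    also have "\<dots> = (\<integral>x. F' (conv U n x) * \<phi> x * ?g x \<partial>lborel) + (\<integral>x. F (conv U n x) * ?d x \<partial>lborel)"
      by (rule Bochner_Integration.integral_add[OF gi Fi])
    also have "(\<integral>x. F' (conv U n x) * \<phi> x * ?g x \<partial>lborel) = (\<integral>y. G y * H n y \<partial>lborel)"
      unfolding H_def by (rule fubini_swap(1)[OF hm hb])
    finally show "(\<integral>x. F (conv U n x) * ?d x \<partial>lborel) + (\<integral>y. G y * H n y \<partial>lborel) = 0" by simp
  qed
  then have "(\<lambda>n. (\<integral>x. F (conv U n x) * ?d x \<partial>lborel) + (\<integral>y. G y * H n y \<partial>lborel)) \<longlonglongrightarrow> 0"
    by (rule tendsto_eventually)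
  from LIMSEQ_unique[OF this tendsto_add[OF I1 I2]]
  show ?thesis by (simp add: mult_ac)
qed

end

section \<open>Sobolev functions on a bounded open set\<close>

text \<open>Representatives have arbitrary values off \<Omega>; these are set to 0 before passing to
  the whole space.\<close>

definition extend :: "'a set \<Rightarrow> ('a \<Rightarrow> real) \<Rightarrow> 'a \<Rightarrow> real" where
  "extend \<Omega> f x = (if x \<in> \<Omega> then f x else 0)"

lemma borel_measurable_lebesgue_onI:
  "f \<in> borel_measurable borel \<Longrightarrow> f \<in> borel_measurable (lebesgue_on S)"
  by (intro measurable_restrict_space1 measurable_completion) simp

lemma test_function_mult:
  assumes \<phi>: "\<phi> \<in> test_functions \<Omega>" and \<psi>: "\<psi> \<in> test_functions \<Omega>"
  shows "(\<lambda>x. \<phi> x * \<psi> x) \<in> test_functions \<Omega>"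
proof -
  have "closure {x. \<phi> x * \<psi> x \<noteq> 0} \<subseteq> closure {x. \<phi> x \<noteq> 0}" by (intro closure_mono) auto
  moreover from this have "compact (closure {x. \<phi> x * \<psi> x \<noteq> 0})"
    using \<phi> unfolding test_functions_def compact_eq_bounded_closed by (auto intro: bounded_subset)
  ultimately show ?thesis using \<phi> \<psi> by (auto simp: test_functions_def intro: Ck_mult)
qed

locale bounded_open =
  fixes \<Omega> :: "'a::euclidean_space set"
  assumes open_\<Omega>: "open \<Omega>" and bounded_\<Omega>: "bounded \<Omega>"
begin

lemma \<Omega>_lmeasurable: "\<Omega> \<in> lmeasurable"
  using bounded_\<Omega> open_\<Omega> by (rule lmeasurable_open)

lemma \<Omega>_sets: "\<Omega> \<in> sets lebesgue"
  using \<Omega>_lmeasurable by (rule fmeasurableD)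

lemma integral_extend: "(\<integral>x. extend \<Omega> f x \<partial>lebesgue) = (\<integral>x. f x \<partial>lebesgue_on \<Omega>)"
  unfolding extend_def by (rule Lebesgue_Measure.integral_restrict_UNIV[OF \<Omega>_sets])

lemma integrable_extend: "integrable lebesgue (extend \<Omega> f) \<longleftrightarrow> integrable (lebesgue_on \<Omega>) f"
  unfolding extend_def[abs_def] by (rule Lebesgue_Measure.integrable_restrict_UNIV[OF \<Omega>_sets])

lemma measurable_extend: "extend \<Omega> f \<in> borel_measurable lebesgue \<longleftrightarrow> f \<in> borel_measurable (lebesgue_on \<Omega>)"
  unfolding extend_def[abs_def] by (rule borel_measurable_if[OF \<Omega>_sets])

lemma AE_on: "(AE x in lebesgue_on \<Omega>. P x) \<longleftrightarrow> (AE x in lebesgue. x \<in> \<Omega> \<longrightarrow> P x)"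
  using \<Omega>_sets by (intro AE_restrict_space_iff) simp

lemma square_integrable_extend:
  "square_integrable lebesgue (extend \<Omega> f) \<longleftrightarrow> square_integrable (lebesgue_on \<Omega>) f"
proof -
  have "(\<lambda>x. (extend \<Omega> f x)\<^sup>2) = extend \<Omega> (\<lambda>x. (f x)\<^sup>2)" by (auto simp: extend_def)
  then show ?thesis by (simp add: square_integrable_def measurable_extend integrable_extend)
qed

text \<open>Sobolev functions are only Lebesgue measurable, while the mollification works with Borel
  functions. The modification is 0 at every point off \<Omega>, not just almost everywhere, as
  \<open>G_out\<close> demands.\<close>

lemma borel_version:
  assumes "f \<in> borel_measurable (lebesgue_on \<Omega>)"
  obtains f' where "f' \<in> borel_measurable borel" "\<And>x. x \<notin> \<Omega> \<Longrightarrow> f' x = 0" "AE x in lborel. f' x = extend \<Omega> f x"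
proof -
  obtain g where g: "g \<in> borel_measurable lborel" "AE x in lborel. extend \<Omega> f x = g x"
    using completion_ex_borel_measurable_real[of "extend \<Omega> f" lborel] assms measurable_extend by blast
  have [measurable]: "g \<in> borel_measurable borel" "\<Omega> \<in> sets borel" using g(1) open_\<Omega> by auto
  have "AE x in lborel. g x * indicator \<Omega> x = extend \<Omega> f x"
    using g(2) by eventually_elim (auto simp: extend_def indicator_def)
  then show ?thesis using that[of "\<lambda>x. g x * indicator \<Omega> x"] by simp
qed

lemma
  assumes f': "f' \<in> borel_measurable borel" "AE x in lborel. f' x = extend \<Omega> f x"
    and f: "f \<in> borel_measurable (lebesgue_on \<Omega>)"
  shows integral_on_borel: "(\<integral>x. f x \<partial>lebesgue_on \<Omega>) = (\<integral>x. f' x \<partial>lborel)"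
    and integrable_on_borel: "integrable (lebesgue_on \<Omega>) f \<longleftrightarrow> integrable lborel f'"
proof -
  have m: "f' \<in> borel_measurable lborel" "f' \<in> borel_measurable lebesgue" "extend \<Omega> f \<in> borel_measurable lebesgue"
    using f' f measurable_extend by (auto intro: measurable_completion)
  have ae: "AE x in lebesgue. extend \<Omega> f x = f' x"
    using AE_completion[OF f'(2)] by eventually_elim simp
  show "(\<integral>x. f x \<partial>lebesgue_on \<Omega>) = (\<integral>x. f' x \<partial>lborel)"
    unfolding integral_extend[symmetric] integral_completion[OF m(1), symmetric]
    by (rule integral_cong_AE[OF m(3,2) ae])
  show "integrable (lebesgue_on \<Omega>) f \<longleftrightarrow> integrable lborel f'"
    unfolding integrable_extend[symmetric] integrable_completion[OF m(1), symmetric]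
    by (rule integrable_cong_AE[OF m(3,2) ae])
qed

text \<open>\<Omega> has finite measure, so the constant 1 is square integrable.\<close>

lemma L2_imp_integrable:
  assumes "square_integrable (lebesgue_on \<Omega>) f"
  shows "integrable (lebesgue_on \<Omega>) f"
proof -
  interpret finite_measure "lebesgue_on \<Omega>"
    by (rule finite_measure_lebesgue_on[OF \<Omega>_lmeasurable])
  have "square_integrable (lebesgue_on \<Omega>) (\<lambda>x. 1)" by (simp add: square_integrable_def)
  from square_integrable_mult[OF assms this] show ?thesis by simp
qed

lemma integrable_mult_bounded:
  fixes w \<phi> :: "'a \<Rightarrow> real"
  assumes w: "integrable (lebesgue_on \<Omega>) w" and \<phi>: "\<phi> \<in> borel_measurable (lebesgue_on \<Omega>)" "\<And>x. \<bar>\<phi> x\<bar> \<le> P"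
  shows "integrable (lebesgue_on \<Omega>) (\<lambda>x. w x * \<phi> x)"
proof (rule Bochner_Integration.integrable_bound)
  show "integrable (lebesgue_on \<Omega>) (\<lambda>x. w x * P)" using w by simp
  show "AE x in lebesgue_on \<Omega>. norm (w x * \<phi> x) \<le> norm (w x * P)"
  proof (intro AE_I2)
    fix x show "norm (w x * \<phi> x) \<le> norm (w x * P)"
      using \<phi>(2)[of x] by (simp add: abs_mult mult_left_mono)
  qed
qed (use w \<phi> in measurable)

lemma integrable_mult_test:
  assumes "integrable (lebesgue_on \<Omega>) w" "\<phi> \<in> test_functions \<Omega>'"
  shows "integrable (lebesgue_on \<Omega>) (\<lambda>x. w x * \<phi> x)"
  by (metis assms integrable_mult_bounded borel_measurable_lebesgue_onI test_function_borel test_function_bounded)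

lemma integrable_mult_test_derivative:
  assumes "integrable (lebesgue_on \<Omega>) w" "\<phi> \<in> test_functions \<Omega>'" "i \<in> Basis"
  shows "integrable (lebesgue_on \<Omega>) (\<lambda>x. w x * frechet_derivative \<phi> (at x) i)"
proof -
  obtain M where "\<And>x. \<bar>frechet_derivative \<phi> (at x) i\<bar> \<le> M" using test_function_derivative_bounded[OF assms(2,3)] by blast
  then show ?thesis
    by (intro integrable_mult_bounded assms borel_measurable_lebesgue_onI test_function_derivative_borel[OF assms(2,3)])
qed

lemma fundamental_lemma_on:
  assumes w: "integrable (lebesgue_on \<Omega>) w"
    and 0: "\<And>\<phi>. \<phi> \<in> test_functions \<Omega> \<Longrightarrow> (\<integral>x. w x * \<phi> x \<partial>lebesgue_on \<Omega>) = 0"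
  shows "AE x in lebesgue_on \<Omega>. w x = 0"
proof -
  have wm: "w \<in> borel_measurable (lebesgue_on \<Omega>)" using w by auto
  obtain w' where w': "w' \<in> borel_measurable borel" "\<And>x. x \<notin> \<Omega> \<Longrightarrow> w' x = 0" "AE x in lborel. w' x = extend \<Omega> w x"
    using borel_version[OF wm] by blast
  have "AE x in lborel. x \<in> \<Omega> \<longrightarrow> w' x = 0"
  proof (rule fundamental_lemma[OF open_\<Omega>])
    show "integrable lborel w'" using integrable_on_borel[OF w'(1,3) wm] w by simp
    fix \<phi> assume \<phi>: "\<phi> \<in> test_functions \<Omega>"
    have "(\<integral>x. w x * \<phi> x \<partial>lebesgue_on \<Omega>) = (\<integral>x. w' x * \<phi> x \<partial>lborel)"
    proof (rule integral_on_borel)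
      show "(\<lambda>x. w' x * \<phi> x) \<in> borel_measurable borel"
        using w'(1) test_function_borel[OF \<phi>] by measurable
      show "AE x in lborel. w' x * \<phi> x = extend \<Omega> (\<lambda>x. w x * \<phi> x) x"
        using w'(3) by eventually_elim (auto simp: extend_def)
      show "(\<lambda>x. w x * \<phi> x) \<in> borel_measurable (lebesgue_on \<Omega>)"
        using integrable_mult_test[OF w \<phi>] by auto
    qed
    then show "(\<integral>x. w' x * \<phi> x \<partial>lborel) = 0" using 0[OF \<phi>] by simp
  qed
  then have "AE x in lebesgue. x \<in> \<Omega> \<longrightarrow> w' x = 0" by (rule AE_completion)
  moreover have "AE x in lebesgue. w' x = extend \<Omega> w x" using w'(3) by (rule AE_completion)
  ultimately show ?thesis unfolding AE_on by eventually_elim (auto simp: extend_def)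
qed

section \<open>Uniqueness and linearity of weak gradients\<close>

lemma weak_gradient_component:
  assumes "is_weak_gradient \<Omega> u g" "i \<in> Basis"
  shows "square_integrable (lebesgue_on \<Omega>) (\<lambda>x. g x \<bullet> i)"
proof -
  have g: "g \<in> borel_measurable (lebesgue_on \<Omega>)" "integrable (lebesgue_on \<Omega>) (\<lambda>x. (norm (g x))\<^sup>2)"
    using assms by (auto simp: is_weak_gradient_def)
  have "square_integrable (lebesgue_on \<Omega>) (\<lambda>x. norm (g x))"
    using g by (auto simp: square_integrable_def)
  then show ?thesis
  proof (rule square_integrable_bound)
    show "(\<lambda>x. g x \<bullet> i) \<in> borel_measurable (lebesgue_on \<Omega>)"
      using g(1) by (intro borel_measurable_inner) auto
    show "AE x in lebesgue_on \<Omega>. \<bar>g x \<bullet> i\<bar> \<le> \<bar>norm (g x)\<bar>"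
      using Basis_le_norm[OF assms(2)] by (intro AE_I2) simp
  qed
qed

text \<open>\<open>weak_grad\<close> is a choice. Its linearity and its chain rule are obtained by
  exhibiting some weak gradient and comparing it with the chosen one; the fundamental lemma does
  this for each component.\<close>

lemma weak_gradient_unique:
  assumes g: "is_weak_gradient \<Omega> u g" and h: "is_weak_gradient \<Omega> u h"
  shows "AE x in lebesgue_on \<Omega>. g x = h x"
proof -
  have "AE x in lebesgue_on \<Omega>. (g x - h x) \<bullet> i = 0" if i: "i \<in> Basis" for i
  proof (rule fundamental_lemma_on)
    note I = L2_imp_integrable[OF weak_gradient_component[OF g i]] L2_imp_integrable[OF weak_gradient_component[OF h i]]
    show "integrable (lebesgue_on \<Omega>) (\<lambda>x. (g x - h x) \<bullet> i)"
      using I by (simp add: inner_diff_left)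
    fix \<phi> assume \<phi>: "\<phi> \<in> test_functions \<Omega>"
    have "(\<integral>x. (g x \<bullet> i) * \<phi> x \<partial>lebesgue_on \<Omega>) = (\<integral>x. (h x \<bullet> i) * \<phi> x \<partial>lebesgue_on \<Omega>)"
    proof -
      have "(\<integral>x. u x * frechet_derivative \<phi> (at x) i \<partial>lebesgue_on \<Omega>) = - (\<integral>x. (g x \<bullet> i) * \<phi> x \<partial>lebesgue_on \<Omega>)"
        "(\<integral>x. u x * frechet_derivative \<phi> (at x) i \<partial>lebesgue_on \<Omega>) = - (\<integral>x. (h x \<bullet> i) * \<phi> x \<partial>lebesgue_on \<Omega>)"
        using g h \<phi> i unfolding is_weak_gradient_def by blast+
      then show ?thesis by linarith
    qed
    moreover have "(\<integral>x. (g x - h x) \<bullet> i * \<phi> x \<partial>lebesgue_on \<Omega>) =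
        (\<integral>x. (g x \<bullet> i) * \<phi> x \<partial>lebesgue_on \<Omega>) - (\<integral>x. (h x \<bullet> i) * \<phi> x \<partial>lebesgue_on \<Omega>)"
      unfolding inner_diff_left left_diff_distrib
      by (rule Bochner_Integration.integral_diff) (intro integrable_mult_test[OF _ \<phi>] I)+
    ultimately show "(\<integral>x. (g x - h x) \<bullet> i * \<phi> x \<partial>lebesgue_on \<Omega>) = 0" by simp
  qed
  then have "AE x in lebesgue_on \<Omega>. \<forall>i\<in>Basis. (g x - h x) \<bullet> i = 0"
    by (intro AE_finite_allI) auto
  then show ?thesis
    by eventually_elim (metis euclidean_all_zero_iff right_minus_eq)
qed

lemma weak_grad_works: "u \<in> H1 \<Omega> \<Longrightarrow> is_weak_gradient \<Omega> u (weak_grad \<Omega> u)"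
  using someI_ex[of "is_weak_gradient \<Omega> u"] by (simp add: H1_def weak_grad_def)

lemma H1_L2: "u \<in> H1 \<Omega> \<Longrightarrow> square_integrable (lebesgue_on \<Omega>) u"
  by (simp add: H1_def L2_iff)

lemma H1I: "square_integrable (lebesgue_on \<Omega>) u \<Longrightarrow> is_weak_gradient \<Omega> u g \<Longrightarrow> u \<in> H1 \<Omega>"
  by (auto simp: H1_def L2_iff)

lemma weak_grad_AE:
  assumes "square_integrable (lebesgue_on \<Omega>) u" "is_weak_gradient \<Omega> u g"
  shows "AE x in lebesgue_on \<Omega>. weak_grad \<Omega> u x = g x"
  using weak_gradient_unique weak_grad_works H1I assms by blast

lemma weak_grad_measurable: "u \<in> H1 \<Omega> \<Longrightarrow> weak_grad \<Omega> u \<in> borel_measurable (lebesgue_on \<Omega>)"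
  using weak_grad_works by (auto simp: is_weak_gradient_def)

lemma weak_grad_norm_square: "u \<in> H1 \<Omega> \<Longrightarrow> integrable (lebesgue_on \<Omega>) (\<lambda>x. (norm (weak_grad \<Omega> u x))\<^sup>2)"
  using weak_grad_works by (auto simp: is_weak_gradient_def)

lemma weak_grad_inner_integrable:
  assumes "u \<in> H1 \<Omega>" "v \<in> H1 \<Omega>"
  shows "integrable (lebesgue_on \<Omega>) (\<lambda>x. weak_grad \<Omega> u x \<bullet> weak_grad \<Omega> v x)"
proof (rule Bochner_Integration.integrable_bound)
  note [measurable] = weak_grad_measurable[OF assms(1)] weak_grad_measurable[OF assms(2)]
  have "square_integrable (lebesgue_on \<Omega>) (\<lambda>x. norm (weak_grad \<Omega> u x))"
    "square_integrable (lebesgue_on \<Omega>) (\<lambda>x. norm (weak_grad \<Omega> v x))"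
    using weak_grad_norm_square[OF assms(1)] weak_grad_norm_square[OF assms(2)]
    by (simp_all add: square_integrable_def)
  then show "integrable (lebesgue_on \<Omega>) (\<lambda>x. norm (weak_grad \<Omega> u x) * norm (weak_grad \<Omega> v x))"
    by (rule square_integrable_mult)
  show "AE x in lebesgue_on \<Omega>. norm (weak_grad \<Omega> u x \<bullet> weak_grad \<Omega> v x) \<le>
      norm (norm (weak_grad \<Omega> u x) * norm (weak_grad \<Omega> v x))"
    using Cauchy_Schwarz_ineq2 by (intro AE_I2) simp
  show "(\<lambda>x. weak_grad \<Omega> u x \<bullet> weak_grad \<Omega> v x) \<in> borel_measurable (lebesgue_on \<Omega>)" by measurable
qed

lemma is_weak_gradient_lin:
  assumes u: "u \<in> H1 \<Omega>" and v: "v \<in> H1 \<Omega>"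
  shows "is_weak_gradient \<Omega> (\<lambda>x. u x - c * v x) (\<lambda>x. weak_grad \<Omega> u x - c *\<^sub>R weak_grad \<Omega> v x)"
  unfolding is_weak_gradient_def
proof (intro conjI ballI)
  note [measurable] = weak_grad_measurable[OF u] weak_grad_measurable[OF v]
  let ?g = "weak_grad \<Omega> u" and ?h = "weak_grad \<Omega> v"
  show m: "(\<lambda>x. ?g x - c *\<^sub>R ?h x) \<in> borel_measurable (lebesgue_on \<Omega>)" by measurable
  have "(norm (?g x - c *\<^sub>R ?h x))\<^sup>2 = ?g x \<bullet> ?g x - 2 * c * (?g x \<bullet> ?h x) + c\<^sup>2 * (?h x \<bullet> ?h x)" for x
    unfolding power2_norm_eq_inner
    by (simp add: inner_diff_left inner_diff_right inner_commute power2_eq_square algebra_simps)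
  then show "integrable (lebesgue_on \<Omega>) (\<lambda>x. (norm (?g x - c *\<^sub>R ?h x))\<^sup>2)"
    using weak_grad_inner_integrable u v by simp
  fix \<phi> and i :: 'a assume \<phi>: "\<phi> \<in> test_functions \<Omega>" and i: "i \<in> Basis"
  let ?d = "\<lambda>x. frechet_derivative \<phi> (at x) i"
  note gu = weak_grad_works[OF u] and gv = weak_grad_works[OF v]
  have "(\<integral>x. (u x - c * v x) * ?d x \<partial>lebesgue_on \<Omega>) =
      (\<integral>x. u x * ?d x \<partial>lebesgue_on \<Omega>) - c * (\<integral>x. v x * ?d x \<partial>lebesgue_on \<Omega>)"
    using integrable_mult_test_derivative[OF L2_imp_integrable[OF H1_L2[OF u]] \<phi> i]
      integrable_mult_test_derivative[OF L2_imp_integrable[OF H1_L2[OF v]] \<phi> i]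
    by (simp add: left_diff_distrib mult.assoc)
  also have "\<dots> = - (\<integral>x. (?g x \<bullet> i) * \<phi> x \<partial>lebesgue_on \<Omega>) + c * (\<integral>x. (?h x \<bullet> i) * \<phi> x \<partial>lebesgue_on \<Omega>)"
    using gu gv \<phi> i by (simp add: is_weak_gradient_def)
  also have "\<dots> = - (\<integral>x. ((?g x - c *\<^sub>R ?h x) \<bullet> i) * \<phi> x \<partial>lebesgue_on \<Omega>)"
    using integrable_mult_test[OF L2_imp_integrable[OF weak_gradient_component[OF gu i]] \<phi>]
      integrable_mult_test[OF L2_imp_integrable[OF weak_gradient_component[OF gv i]] \<phi>]
    by (simp add: inner_diff_left left_diff_distrib mult.assoc)
  finally show "(\<integral>x. (u x - c * v x) * ?d x \<partial>lebesgue_on \<Omega>) =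
      - (\<integral>x. ((?g x - c *\<^sub>R ?h x) \<bullet> i) * \<phi> x \<partial>lebesgue_on \<Omega>)" .
qed

lemma square_integrable_lin:
  "square_integrable M f \<Longrightarrow> square_integrable M g \<Longrightarrow> square_integrable M (\<lambda>x. f x - c * g x)"
  by (intro square_integrable_diff square_integrable_cmult)

lemma H1_lin: "u \<in> H1 \<Omega> \<Longrightarrow> v \<in> H1 \<Omega> \<Longrightarrow> (\<lambda>x. u x - c * v x) \<in> H1 \<Omega>"
  by (rule H1I[OF square_integrable_lin[OF H1_L2 H1_L2] is_weak_gradient_lin])

lemma weak_grad_lin:
  "u \<in> H1 \<Omega> \<Longrightarrow> v \<in> H1 \<Omega> \<Longrightarrow>
    AE x in lebesgue_on \<Omega>. weak_grad \<Omega> (\<lambda>x. u x - c * v x) x = weak_grad \<Omega> u x - c *\<^sub>R weak_grad \<Omega> v x"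
  by (rule weak_grad_AE[OF square_integrable_lin[OF H1_L2 H1_L2] is_weak_gradient_lin])

text \<open>A continuous function on an open set has a Borel zero extension, so \<open>u\<close>
  itself enters the locale \<open>chain_rule\<close> and can be composed with \<open>F\<close>
  pointwise. Only the gradient component has to be replaced by a Borel version.\<close>

lemma H1_chain_rule:
  assumes u: "u \<in> H1 \<Omega>" and cont: "continuous_on \<Omega> u" and M: "\<And>x. x \<in> \<Omega> \<Longrightarrow> \<bar>u x\<bar> \<le> M"
    and F: "\<And>z. (F has_real_derivative F' z) (at z)" and C: "\<And>z. \<bar>F' z\<bar> \<le> 1" and F': "continuous_on UNIV F'"
  shows "is_weak_gradient \<Omega> (\<lambda>x. F (u x)) (\<lambda>x. F' (u x) *\<^sub>R weak_grad \<Omega> u x)"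
  unfolding is_weak_gradient_def
proof (intro conjI ballI)
  let ?g = "weak_grad \<Omega> u"
  note gu = weak_grad_works[OF u]
  note [measurable] = weak_grad_measurable[OF u]
  have [measurable]: "u \<in> borel_measurable (lebesgue_on \<Omega>)" using H1_L2[OF u] by (simp add: square_integrable_def)
  have [measurable]: "F' \<in> borel_measurable borel" using F' by (intro borel_measurable_continuous_onI)
  have [measurable]: "F \<in> borel_measurable borel"
    using F by (intro borel_measurable_continuous_onI continuous_at_imp_continuous_on) (blast intro: DERIV_isCont)
  have [measurable]: "\<Omega> \<in> sets borel" using open_\<Omega> by simp
  show "(\<lambda>x. F' (u x) *\<^sub>R ?g x) \<in> borel_measurable (lebesgue_on \<Omega>)" by measurable
  show "integrable (lebesgue_on \<Omega>) (\<lambda>x. (norm (F' (u x) *\<^sub>R ?g x))\<^sup>2)"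
  proof (rule Bochner_Integration.integrable_bound[OF weak_grad_norm_square[OF u]])
    show "AE x in lebesgue_on \<Omega>. norm ((norm (F' (u x) *\<^sub>R ?g x))\<^sup>2) \<le> norm ((norm (?g x))\<^sup>2)"
    proof (intro AE_I2)
      fix x
      have "norm (F' (u x) *\<^sub>R ?g x) \<le> norm (?g x)" using C[of "u x"] by (simp add: mult_left_le_one_le)
      then show "norm ((norm (F' (u x) *\<^sub>R ?g x))\<^sup>2) \<le> norm ((norm (?g x))\<^sup>2)" by simp
    qed
  qed measurable
  fix \<phi> and i :: 'a assume \<phi>: "\<phi> \<in> test_functions \<Omega>" and i: "i \<in> Basis"
  note gi = weak_gradient_component[OF gu i]
  have gim: "(\<lambda>x. ?g x \<bullet> i) \<in> borel_measurable (lebesgue_on \<Omega>)" using gi by (simp add: square_integrable_def)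
  obtain G where G: "G \<in> borel_measurable borel" "\<And>x. x \<notin> \<Omega> \<Longrightarrow> G x = 0" "AE x in lborel. G x = extend \<Omega> (\<lambda>x. ?g x \<bullet> i) x"
    using borel_version[OF gim] by blast
  note [measurable] = G(1)
  let ?U = "extend \<Omega> u"
  have Um: "?U \<in> borel_measurable borel"
  proof -
    have "(\<lambda>x. indicator \<Omega> x *\<^sub>R u x) \<in> borel_measurable borel"
      using cont by (intro borel_measurable_continuous_on_indicator) auto
    moreover have "?U = (\<lambda>x. indicator \<Omega> x *\<^sub>R u x)" by (auto simp: extend_def indicator_def)
    ultimately show ?thesis by simp
  qed
  note [measurable] = Um
  have test_m: "\<psi> \<in> borel_measurable (lebesgue_on \<Omega>)" "(\<lambda>x. frechet_derivative \<psi> (at x) i) \<in> borel_measurable (lebesgue_on \<Omega>)"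
    "\<psi> \<in> borel_measurable borel" "(\<lambda>x. frechet_derivative \<psi> (at x) i) \<in> borel_measurable borel"
    if "\<psi> \<in> test_functions \<Omega>" for \<psi>
    using test_function_borel[OF that] test_function_derivative_borel[OF that i] borel_measurable_lebesgue_onI by auto
  interpret chain_rule \<Omega> ?U G i "max 0 M"
  proof
    show "open \<Omega>" by (rule open_\<Omega>)
    show "\<bar>?U x\<bar> \<le> max 0 M" for x using M[of x] by (auto simp: extend_def)
    show "integrable lborel ?U"
      using integrable_on_borel[OF Um, of u] L2_imp_integrable[OF H1_L2[OF u]] by simp
    show "isCont ?U y" if "y \<in> \<Omega>" for y
    proof -
      have "continuous_on \<Omega> ?U" using cont by (rule continuous_on_eq) (simp add: extend_def)
      then show ?thesis using that open_\<Omega> by (simp add: continuous_on_eq_continuous_at)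
    qed
    show "integrable lborel G"
      using integrable_on_borel[OF G(1,3) gim] L2_imp_integrable[OF gi] by simp
    show "(\<integral>x. ?U x * frechet_derivative \<psi> (at x) i \<partial>lborel) = - (\<integral>x. G x * \<psi> x \<partial>lborel)"
      if \<psi>: "\<psi> \<in> test_functions \<Omega>" for \<psi>
    proof -
      note [measurable] = test_m[OF \<psi>]
      have "(\<integral>x. u x * frechet_derivative \<psi> (at x) i \<partial>lebesgue_on \<Omega>) = (\<integral>x. ?U x * frechet_derivative \<psi> (at x) i \<partial>lborel)"
      proof (rule integral_on_borel)
        show "AE x in lborel. ?U x * frechet_derivative \<psi> (at x) i = extend \<Omega> (\<lambda>x. u x * frechet_derivative \<psi> (at x) i) x"
          by (simp add: extend_def)
      qed measurable
      moreover have "(\<integral>x. (?g x \<bullet> i) * \<psi> x \<partial>lebesgue_on \<Omega>) = (\<integral>x. G x * \<psi> x \<partial>lborel)"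
      proof (rule integral_on_borel)
        show "AE x in lborel. G x * \<psi> x = extend \<Omega> (\<lambda>x. (?g x \<bullet> i) * \<psi> x) x"
          using G(3) by eventually_elim (simp add: extend_def)
      qed measurable
      ultimately show ?thesis using gu \<psi> i by (simp add: is_weak_gradient_def)
    qed
  qed (use Um G i in auto)
  note [measurable] = test_m[OF \<phi>]
  \<comment> \<open>Off \<Omega> the composition takes the value \<open>F 0\<close>, which may be
    different from 0; the test function and its derivative remove it.\<close>
  have out: "\<phi> x = 0" "frechet_derivative \<phi> (at x) i = 0" if "x \<notin> \<Omega>" for x
  proof -
    have "x \<notin> closure {x. \<phi> x \<noteq> 0}" using \<phi> that by (auto simp: test_functions_def)
    from test_function_outside[OF \<phi> this] show "\<phi> x = 0" "frechet_derivative \<phi> (at x) i = 0" by simp_all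
  qed
  have "(\<integral>x. F (u x) * frechet_derivative \<phi> (at x) i \<partial>lebesgue_on \<Omega>) = (\<integral>x. F (?U x) * frechet_derivative \<phi> (at x) i \<partial>lborel)"
  proof (rule integral_on_borel)
    show "AE x in lborel. F (?U x) * frechet_derivative \<phi> (at x) i = extend \<Omega> (\<lambda>x. F (u x) * frechet_derivative \<phi> (at x) i) x"
      by (simp add: extend_def out)
  qed measurable
  moreover have "(\<integral>x. (F' (u x) *\<^sub>R ?g x) \<bullet> i * \<phi> x \<partial>lebesgue_on \<Omega>) = (\<integral>x. F' (?U x) * G x * \<phi> x \<partial>lborel)"
  proof (rule integral_on_borel)
    show "AE x in lborel. F' (?U x) * G x * \<phi> x = extend \<Omega> (\<lambda>x. (F' (u x) *\<^sub>R ?g x) \<bullet> i * \<phi> x) x"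
      using G(3) by eventually_elim (simp add: extend_def)
  qed measurable
  ultimately show "(\<integral>x. F (u x) * frechet_derivative \<phi> (at x) i \<partial>lebesgue_on \<Omega>) =
      - (\<integral>x. (F' (u x) *\<^sub>R ?g x) \<bullet> i * \<phi> x \<partial>lebesgue_on \<Omega>)"
    using chain_rule_weak[OF F C F' \<phi>] by simp
qed

section \<open>Test functions as Sobolev functions\<close>

lemma test_function_square_integrable:
  assumes \<phi>: "\<phi> \<in> test_functions \<Omega>"
  shows "square_integrable (lebesgue_on \<Omega>) \<phi>"
proof -
  interpret finite_measure "lebesgue_on \<Omega>"
    by (rule finite_measure_lebesgue_on[OF \<Omega>_lmeasurable])
  obtain P where P: "0 \<le> P" "\<And>x. \<bar>\<phi> x\<bar> \<le> P" using test_function_bounded[OF \<phi>] by blast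
  have "square_integrable (lebesgue_on \<Omega>) (\<lambda>x. P)" by (simp add: square_integrable_def)
  then show ?thesis
    by (rule square_integrable_bound) (use P borel_measurable_lebesgue_onI[OF test_function_borel[OF \<phi>]] in auto)
qed

text \<open>The product of two test functions is a test function, and its derivative has integral 0;
  the product rule then reads as integration by parts.\<close>

lemma test_function_weak_gradient:
  assumes \<phi>: "\<phi> \<in> test_functions \<Omega>"
  shows "is_weak_gradient \<Omega> \<phi> (\<lambda>x. \<Sum>i\<in>Basis. frechet_derivative \<phi> (at x) i *\<^sub>R i)" (is "is_weak_gradient \<Omega> \<phi> ?g")
  unfolding is_weak_gradient_def
proof (intro conjI ballI)
  interpret finite_measure "lebesgue_on \<Omega>"
    by (rule finite_measure_lebesgue_on[OF \<Omega>_lmeasurable])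
  have dm: "(\<lambda>x. frechet_derivative \<phi> (at x) i) \<in> borel_measurable (lebesgue_on \<Omega>)" if "i \<in> Basis" for i
    by (rule borel_measurable_lebesgue_onI[OF test_function_derivative_borel[OF \<phi> that]])
  show "?g \<in> borel_measurable (lebesgue_on \<Omega>)"
    by (intro borel_measurable_sum borel_measurable_scaleR dm) auto
  have "(norm (?g x))\<^sup>2 = (\<Sum>i\<in>Basis. (frechet_derivative \<phi> (at x) i)\<^sup>2)" for x
    unfolding power2_norm_eq_inner euclidean_inner[of "?g x" "?g x"]
    by (simp add: inner_sum_left_Basis power2_eq_square)
  moreover have "integrable (lebesgue_on \<Omega>) (\<lambda>x. \<Sum>i\<in>Basis. (frechet_derivative \<phi> (at x) i)\<^sup>2)"
  proof (rule Bochner_Integration.integrable_sum)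
    fix i :: 'a assume i: "i \<in> Basis"
    obtain P where P: "0 \<le> P" "\<And>x. \<bar>frechet_derivative \<phi> (at x) i\<bar> \<le> P" using test_function_derivative_bounded[OF \<phi> i] by blast
    have "square_integrable (lebesgue_on \<Omega>) (\<lambda>x. P)" by (simp add: square_integrable_def)
    then have "square_integrable (lebesgue_on \<Omega>) (\<lambda>x. frechet_derivative \<phi> (at x) i)"
      by (rule square_integrable_bound) (use P dm[OF i] in auto)
    then show "integrable (lebesgue_on \<Omega>) (\<lambda>x. (frechet_derivative \<phi> (at x) i)\<^sup>2)"
      by (simp add: square_integrable_def)
  qed
  ultimately show "integrable (lebesgue_on \<Omega>) (\<lambda>x. (norm (?g x))\<^sup>2)" by simp
  fix \<psi> and i :: 'a assume \<psi>: "\<psi> \<in> test_functions \<Omega>" and i: "i \<in> Basis"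
  let ?p = "\<lambda>x. \<phi> x * frechet_derivative \<psi> (at x) i + frechet_derivative \<phi> (at x) i * \<psi> x"
  have der: "frechet_derivative (\<lambda>x. \<phi> x * \<psi> x) (at x) i = ?p x" for x
    by (subst frechet_derivative_eqI[OF has_derivative_mult[OF test_function_derivative[OF \<phi>] test_function_derivative[OF \<psi>]]]) simp
  have zero: "(\<integral>x. ?p x \<partial>lborel) = 0"
    using integral_test_function_derivative[OF test_function_mult[OF \<phi> \<psi>] i] by (simp add: der)
  have out: "?p x = 0" if "x \<notin> \<Omega>" for x
  proof -
    have "x \<notin> closure {x. \<phi> x \<noteq> 0}" "x \<notin> closure {x. \<psi> x \<noteq> 0}" using \<phi> \<psi> that by (auto simp: test_functions_def)
    then have "\<phi> x = 0" "\<psi> x = 0"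
      using test_function_outside(1)[OF \<phi>, of x] test_function_outside(1)[OF \<psi>, of x] by blast+
    then show ?thesis by simp
  qed
  note [measurable] = test_function_borel[OF \<phi>] test_function_borel[OF \<psi>]
    test_function_derivative_borel[OF \<phi> i] test_function_derivative_borel[OF \<psi> i]
  have pm: "?p \<in> borel_measurable borel" by measurable
  have "(\<integral>x. ?p x \<partial>lebesgue_on \<Omega>) = (\<integral>x. ?p x \<partial>lborel)"
    by (rule integral_on_borel[OF pm _ borel_measurable_lebesgue_onI[OF pm]]) (use out in \<open>auto simp: extend_def\<close>)
  moreover have "(\<integral>x. ?p x \<partial>lebesgue_on \<Omega>) = (\<integral>x. \<phi> x * frechet_derivative \<psi> (at x) i \<partial>lebesgue_on \<Omega>) +
      (\<integral>x. frechet_derivative \<phi> (at x) i * \<psi> x \<partial>lebesgue_on \<Omega>)"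
  proof (rule Bochner_Integration.integral_add)
    note L = L2_imp_integrable[OF test_function_square_integrable]
    show "integrable (lebesgue_on \<Omega>) (\<lambda>x. \<phi> x * frechet_derivative \<psi> (at x) i)"
      by (rule integrable_mult_test_derivative[OF L[OF \<phi>] \<psi> i])
    show "integrable (lebesgue_on \<Omega>) (\<lambda>x. frechet_derivative \<phi> (at x) i * \<psi> x)"
      using integrable_mult_test_derivative[OF L[OF \<psi>] \<phi> i] by (simp add: mult.commute)
  qed
  ultimately show "(\<integral>x. \<phi> x * frechet_derivative \<psi> (at x) i \<partial>lebesgue_on \<Omega>) = - (\<integral>x. (?g x \<bullet> i) * \<psi> x \<partial>lebesgue_on \<Omega>)"
    using zero i by (simp add: inner_sum_left_Basis)
qed

lemma test_function_H1: "\<phi> \<in> test_functions \<Omega> \<Longrightarrow> \<phi> \<in> H1 \<Omega>"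
  by (rule H1I[OF test_function_square_integrable test_function_weak_gradient])

end

section \<open>Smooth cut-offs\<close>

text \<open>Above \<open>M\<close> the excess \<open>r = s - M\<close> is compressed to
  \<open>r / (1 + r / e)\<close>, which stays below \<open>e\<close> and has slope 1 at
  \<open>r = 0\<close>. The branches therefore join continuously differentiably, and every slope
  lies between 0 and 1.\<close>

definition squash :: "real \<Rightarrow> real \<Rightarrow> real \<Rightarrow> real" where
  "squash M e s = (if s \<le> M then s else M + (s - M) / (1 + (s - M) / e))"

text \<open>The maximum merges the two branches, so that continuity can be read off the
  formula.\<close>

definition squash' :: "real \<Rightarrow> real \<Rightarrow> real \<Rightarrow> real" where
  "squash' M e s = (1 / (1 + max 0 (s - M) / e))\<^sup>2"

lemma squash_eq: "s \<le> M \<Longrightarrow> squash M e s = s" by (simp add: squash_def)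

lemma squash_denominator: "0 < e \<Longrightarrow> 0 < 1 + max 0 (s - M) / (e::real)"
  by (intro add_pos_nonneg) auto

lemma squash_le: "0 < e \<Longrightarrow> squash M e s \<le> M + e"
proof (cases "s \<le> M")
  case False
  assume e: "0 < e"
  have "s - M \<le> e * (1 + (s - M) / e)" using e by (simp add: distrib_left)
  then have "(s - M) / (1 + (s - M) / e) \<le> e"
    using squash_denominator[OF e, of s M] False by (simp add: pos_divide_le_eq)
  then show ?thesis using False by (simp add: squash_def)
qed (simp add: squash_def)

lemma continuous_squash': "0 < e \<Longrightarrow> continuous_on UNIV (squash' M e)"
proof -
  assume e: "0 < e"
  have "1 + max 0 (s - M) / e \<noteq> 0" for s using squash_denominator[OF e, of s M] by simp
  then show ?thesis unfolding squash'_def[abs_def] using e by (intro continuous_intros) auto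
qed

lemma abs_squash'_le: "0 < e \<Longrightarrow> \<bar>squash' M e s\<bar> \<le> 1"
proof -
  assume e: "0 < e"
  have "0 \<le> 1 / (1 + max 0 (s - M) / e)" "1 / (1 + max 0 (s - M) / e) \<le> 1"
    using squash_denominator[OF e, of s M] e by (auto simp: divide_le_eq_1)
  then show ?thesis by (simp add: squash'_def power_le_one)
qed

lemma squash_deriv:
  assumes e: "0 < e"
  shows "(squash M e has_real_derivative squash' M e s) (at s)"
proof (cases s M rule: linorder_cases)
  case less
  have "((\<lambda>t. t) has_real_derivative 1) (at s)" by simp
  then have "(squash M e has_real_derivative 1) (at s)"
    by (rule has_field_derivative_transform_within_open[of _ _ _ "{..<M}"]) (use less in \<open>auto simp: squash_def\<close>)
  then show ?thesis using less by (simp add: squash'_def)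
next
  case greater
  have p: "1 + (s - M) / e \<noteq> 0" using squash_denominator[OF e, of s M] greater by simp
  have "((\<lambda>t. M + (t - M) / (1 + (t - M) / e)) has_real_derivative
      (1 * (1 + (s - M) / e) - (s - M) * (1 / e)) / ((1 + (s - M) / e) * (1 + (s - M) / e))) (at s)"
    using p e by (auto intro!: derivative_eq_intros)
  also have "(1 * (1 + (s - M) / e) - (s - M) * (1 / e)) / ((1 + (s - M) / e) * (1 + (s - M) / e)) = squash' M e s"
    using greater by (simp add: squash'_def power2_eq_square)
  finally show ?thesis
    by (rule has_field_derivative_transform_within_open[of _ _ _ "{M<..}"]) (use greater in \<open>auto simp: squash_def\<close>)
next
  case equal
  \<comment> \<open>On both sides of \<open>M\<close> the difference quotient at \<open>M\<close> is
    this one continuous function.\<close>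
  let ?k = "\<lambda>y. 1 / (1 + max 0 (y - M) / e)"
  have "isCont ?k M" using e by (intro continuous_intros) auto
  then have "(?k \<longlongrightarrow> 1) (at M)" by (simp add: isCont_def)
  moreover have "\<forall>\<^sub>F y in at M. ?k y = (squash M e y - squash M e M) / (y - M)"
    by (auto simp: eventually_at_filter squash_def)
  ultimately have "((\<lambda>y. (squash M e y - squash M e M) / (y - M)) \<longlongrightarrow> 1) (at M)"
    by (rule Lim_transform_eventually)
  then show ?thesis using equal by (simp add: has_field_derivative_iff squash'_def)
qed

lemma squash_lipschitz: "0 < e \<Longrightarrow> \<bar>squash M e s - squash M e t\<bar> \<le> \<bar>s - t\<bar>"
  using field_differentiable_bound[of UNIV "squash M e" "squash' M e" 1 s t] squash_deriv abs_squash'_le by simp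

section \<open>Square integrable functions on an open set as elements of the Hilbert space\<close>

context bounded_open
begin

definition j :: "('a \<Rightarrow> real) \<Rightarrow> 'a lsq" where "j f = abs_lsq (extend \<Omega> f)"

abbreviation "sqi f \<equiv> square_integrable (lebesgue_on \<Omega>) f"

lemma sqi_rep: "sqi (rep_lsq h)"
proof -
  have "square_integrable lebesgue (extend \<Omega> (rep_lsq h))"
  proof (rule square_integrable_bound[OF square_integrable_rep_lsq])
    have "rep_lsq h \<in> borel_measurable (lebesgue_on \<Omega>)"
      using square_integrable_rep_lsq[of h] by (intro measurable_restrict_space1) (simp add: square_integrable_def)
    then show "extend \<Omega> (rep_lsq h) \<in> borel_measurable lebesgue" by (simp add: measurable_extend)
    show "AE x in lebesgue. \<bar>extend \<Omega> (rep_lsq h) x\<bar> \<le> \<bar>rep_lsq h x\<bar>" by (simp add: extend_def)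
  qed
  then show ?thesis by (simp add: square_integrable_extend)
qed

lemma j_lin:
  assumes "sqi f" "sqi g"
  shows "j (\<lambda>x. f x - c * g x) = j f - c *\<^sub>R j g"
proof -
  have "extend \<Omega> (\<lambda>x. f x - c * g x) = (\<lambda>x. extend \<Omega> f x - c * extend \<Omega> g x)" by (auto simp: extend_def)
  then show ?thesis
    using assms by (simp add: j_def abs_lsq_scaleR abs_lsq_diff square_integrable_extend square_integrable_cmult)
qed

lemma j_zero: "j (\<lambda>x. 0) = 0"
  using j_lin[OF square_integrable_zero square_integrable_zero, of 1] by simp

lemma j_add: "sqi f \<Longrightarrow> sqi g \<Longrightarrow> j (\<lambda>x. f x + g x) = j f + j g"
  using j_lin[of f g "-1"] by simp

lemma j_diff: "sqi f \<Longrightarrow> sqi g \<Longrightarrow> j (\<lambda>x. f x - g x) = j f - j g"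
  using j_lin[of f g 1] by simp

lemma j_scaleR: "sqi f \<Longrightarrow> j (\<lambda>x. c * f x) = c *\<^sub>R j f"
  using j_lin[OF square_integrable_zero, of f "- c"] by (simp add: j_zero)

lemma j_uminus: "sqi f \<Longrightarrow> j (\<lambda>x. - f x) = - j f"
  using j_scaleR[of f "-1"] by simp

lemma sqi_uminus: "sqi f \<Longrightarrow> sqi (\<lambda>x. - f x)"
  using square_integrable_cmult[of "lebesgue_on \<Omega>" f "-1"] by simp

lemma inner_j: "sqi f \<Longrightarrow> sqi g \<Longrightarrow> j f \<bullet> j g = l2_inner \<Omega> f g"
proof -
  assume fg: "sqi f" "sqi g"
  have "(\<lambda>x. extend \<Omega> f x * extend \<Omega> g x) = extend \<Omega> (\<lambda>x. f x * g x)" by (auto simp: extend_def)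
  then show ?thesis
    using fg by (simp add: j_def inner_abs_lsq square_integrable_extend integral_extend l2_inner_def)
qed

lemma norm_j: "sqi f \<Longrightarrow> norm (j f) = l2_norm \<Omega> f"
  using inner_j[of f f] by (simp add: norm_eq_sqrt_inner l2_norm_def l2_inner_def power2_eq_square)

lemma j_eq_iff: "sqi f \<Longrightarrow> sqi g \<Longrightarrow> j f = j g \<longleftrightarrow> (AE x in lebesgue_on \<Omega>. f x = g x)"
proof -
  assume fg: "sqi f" "sqi g"
  have "(AE x in lebesgue. extend \<Omega> f x = extend \<Omega> g x) \<longleftrightarrow> (AE x in lebesgue. x \<in> \<Omega> \<longrightarrow> f x = g x)"
    by (intro eventually_subst always_eventually allI) (auto simp: extend_def)
  then show ?thesis using fg by (simp add: j_def abs_lsq_eq_iff square_integrable_extend AE_on)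
qed

text \<open>Off \<Omega> the extension is 0, which respects the bound because \<open>M\<close> is
  nonnegative.\<close>

lemma j_below_iff: "sqi f \<Longrightarrow> 0 \<le> M \<Longrightarrow> j f \<in> below M \<longleftrightarrow> (AE x in lebesgue_on \<Omega>. f x \<le> M)"
proof -
  assume f: "sqi f" and M: "0 \<le> M"
  have "(AE x in lebesgue. extend \<Omega> f x \<le> M) \<longleftrightarrow> (AE x in lebesgue. x \<in> \<Omega> \<longrightarrow> f x \<le> M)"
    by (intro eventually_subst always_eventually allI) (use M in \<open>auto simp: extend_def\<close>)
  then show ?thesis using f by (simp add: j_def abs_lsq_below_iff square_integrable_extend AE_on)
qed

lemma j_rep_j: "sqi f \<Longrightarrow> j (rep_lsq (j f)) = j f"
proof -
  assume f: "sqi f"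
  have "AE x in lebesgue. rep_lsq (j f) x = extend \<Omega> f x"
    unfolding j_def by (rule rep_abs_lsq) (simp add: square_integrable_extend f)
  then have "AE x in lebesgue_on \<Omega>. rep_lsq (j f) x = f x"
    unfolding AE_on by eventually_elim (simp add: extend_def)
  then show ?thesis using j_eq_iff[OF sqi_rep f] by simp
qed

lemma norm_abs_lsq_mono:
  assumes f: "square_integrable lebesgue f" and g: "square_integrable lebesgue g"
    and le: "AE x in lebesgue. \<bar>f x\<bar> \<le> \<bar>g x\<bar>"
  shows "norm (abs_lsq f) \<le> norm (abs_lsq g)"
proof -
  have "(norm (abs_lsq f))\<^sup>2 \<le> (norm (abs_lsq g))\<^sup>2"
    unfolding norm_abs_lsq[OF f] norm_abs_lsq[OF g]
  proof (rule integral_mono_AE)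
    show "AE x in lebesgue. (f x)\<^sup>2 \<le> (g x)\<^sup>2"
      using le by eventually_elim (simp add: abs_le_square_iff)
  qed (use f g in \<open>auto simp: square_integrable_def\<close>)
  then show ?thesis by (rule power2_le_imp_le) simp
qed

text \<open>The map \<open>h \<mapsto> j (rep_lsq h)\<close> cuts \<open>h\<close> off outside
  \<Omega>; it is the orthogonal projection onto L2 of \<Omega>. Together with
  \<open>j_rep_diff\<close> this bound makes its set of fixed points closed, which is
  \<open>j_rep_lim\<close>.\<close>

lemma norm_j_rep: "norm (j (rep_lsq h)) \<le> norm h"
proof -
  have "norm (abs_lsq (extend \<Omega> (rep_lsq h))) \<le> norm (abs_lsq (rep_lsq h))"
    by (rule norm_abs_lsq_mono)
      (use sqi_rep square_integrable_extend square_integrable_rep_lsq in \<open>auto simp: extend_def\<close>)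
  then show ?thesis by (simp add: j_def)
qed

lemma j_rep_diff: "j (rep_lsq h) - j (rep_lsq k) = j (rep_lsq (h - k))"
proof -
  have "AE x in lebesgue. rep_lsq (abs_lsq (\<lambda>x. rep_lsq h x - rep_lsq k x)) x = rep_lsq h x - rep_lsq k x"
    by (rule rep_abs_lsq) (intro square_integrable_diff square_integrable_rep_lsq)
  then have "AE x in lebesgue. rep_lsq (h - k) x = rep_lsq h x - rep_lsq k x"
    using abs_lsq_diff[of "rep_lsq h" "rep_lsq k"] by (simp add: square_integrable_rep_lsq)
  then have "AE x in lebesgue_on \<Omega>. rep_lsq (h - k) x = rep_lsq h x - rep_lsq k x"
    unfolding AE_on by eventually_elim simp
  then have "j (rep_lsq (h - k)) = j (\<lambda>x. rep_lsq h x - rep_lsq k x)"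
    using j_eq_iff[OF sqi_rep square_integrable_diff[OF sqi_rep sqi_rep]] by simp
  then show ?thesis by (simp add: j_diff sqi_rep)
qed

lemma j_rep_lim:
  assumes "\<And>n. j (rep_lsq (X n)) = X n" "X \<longlonglongrightarrow> h"
  shows "j (rep_lsq h) = h"
proof (rule LIMSEQ_unique)
  have "(\<lambda>n. norm (X n - h)) \<longlonglongrightarrow> 0" using assms(2) by (simp add: tendsto_norm_zero_iff LIM_zero_iff)
  then have "(\<lambda>n. X n - j (rep_lsq h)) \<longlonglongrightarrow> 0"
  proof (rule Lim_null_comparison[rotated], intro always_eventually allI)
    fix n
    have "X n - j (rep_lsq h) = j (rep_lsq (X n - h))" using j_rep_diff[of "X n" h] assms(1) by simp
    then show "norm (X n - j (rep_lsq h)) \<le> norm (X n - h)" using norm_j_rep by metis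
  qed
  then show "X \<longlonglongrightarrow> j (rep_lsq h)" by (rule LIM_zero_cancel)
qed (rule assms)

end

section \<open>The form with Robin and nonlocal boundary terms\<close>

locale robin_form = bounded_open \<Omega> for \<Omega> :: "'a::euclidean_space set" +
  fixes \<kappa> :: "'a measure" and \<theta> :: "('a \<times> 'a) measure"
  assumes \<kappa>: "borel_measure_on (frontier \<Omega>) \<kappa>"
    and \<theta>: "borel_measure_on (offdiag_boundary \<Omega>) \<theta>"
begin

abbreviation "D \<equiv> form_domain \<Omega> \<kappa> \<theta>"
abbreviation "a \<equiv> energy_form \<Omega> \<kappa> \<theta>"
abbreviation "jump u p \<equiv> u (fst p) - u (snd p)"

lemma space_\<kappa>: "space \<kappa> = frontier \<Omega>"
  using \<kappa> sets_eq_imp_space_eq[of \<kappa> "restrict_space borel (frontier \<Omega>)"] by (simp add: borel_measure_on_def space_restrict_space)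

lemma space_\<theta>: "space \<theta> = offdiag_boundary \<Omega>"
  using \<theta> sets_eq_imp_space_eq[of \<theta> "restrict_space borel (offdiag_boundary \<Omega>)"]
  by (simp add: borel_measure_on_def space_restrict_space)

lemma frontier_sub: "frontier \<Omega> \<subseteq> closure \<Omega>"
  by (simp add: frontier_def)

lemma measurable_\<kappa>: "continuous_on (closure \<Omega>) u \<Longrightarrow> u \<in> borel_measurable \<kappa>"
proof -
  assume "continuous_on (closure \<Omega>) u"
  then have "continuous_on (frontier \<Omega>) u" using continuous_on_subset frontier_sub by blast
  then have "u \<in> borel_measurable (restrict_space borel (frontier \<Omega>))" by (rule borel_measurable_continuous_on_restrict)
  then show ?thesis using \<kappa> measurable_cong_sets[of \<kappa> _ borel borel] unfolding borel_measure_on_def by blast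
qed

lemma measurable_\<theta>:
  fixes u :: "'a \<Rightarrow> real"
  assumes u: "continuous_on (closure \<Omega>) u"
  shows "jump u \<in> borel_measurable \<theta>"
proof -
  have "continuous_on (offdiag_boundary \<Omega>) (jump u)"
    by (rule continuous_on_diff; rule continuous_on_compose2[OF u])
      (use frontier_sub in \<open>auto simp: offdiag_boundary_def intro!: continuous_intros\<close>)
  then have "jump u \<in> borel_measurable (restrict_space borel (offdiag_boundary \<Omega>))"
    by (rule borel_measurable_continuous_on_restrict)
  then show ?thesis using \<theta> measurable_cong_sets[of \<theta> _ borel borel] unfolding borel_measure_on_def by blast
qed

text \<open>The closure of \<Omega> is compact, so membership comes down to Sobolev regularity,
  continuity and square integrability for the two boundary measures. Each of these is visibly linear
  and stable under contractions.\<close>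

lemma D_iff:
  "u \<in> D \<longleftrightarrow> u \<in> H1 \<Omega> \<and> continuous_on (closure \<Omega>) u \<and> square_integrable \<kappa> u \<and> square_integrable \<theta> (jump u)"
proof -
  have "compact (closure \<Omega>)" using bounded_\<Omega> by (simp add: compact_closure)
  then have cpt: "compact (closure {x \<in> closure \<Omega>. u x \<noteq> 0})"
    by (metis (no_types, lifting) bounded_subset compact_closure compact_imp_bounded mem_Collect_eq subsetI)
  have "square_integrable \<kappa> u \<longleftrightarrow> (\<integral>\<^sup>+x. ennreal ((u x)\<^sup>2) \<partial>\<kappa>) < \<infinity>"
    "square_integrable \<theta> (jump u) \<longleftrightarrow> (\<integral>\<^sup>+p. ennreal ((jump u p)\<^sup>2) \<partial>\<theta>) < \<infinity>" if "continuous_on (closure \<Omega>) u"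
    using measurable_\<kappa>[OF that] measurable_\<theta>[OF that]
    by (auto simp: square_integrable_def integrable_iff_bounded)
  then show ?thesis using cpt by (auto simp: form_domain_def Cc_closure_def)
qed

lemma D_sqi: "u \<in> D \<Longrightarrow> sqi u" by (simp add: D_iff H1_L2)

lemma D_zero: "(\<lambda>x. 0) \<in> D"
proof -
  have "is_weak_gradient \<Omega> (\<lambda>x. 0) (\<lambda>x. 0)" by (simp add: is_weak_gradient_def)
  then show ?thesis using H1I[OF square_integrable_zero] by (simp add: D_iff square_integrable_zero)
qed

lemma D_lin: "u \<in> D \<Longrightarrow> v \<in> D \<Longrightarrow> (\<lambda>x. u x - c * v x) \<in> D"
proof -
  assume u: "u \<in> D" and v: "v \<in> D"
  have "square_integrable \<theta> (\<lambda>p. jump u p - c * jump v p)"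
    using u v by (intro square_integrable_lin) (auto simp: D_iff)
  then have "square_integrable \<theta> (jump (\<lambda>x. u x - c * v x))" by (simp add: algebra_simps)
  then show ?thesis
    using u v by (auto simp: D_iff intro!: H1_lin square_integrable_lin continuous_on_diff continuous_on_mult_left)
qed

lemma a_sym: "a u v = a v u"
  by (simp add: energy_form_def inner_commute mult.commute)

lemma a_pos: "0 \<le> a u u"
  unfolding energy_form_def by (intro add_nonneg_nonneg Bochner_Integration.integral_nonneg) auto

lemma a_lin:
  assumes u: "u \<in> D" and v: "v \<in> D" and w: "w \<in> D"
  shows "a (\<lambda>x. u x - c * v x) w = a u w - c * a v w"
proof -
  note H = u[unfolded D_iff] v[unfolded D_iff] w[unfolded D_iff]
  have uv: "(\<lambda>x. u x - c * v x) \<in> H1 \<Omega>" using H by (intro H1_lin) auto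
  let ?g = "weak_grad \<Omega>"
  have "(\<integral>x. ?g (\<lambda>x. u x - c * v x) x \<bullet> ?g w x \<partial>lebesgue_on \<Omega>) =
      (\<integral>x. ?g u x \<bullet> ?g w x - c * (?g v x \<bullet> ?g w x) \<partial>lebesgue_on \<Omega>)"
  proof (rule integral_cong_AE)
    have "u \<in> H1 \<Omega>" "v \<in> H1 \<Omega>" "w \<in> H1 \<Omega>" using H by auto
    note [measurable] = this[THEN weak_grad_measurable] weak_grad_measurable[OF uv]
    show "(\<lambda>x. ?g (\<lambda>x. u x - c * v x) x \<bullet> ?g w x) \<in> borel_measurable (lebesgue_on \<Omega>)"
      by measurable
    show "(\<lambda>x. ?g u x \<bullet> ?g w x - c * (?g v x \<bullet> ?g w x)) \<in> borel_measurable (lebesgue_on \<Omega>)"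
      by measurable
    have "AE x in lebesgue_on \<Omega>. ?g (\<lambda>x. u x - c * v x) x = ?g u x - c *\<^sub>R ?g v x"
      using H by (intro weak_grad_lin) auto
    then show "AE x in lebesgue_on \<Omega>. ?g (\<lambda>x. u x - c * v x) x \<bullet> ?g w x = ?g u x \<bullet> ?g w x - c * (?g v x \<bullet> ?g w x)"
      by eventually_elim (simp add: inner_diff_left)
  qed
  also have "\<dots> = (\<integral>x. ?g u x \<bullet> ?g w x \<partial>lebesgue_on \<Omega>) - c * (\<integral>x. ?g v x \<bullet> ?g w x \<partial>lebesgue_on \<Omega>)"
    using H weak_grad_inner_integrable[of u w] weak_grad_inner_integrable[of v w] by simp
  finally have 1: "(\<integral>x. ?g (\<lambda>x. u x - c * v x) x \<bullet> ?g w x \<partial>lebesgue_on \<Omega>) =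
    (\<integral>x. ?g u x \<bullet> ?g w x \<partial>lebesgue_on \<Omega>) - c * (\<integral>x. ?g v x \<bullet> ?g w x \<partial>lebesgue_on \<Omega>)" .
  have bil: "(\<integral>x. (f x - c * g x) * h x \<partial>M) = (\<integral>x. f x * h x \<partial>M) - c * (\<integral>x. g x * h x \<partial>M)"
    if "square_integrable M f" "square_integrable M g" "square_integrable M h" for M :: "'b measure" and f g h
    using square_integrable_mult[OF that(1,3)] square_integrable_mult[OF that(2,3)]
    by (simp add: left_diff_distrib mult.assoc)
  have 2: "(\<integral>x. (u x - c * v x) * w x \<partial>\<kappa>) = (\<integral>x. u x * w x \<partial>\<kappa>) - c * (\<integral>x. v x * w x \<partial>\<kappa>)"
    using H by (intro bil) auto
  have "(\<integral>p. (jump u p - c * jump v p) * jump w p \<partial>\<theta>) = (\<integral>p. jump u p * jump w p \<partial>\<theta>) - c * (\<integral>p. jump v p * jump w p \<partial>\<theta>)"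
    using H by (intro bil) auto
  moreover have "(\<lambda>p. jump (\<lambda>x. u x - c * v x) p * jump w p) = (\<lambda>p. (jump u p - c * jump v p) * jump w p)"
    by (auto simp: algebra_simps)
  ultimately have 3: "(\<integral>p. jump (\<lambda>x. u x - c * v x) p * jump w p \<partial>\<theta>) =
      (\<integral>p. jump u p * jump w p \<partial>\<theta>) - c * (\<integral>p. jump v p * jump w p \<partial>\<theta>)" by (simp only:)
  show ?thesis unfolding energy_form_def 1 2 3 by (simp add: algebra_simps)
qed

sublocale form: symmetric_form D a j
  by unfold_locales (use D_zero D_lin a_sym a_lin a_pos j_lin D_sqi in auto)

text \<open>Every term of the energy decreases for its own reason: the gradient because the slope of
  \<open>squash M e\<close> is at most 1, the integral over \<kappa> because 0 is fixed and so
  absolute values shrink, the integral over \<theta> because differences shrink. The value 0 is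
  fixed since \<open>M\<close> is nonnegative.\<close>

lemma normal_contraction:
  assumes u: "u \<in> D" and e: "0 < e" and M: "0 \<le> M"
  shows "(\<lambda>x. squash M e (u x)) \<in> D" "a (\<lambda>x. squash M e (u x)) (\<lambda>x. squash M e (u x)) \<le> a u u"
proof -
  let ?F = "squash M e" and ?g = "weak_grad \<Omega>"
  let ?w = "\<lambda>x. ?F (u x)"
  have H: "u \<in> H1 \<Omega>" "continuous_on (closure \<Omega>) u" "square_integrable \<kappa> u" "square_integrable \<theta> (jump u)"
    using u by (auto simp: D_iff)
  have F0: "\<bar>?F s\<bar> \<le> \<bar>s\<bar>" for s
    using squash_lipschitz[OF e, of M s 0] squash_eq[OF M, of e] by simp
  have contF: "continuous_on UNIV ?F"
    using squash_deriv[OF e] by (meson DERIV_isCont continuous_at_imp_continuous_on)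
  have cw: "continuous_on (closure \<Omega>) ?w"
    by (rule continuous_on_compose2[OF contF H(2)]) auto
  have sw: "sqi ?w"
  proof (rule square_integrable_bound[OF H1_L2[OF H(1)]])
    have "u \<in> borel_measurable (lebesgue_on \<Omega>)" using H1_L2[OF H(1)] by (simp add: square_integrable_def)
    moreover have "?F \<in> borel_measurable borel" using contF by (intro borel_measurable_continuous_onI)
    ultimately show "?w \<in> borel_measurable (lebesgue_on \<Omega>)" by measurable
  qed (use F0 in simp)
  have "compact (u ` closure \<Omega>)"
    using bounded_\<Omega> H(2) by (intro compact_continuous_image) (simp_all add: compact_closure)
  then obtain B where B: "\<And>x. x \<in> closure \<Omega> \<Longrightarrow> \<bar>u x\<bar> \<le> B"
    using compact_imp_bounded[of "u ` closure \<Omega>"] by (auto simp: bounded_iff)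
  have wg: "is_weak_gradient \<Omega> ?w (\<lambda>x. squash' M e (u x) *\<^sub>R ?g u x)"
  proof (rule H1_chain_rule[OF H(1)])
    show "continuous_on \<Omega> u" using H(2) closure_subset continuous_on_subset by blast
    show "\<bar>u x\<bar> \<le> B" if "x \<in> \<Omega>" for x using B that closure_subset by blast
  qed (use squash_deriv[OF e] abs_squash'_le[OF e] continuous_squash'[OF e] in auto)
  have w1: "?w \<in> H1 \<Omega>" by (rule H1I[OF sw wg])
  have wk: "square_integrable \<kappa> ?w"
    by (rule square_integrable_bound[OF H(3) measurable_\<kappa>[OF cw]]) (use F0 in simp)
  have jl: "\<bar>jump ?w p\<bar> \<le> \<bar>jump u p\<bar>" for p by (rule squash_lipschitz[OF e])
  have wt: "square_integrable \<theta> (jump ?w)"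
    by (rule square_integrable_bound[OF H(4) measurable_\<theta>[OF cw]]) (use jl in simp)
  show "?w \<in> D" using w1 cw wk wt by (simp add: D_iff)
  have "(\<integral>x. ?g ?w x \<bullet> ?g ?w x \<partial>lebesgue_on \<Omega>) \<le> (\<integral>x. ?g u x \<bullet> ?g u x \<partial>lebesgue_on \<Omega>)"
  proof (rule integral_mono_AE)
    show "integrable (lebesgue_on \<Omega>) (\<lambda>x. ?g ?w x \<bullet> ?g ?w x)" "integrable (lebesgue_on \<Omega>) (\<lambda>x. ?g u x \<bullet> ?g u x)"
      by (intro weak_grad_inner_integrable w1 H)+
    show "AE x in lebesgue_on \<Omega>. ?g ?w x \<bullet> ?g ?w x \<le> ?g u x \<bullet> ?g u x"
      using weak_grad_AE[OF sw wg]
    proof eventually_elim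
      fix x assume eq: "?g ?w x = squash' M e (u x) *\<^sub>R ?g u x"
      have "norm (?g ?w x) \<le> norm (?g u x)"
        unfolding eq using abs_squash'_le[OF e, of M "u x"] by (simp add: mult_left_le_one_le)
      then show "?g ?w x \<bullet> ?g ?w x \<le> ?g u x \<bullet> ?g u x" by (simp flip: power2_norm_eq_inner)
    qed
  qed
  moreover have "(\<integral>x. ?w x * ?w x \<partial>\<kappa>) \<le> (\<integral>x. u x * u x \<partial>\<kappa>)"
  proof (rule integral_mono)
    show "?w x * ?w x \<le> u x * u x" for x
      using F0[of "u x"] by (simp only: abs_le_square_iff power2_eq_square)
  qed (use wk H(3) square_integrable_mult in auto)
  moreover have "(\<integral>p. jump ?w p * jump ?w p \<partial>\<theta>) \<le> (\<integral>p. jump u p * jump u p \<partial>\<theta>)"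
  proof (rule integral_mono)
    show "jump ?w p * jump ?w p \<le> jump u p * jump u p" for p
      using jl[of p] by (simp only: abs_le_square_iff power2_eq_square)
  qed (use wt H(4) square_integrable_mult in auto)
  ultimately show "a ?w ?w \<le> a u u" unfolding energy_form_def by (intro add_mono)
qed

lemma res_below:
  assumes c: "0 < c" and M: "0 \<le> M" and g: "g \<in> below M"
  shows "c *\<^sub>R form.rel.res c g \<in> below M"
proof -
  let ?r = "c *\<^sub>R form.rel.res c g"
  have "?r \<in> below (M + e)" if e: "0 < e" for e
  proof (rule form.res_in_closed[OF c closed_below, where F = "\<lambda>u x. squash M e (u x)"])
    fix u assume u: "u \<in> D"
    let ?w = "\<lambda>x. squash M e (u x)"
    show w: "?w \<in> D" and "a ?w ?w \<le> a u u" by (rule normal_contraction[OF u e M])+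
    show "j ?w \<in> below (M + e)"
      using j_below_iff[OF D_sqi[OF w], of "M + e"] squash_le[OF e] M e by simp
    have diff: "j f - g = abs_lsq (\<lambda>x. extend \<Omega> f x - rep_lsq g x)" "square_integrable lebesgue (\<lambda>x. extend \<Omega> f x - rep_lsq g x)"
      if "sqi f" for f
      using abs_lsq_diff[of "extend \<Omega> f" "rep_lsq g"] that
      by (simp_all add: j_def square_integrable_extend square_integrable_rep_lsq square_integrable_diff)
    show "norm (j ?w - g) \<le> norm (j u - g)"
      unfolding diff(1)[OF D_sqi[OF w]] diff(1)[OF D_sqi[OF u]]
    proof (rule norm_abs_lsq_mono[OF diff(2)[OF D_sqi[OF w]] diff(2)[OF D_sqi[OF u]]])
      \<comment> \<open>Off \<Omega> both extensions are 0 and the two sides coincide.\<close>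
      show "AE x in lebesgue. \<bar>extend \<Omega> ?w x - rep_lsq g x\<bar> \<le> \<bar>extend \<Omega> u x - rep_lsq g x\<bar>"
        using g[unfolded below_def mem_Collect_eq]
      proof eventually_elim
        fix x assume "rep_lsq g x \<le> M"
        then show "\<bar>extend \<Omega> ?w x - rep_lsq g x\<bar> \<le> \<bar>extend \<Omega> u x - rep_lsq g x\<bar>"
          using squash_lipschitz[OF e, of M "u x" "rep_lsq g x"] squash_eq[of "rep_lsq g x" M e] by (simp add: extend_def)
      qed
    qed
  qed
  \<comment> \<open>A sequence of excesses keeps the number of exceptional null sets
    countable.\<close>
  then have "AE x in lebesgue. rep_lsq ?r x \<le> M + tick n" for n by (simp add: below_def)
  then have "AE x in lebesgue. \<forall>n. rep_lsq ?r x \<le> M + tick n" by (simp add: AE_all_countable)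
  then have "AE x in lebesgue. rep_lsq ?r x \<le> M"
  proof eventually_elim
    fix x assume x: "\<forall>n. rep_lsq ?r x \<le> M + tick n"
    have "(\<lambda>n. M + tick n) \<longlonglongrightarrow> M + 0" by (intro tendsto_add tendsto_const tick_tendsto)
    then show "rep_lsq ?r x \<le> M" using x by (intro LIMSEQ_le_const[of "\<lambda>n. M + tick n"]) auto
  qed
  then show ?thesis by (simp add: below_def)
qed

lemma S_below:
  assumes "0 \<le> t" "0 \<le> M" "h \<in> form.rel.H0" "h \<in> below M"
  shows "form.rel.S t h \<in> below M"
  by (rule form.rel.S_invariant[OF closed_below convex_below zero_in_below]) (use assms res_below in auto)

section \<open>Density of the form domain\<close>

lemma test_function_D:
  assumes \<phi>: "\<phi> \<in> test_functions \<Omega>"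
  shows "\<phi> \<in> D"
proof -
  have out: "\<phi> x = 0" if "x \<in> frontier \<Omega>" for x
  proof -
    have "x \<notin> \<Omega>" using that open_\<Omega> by (simp add: frontier_def interior_open)
    then have "x \<notin> closure {x. \<phi> x \<noteq> 0}" using \<phi> by (auto simp: test_functions_def)
    then show ?thesis by (rule test_function_outside(1)[OF \<phi>])
  qed
  have c: "continuous_on (closure \<Omega>) \<phi>" by (rule test_function_continuous[OF \<phi>])
  have "square_integrable \<kappa> \<phi>"
    by (rule square_integrable_bound[OF square_integrable_zero measurable_\<kappa>[OF c]])
      (auto simp: space_\<kappa> out intro!: AE_I2)
  moreover have "square_integrable \<theta> (jump \<phi>)"
    by (rule square_integrable_bound[OF square_integrable_zero measurable_\<theta>[OF c]])
      (auto simp: space_\<theta> offdiag_boundary_def out intro!: AE_I2)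
  ultimately show ?thesis using c test_function_H1[OF \<phi>] by (simp add: D_iff)
qed

lemma appr_j_rep: "form.appr us h \<Longrightarrow> j (rep_lsq h) = h"
  by (rule j_rep_lim[OF _ form.appr_lim]) (auto intro: j_rep_j D_sqi form.appr_D)

text \<open>The converse of \<open>dense\<close>: limits of zero extensions are zero extensions, so
  the semigroup does not leave the functions on \<Omega>.\<close>

lemma H0_j_rep: "h \<in> form.rel.H0 \<Longrightarrow> j (rep_lsq h) = h"
proof -
  assume "h \<in> form.rel.H0"
  then obtain X where X: "\<And>n. X n \<in> fst ` form.G" "X \<longlonglongrightarrow> h"
    unfolding form.rel.H0_def closure_sequential by blast
  have "j (rep_lsq (X n)) = X n" for n
    using X(1)[of n] appr_j_rep unfolding form.G_def by auto
  then show ?thesis using X(2) by (rule j_rep_lim)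
qed

text \<open>
  For the zero form the resolvent at \<open>1\<close> is the orthogonal projection onto the closure of \<open>j ` D\<close>; by the
  fundamental lemma the complementary part vanishes on \<open>\<Omega>\<close>.
\<close>

lemma dense:
  assumes f: "sqi f"
  shows "j f \<in> form.rel.H0"
proof -
  interpret z: symmetric_form D "\<lambda>u v. 0" j
    by unfold_locales (use D_zero D_lin j_lin D_sqi in auto)
  obtain u v where uv: "(u, v) \<in> z.G" "v + 1 *\<^sub>R u = j f" using z.rel.surj[of 1 "j f"] by auto
  then obtain us where us: "z.appr us u" "\<And>\<phi>s \<phi>. z.appr \<phi>s \<phi> \<Longrightarrow> (\<lambda>n. 0::real) \<longlonglongrightarrow> v \<bullet> \<phi>"
    unfolding z.G_def by blast
  have orth: "v \<bullet> j \<phi> = 0" if \<phi>: "\<phi> \<in> D" for \<phi>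
  proof -
    have "z.appr (\<lambda>n. \<phi>) (j \<phi>)" using \<phi> by (simp add: z.appr_def)
    from us(2)[OF this] show ?thesis by (simp add: LIMSEQ_const_iff)
  qed
  have u: "j (rep_lsq u) = u"
    by (rule j_rep_lim[OF _ z.appr_lim[OF us(1)]]) (rule j_rep_j[OF D_sqi[OF z.appr_D[OF us(1)]]])
  have vj: "v = j (\<lambda>x. f x - rep_lsq u x)"
    using uv(2) u by (simp add: j_diff f sqi_rep eq_diff_eq)
  let ?w = "\<lambda>x. f x - rep_lsq u x"
  have w: "sqi ?w" by (intro square_integrable_diff f sqi_rep)
  have "AE x in lebesgue_on \<Omega>. ?w x = 0"
  proof (rule fundamental_lemma_on[OF L2_imp_integrable[OF w]])
    fix \<phi> assume \<phi>: "\<phi> \<in> test_functions \<Omega>"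
    show "(\<integral>x. ?w x * \<phi> x \<partial>lebesgue_on \<Omega>) = 0"
      using orth[OF test_function_D[OF \<phi>]] inner_j[OF w D_sqi[OF test_function_D[OF \<phi>]]]
      by (simp add: vj l2_inner_def)
  qed
  then have "v = 0" using j_eq_iff[OF w square_integrable_zero] by (simp add: vj j_zero)
  then have "(\<lambda>n. j (us n)) \<longlonglongrightarrow> j f" using z.appr_lim[OF us(1)] uv(2) by simp
  moreover have "j (us n) \<in> form.rel.H0" for n by (rule form.j_in_H0[OF z.appr_D[OF us(1)]])
  ultimately show ?thesis by (rule closed_sequentially[OF form.rel.closed_H0, rotated])
qed

section \<open>From the Hilbert space back to functions on \<Omega>\<close>

lemma approximates_iff: "approximates \<Omega> D a us u \<longleftrightarrow> sqi u \<and> form.appr us (j u)"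
proof -
  have "(\<lambda>n. l2_norm \<Omega> (\<lambda>x. us n x - u x)) \<longlonglongrightarrow> 0 \<longleftrightarrow> (\<lambda>n. j (us n)) \<longlonglongrightarrow> j u" if "sqi u" "\<forall>n. us n \<in> D"
  proof -
    have "l2_norm \<Omega> (\<lambda>x. us n x - u x) = norm (j (us n) - j u)" for n
      using that norm_j[of "\<lambda>x. us n x - u x"] by (simp add: j_diff D_sqi square_integrable_diff)
    then show ?thesis by (simp add: tendsto_norm_zero_iff LIM_zero_iff)
  qed
  then show ?thesis unfolding approximates_def form.appr_def L2_iff by blast
qed

lemma robin_laplacian_iff: "(f, g) \<in> robin_laplacian \<Omega> \<kappa> \<theta> \<longleftrightarrow> sqi f \<and> sqi g \<and> (j f, - j g) \<in> form.G"
proof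
  assume "(f, g) \<in> robin_laplacian \<Omega> \<kappa> \<theta>"
  then obtain v us where v: "g = (\<lambda>x. - v x)" "sqi v" and us: "approximates \<Omega> D a us f"
    "\<And>\<phi> \<phi>s. approximates \<Omega> D a \<phi>s \<phi> \<Longrightarrow> (\<lambda>n. a (us n) (\<phi>s n)) \<longlonglongrightarrow> l2_inner \<Omega> v \<phi>"
    unfolding robin_laplacian_def form_operator_def L2_iff by blast
  \<comment> \<open>The limit of an approximating sequence is the image under \<open>j\<close> of
    its own representative, so testing with functions reaches every vector that occurs in
    \<open>form.G\<close>.\<close>
  have "(\<lambda>n. a (us n) (\<phi>s n)) \<longlonglongrightarrow> j v \<bullet> \<phi>" if "form.appr \<phi>s \<phi>" for \<phi>s \<phi>
    using us(2)[of \<phi>s "rep_lsq \<phi>"] that appr_j_rep[OF that] inner_j[OF v(2) sqi_rep, of \<phi>]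
    by (simp add: approximates_iff sqi_rep)
  then have "(j f, j v) \<in> form.G" using us(1) unfolding form.G_def approximates_iff by blast
  then show "sqi f \<and> sqi g \<and> (j f, - j g) \<in> form.G"
    using us(1) v by (simp add: approximates_iff j_uminus sqi_uminus)
next
  assume fg: "sqi f \<and> sqi g \<and> (j f, - j g) \<in> form.G"
  let ?v = "\<lambda>x. - g x"
  obtain us where us: "form.appr us (j f)"
    "\<And>\<phi>s \<phi>. form.appr \<phi>s \<phi> \<Longrightarrow> (\<lambda>n. a (us n) (\<phi>s n)) \<longlonglongrightarrow> (- j g) \<bullet> \<phi>"
    using fg unfolding form.G_def by blast
  have v: "sqi ?v" using fg by (simp add: sqi_uminus)
  have "(\<lambda>n. a (us n) (\<phi>s n)) \<longlonglongrightarrow> l2_inner \<Omega> ?v \<phi>" if "approximates \<Omega> D a \<phi>s \<phi>" for \<phi> \<phi>s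
    using us(2)[of \<phi>s "j \<phi>"] that fg inner_j[OF v, of \<phi>] by (simp add: approximates_iff j_uminus)
  moreover have "approximates \<Omega> D a us f" using us(1) fg by (simp add: approximates_iff)
  ultimately show "(f, g) \<in> robin_laplacian \<Omega> \<kappa> \<theta>"
    unfolding robin_laplacian_def form_operator_def L2_iff using v
    by (intro CollectI exI[of _ f] exI[of _ ?v]) auto
qed

text \<open>The result depends on the class of \<open>f\<close> only, as a fixed representative of a
  vector of the Hilbert space. Identities that hold almost everywhere are therefore proved as
  equations between images under \<open>j\<close>.\<close>

definition T :: "real \<Rightarrow> ('a \<Rightarrow> real) \<Rightarrow> 'a \<Rightarrow> real" where
  "T t f = rep_lsq (form.rel.S t (j f))"

lemma sqi_T: "sqi (T t f)" by (simp add: T_def sqi_rep)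

lemma j_T: "0 \<le> t \<Longrightarrow> sqi f \<Longrightarrow> j (T t f) = form.rel.S t (j f)"
  unfolding T_def by (intro H0_j_rep form.rel.S_H0 dense)

lemma T_bounded_operator:
  assumes t: "0 \<le> t"
  shows "bounded_operator \<Omega> (T t)"
  unfolding bounded_operator_def
proof (intro conjI ballI allI impI)
  fix f g :: "'a \<Rightarrow> real" and c :: real
  assume "f \<in> L2 \<Omega>"
  then have f: "sqi f" by (simp add: L2_iff)
  show "T t f \<in> L2 \<Omega>" by (simp add: L2_iff sqi_T)
  have "j (T t (\<lambda>y. c * f y)) = j (\<lambda>x. c * T t f x)"
    by (simp add: j_T j_scaleR t f sqi_T square_integrable_cmult form.rel.S_scaleR dense)
  then show "AE x in lebesgue_on \<Omega>. T t (\<lambda>y. c * f y) x = c * T t f x"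
    by (simp add: j_eq_iff sqi_T square_integrable_cmult)
  assume "g \<in> L2 \<Omega>"
  then have g: "sqi g" by (simp add: L2_iff)
  have "j (T t (\<lambda>y. f y + g y)) = j (\<lambda>x. T t f x + T t g x)"
    by (simp add: j_T j_add t f g sqi_T square_integrable_add form.rel.S_add dense)
  then show "AE x in lebesgue_on \<Omega>. T t (\<lambda>y. f y + g y) x = T t f x + T t g x"
    by (simp add: j_eq_iff sqi_T square_integrable_add)
  assume "AE x in lebesgue_on \<Omega>. f x = g x"
  then have "j f = j g" using j_eq_iff f g by simp
  then show "AE x in lebesgue_on \<Omega>. T t f x = T t g x" by (simp add: T_def)
next
  show "\<exists>C. \<forall>f\<in>L2 \<Omega>. l2_norm \<Omega> (T t f) \<le> C * l2_norm \<Omega> f"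
    using form.rel.norm_S[OF dense t] by (intro exI[of _ 1]) (auto simp: L2_iff norm_j[symmetric] j_T t sqi_T)
qed

lemma T_C0_semigroup: "C0_semigroup \<Omega> T"
  unfolding C0_semigroup_def
proof (intro conjI allI impI ballI)
  show "bounded_operator \<Omega> (T t)" if "0 \<le> t" for t using that by (rule T_bounded_operator)
  fix f assume "f \<in> L2 \<Omega>"
  then have f: "sqi f" by (simp add: L2_iff)
  have "j (T 0 f) = j f" by (simp add: j_T f form.rel.S_0 dense)
  then show "AE x in lebesgue_on \<Omega>. T 0 f x = f x" by (simp add: j_eq_iff sqi_T f)
  show "AE x in lebesgue_on \<Omega>. T (s + t) f x = T s (T t f) x" if "0 \<le> s" "0 \<le> t" for s t
  proof -
    have "j (T (s + t) f) = j (T s (T t f))"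
      using that by (simp add: j_T f sqi_T form.rel.S_plus dense)
    then show ?thesis by (simp add: j_eq_iff sqi_T)
  qed
  have "((\<lambda>t. norm (form.rel.S t (j f) - j f)) \<longlongrightarrow> 0) (at_right 0)"
    using form.rel.S_continuous[OF dense[OF f]] by (simp add: tendsto_norm_zero_iff LIM_zero_iff)
  moreover have "\<forall>\<^sub>F t in at_right 0. norm (form.rel.S t (j f) - j f) = l2_norm \<Omega> (\<lambda>x. T t f x - f x)"
    using eventually_at_right_less[of 0]
    by eventually_elim (simp add: norm_j[symmetric] j_diff sqi_T f square_integrable_diff j_T)
  ultimately show "((\<lambda>t. l2_norm \<Omega> (\<lambda>x. T t f x - f x)) \<longlongrightarrow> 0) (at_right 0)"
    by (rule Lim_transform_eventually)
qed

lemma generator_T: "generator \<Omega> T = robin_laplacian \<Omega> \<kappa> \<theta>"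
proof -
  have "(f, g) \<in> generator \<Omega> T \<longleftrightarrow> (f, g) \<in> robin_laplacian \<Omega> \<kappa> \<theta>" for f g
  proof (cases "sqi f \<and> sqi g")
    case True
    then have f: "sqi f" and g: "sqi g" by auto
    let ?q = "\<lambda>t. (1 / t) *\<^sub>R (form.rel.S t (j f) - j f)"
    have "\<forall>\<^sub>F t in at_right 0. l2_norm \<Omega> (\<lambda>x. (T t f x - f x) / t - g x) = norm (?q t - j g)"
      using eventually_at_right_less[of 0]
    proof eventually_elim
      fix t :: real assume t: "0 < t"
      have d: "sqi (\<lambda>x. T t f x - f x)" by (intro square_integrable_diff sqi_T f)
      have q: "sqi (\<lambda>x. (1 / t) * (T t f x - f x))" by (rule square_integrable_cmult[OF d])
      have "j (\<lambda>x. (1 / t) * (T t f x - f x) - g x) = ?q t - j g"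
        unfolding j_diff[OF q g] j_scaleR[OF d] j_diff[OF sqi_T f] using t f by (simp add: j_T)
      then show "l2_norm \<Omega> (\<lambda>x. (T t f x - f x) / t - g x) = norm (?q t - j g)"
        using norm_j[OF square_integrable_diff[OF q g]] by simp
    qed
    then have "((\<lambda>t. l2_norm \<Omega> (\<lambda>x. (T t f x - f x) / t - g x)) \<longlongrightarrow> 0) (at_right 0) \<longleftrightarrow>
        ((\<lambda>t. norm (?q t - j g)) \<longlongrightarrow> 0) (at_right 0)"
      by (rule tendsto_cong)
    also have "\<dots> \<longleftrightarrow> (?q \<longlongrightarrow> j g) (at_right 0)"
      by (simp only: tendsto_norm_zero_iff LIM_zero_iff)
    also have "\<dots> \<longleftrightarrow> (j f, - j g) \<in> form.rel.D2"
      using form.rel.generator_iff[of "j f" "j g"] dense[OF f] dense[OF g] by simp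
    \<comment> \<open>By \<open>dense\<close> the value \<open>- j g\<close> lies in
      \<open>H0\<close>, so \<open>D2\<close> and \<open>G\<close> agree on such pairs.\<close>
    also have "\<dots> \<longleftrightarrow> (j f, - j g) \<in> form.G"
      using dense[OF g] subspace_neg[OF form.rel.subspace_H0] by (auto simp: form.rel.D2_def)
    finally show ?thesis
      using f g by (simp add: generator_def L2_iff robin_laplacian_iff)
  next
    case False
    then show ?thesis by (auto simp: generator_def L2_iff robin_laplacian_iff)
  qed
  then show ?thesis by auto
qed

lemma T_symmetric: "symmetric_semigroup \<Omega> T"
  unfolding symmetric_semigroup_def L2_iff
  by (auto simp: L2_iff inner_j[symmetric] sqi_T j_T form.rel.S_symmetric dense)

lemma T_upper:
  assumes t: "0 \<le> t" and f: "sqi f" and M: "0 \<le> M" and le: "AE x in lebesgue_on \<Omega>. f x \<le> M"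
  shows "AE x in lebesgue_on \<Omega>. T t f x \<le> M"
  using S_below[OF t M dense[OF f]] j_below_iff[OF f M] j_below_iff[OF sqi_T M, of t f] le
  by (simp add: j_T t f)

lemma T_lower:
  assumes t: "0 \<le> t" and f: "sqi f" and M: "0 \<le> M" and le: "AE x in lebesgue_on \<Omega>. - M \<le> f x"
  shows "AE x in lebesgue_on \<Omega>. - M \<le> T t f x"
proof -
  have nf: "sqi (\<lambda>x. - f x)" using f by (rule sqi_uminus)
  have "AE x in lebesgue_on \<Omega>. - f x \<le> M" using le by eventually_elim simp
  from T_upper[OF t nf M this] have 1: "AE x in lebesgue_on \<Omega>. T t (\<lambda>x. - f x) x \<le> M" .
  have "j (T t (\<lambda>x. - f x)) = j (\<lambda>x. - T t f x)"
    using form.rel.S_scaleR[OF dense[OF f] t, of "-1"] by (simp add: j_T t f nf j_uminus sqi_T)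
  then have "AE x in lebesgue_on \<Omega>. T t (\<lambda>x. - f x) x = - T t f x"
    by (simp add: j_eq_iff sqi_T sqi_uminus)
  with 1 show ?thesis by eventually_elim simp
qed

lemma T_sub_Markovian: "sub_Markovian \<Omega> T"
  unfolding sub_Markovian_def
proof
  show "positive_semigroup \<Omega> T"
    unfolding positive_semigroup_def using T_lower[of _ _ 0] by (simp add: L2_iff)
  show "Linf_contractive \<Omega> T"
    unfolding Linf_contractive_def
  proof (intro allI impI ballI)
    fix t :: real and f assume t: "0 \<le> t" and "f \<in> L2 \<Omega> \<inter> Linf \<Omega>"
    then have f: "sqi f" and fin: "linf_norm \<Omega> f < \<infinity>" by (auto simp: L2_iff Linf_def)
    have m: "(\<lambda>x. ereal \<bar>T t f x\<bar>) \<in> borel_measurable (lebesgue_on \<Omega>)"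
      using sqi_T[of t f] by (auto simp: square_integrable_def)
    have le: "AE x in lebesgue_on \<Omega>. ereal \<bar>f x\<bar> \<le> linf_norm \<Omega> f"
      unfolding linf_norm_def by (rule esssup_AE)
    have "AE x in lebesgue_on \<Omega>. ereal \<bar>T t f x\<bar> \<le> linf_norm \<Omega> f"
    proof (cases "0 \<le> linf_norm \<Omega> f")
      case True
      with fin obtain M where M: "linf_norm \<Omega> f = ereal M" "0 \<le> M" by (cases "linf_norm \<Omega> f") auto
      have "AE x in lebesgue_on \<Omega>. f x \<le> M" "AE x in lebesgue_on \<Omega>. - M \<le> f x"
        using le by (eventually_elim; auto simp: M)+
      from T_upper[OF t f M(2) this(1)] T_lower[OF t f M(2) this(2)]
      show ?thesis by eventually_elim (auto simp: M)
    next
      \<comment> \<open>A negative essential supremum of an absolute value can occur only if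
        \<Omega> is null, and then every statement holds almost everywhere.\<close>
      case False
      have "AE x in lebesgue_on \<Omega>. False"
        using le
      proof eventually_elim
        fix x assume "ereal \<bar>f x\<bar> \<le> linf_norm \<Omega> f"
        moreover have "0 \<le> ereal \<bar>f x\<bar>" by simp
        ultimately show False using False order_trans by blast
      qed
      then show ?thesis by eventually_elim simp
    qed
    with m show "linf_norm \<Omega> (T t f) \<le> linf_norm \<Omega> f"
      unfolding linf_norm_def[of \<Omega> "T t f"] by (rule esssup_I)
  qed
qed

end

theorem proposition4p1:
  fixes \<Omega> :: "'a::euclidean_space set"
    and \<kappa> :: "'a measure"
    and \<theta> :: "('a \<times> 'a) measure"
  assumes "open \<Omega>" and "bounded \<Omega>"
    and "borel_measure_on (frontier \<Omega>) \<kappa>"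
    and "radon_measure_on (offdiag_boundary \<Omega>) \<theta>"
    and "symmetric_measure \<theta>"
    and "admissible \<Omega> \<kappa> \<theta>"
  shows "\<exists>T. generates \<Omega> (robin_laplacian \<Omega> \<kappa> \<theta>) T \<and>
             symmetric_semigroup \<Omega> T \<and> sub_Markovian \<Omega> T"
proof -
  interpret robin_form \<Omega> \<kappa> \<theta>
    using assms(1-4) by unfold_locales (auto simp: radon_measure_on_def)
  show ?thesis
    using T_C0_semigroup generator_T T_symmetric T_sub_Markovian by (auto simp: generates_def)
qed

end
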